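(* Let $w\in\mathrm{BV}_W(\Omega)$, let $\operatorname{TV}(w)=-\int_\Omega\operatorname{div}\phi(x)\,w(x)\,dx$ with some $\phi\in W^{1,\infty}_0(\Omega;\mathbb{R}^d)$ satisfying $\|\phi\|_{L^\infty(\Omega;\mathbb{R}^d)}\le1$, and let $\{(h,\tau_h)\}_h$ be a family of admissible mesh pairs. If $\operatorname{div}\phi\in H^1(\Omega)$, then there is a constant $c(w,\phi)>0$, depending on $w$ and $\phi$ (but not on $h$ and $\tau_h$), such that for all $h$ $$\operatorname{TV}^h\big(R^W_{P0^{\tau_h}}(w)\big)\ge\operatorname{TV}(w)-c(w,\phi)\Big(h^2+h+\frac{\tau_h}{h}\Big).$$
   Context: Setting. $\Omega\subset\mathbb{R}^d$, $d\in\{1,2,3\}$, is a bounded Lipschitz domain that is a finite union of bounded intervals ($d=1$), axis-aligned squares ($d=2$) or axis-aligned cubes ($d=3$). $W\subset\mathbb{Z}$ is a finite nonempty set. $\|\cdot\|$ is the Euclidean norm and $\|\phi\|_{L^\infty(\Omega;\mathbb{R}^d)}=\operatorname{ess\,sup}_{x\in\Omega}\|\phi(x)\|$. For $w\in L^1(\Omega)$, $\operatorname{TV}(w)=\sup\{\int_\Omega w\,\operatorname{div}\phi\,dx : \phi\in C^1_c(\Omega;\mathbb{R}^d),\ \sup_{x}\|\phi(x)\|\le 1\}\in[0,\infty]$; $\mathrm{BV}_W(\Omega)=\{w\in L^1(\Omega): w(x)\in W \text{ for a.a. } x\in\Omega,\ \operatorname{TV}(w)<\infty\}$. Meshes. A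 mesh of $\Omega$ of size $\tau>0$ is a conforming finite element mesh $\mathcal{Q}_\tau$: a finite collection of intervals / axis-aligned squares / axis-aligned cubes of side length $\tau$ with pairwise disjoint interiors, whose union is $\Omega$ up to a Lebesgue null set, and such that two distinct closed cells intersect in the empty set or a common face. A pair $(h,\tau_h)$ with $h>0$ and $\tau_h\in(0,h]$ is an admissible mesh pair if there are given a mesh $\mathcal{Q}_h$ of size $h$ (the TV mesh) and a mesh $\mathcal{Q}_{\tau_h}$ of size $\tau_h$ (the input mesh) such that every cell of $\mathcal{Q}_h$ is a union of cells of $\mathcal{Q}_{\tau_h}$. Families are indexed by $h$ in a set of positive numbers accumulating at $0$. Discretized total variation. For a cell $Q$, $RT0^h(Q)$ is the space of maps $Q\to\mathbb{R}^d$, $x\mapsto (a_i+c_ix_i)_{i=1}^d$ with $a,c\in\mathbb{R}^d$. $RT0^h=\{\phi\in H(\operatorname{div};\Omega):\phi|_Q\in RT0^h(Q)\ \forall Q\in\mathcal{Q}_h\}$, and $RT0^h_0=\{\phi\in RT0^h:(\phi\cdot n)|_{\partial\Omega}\equiv0\}$ with $n$ the outer unit normal of $\Omega$. For $w\in L^1(\Omega)$, $\operatorname{TV}^h(w)=\sup\{\int_\Omega w\operatorname{div}\phi\,dx:\phi\in RT0^h_0,\ \|\phi\|_{L^\infty(\Omega;\mathbb{R}^d)}\le1\}$. Rounding operator. For $w\in \mathrm{BV}_W(\Omega)$ and a mesh $\mathcal{Q}_\tau$, $R^W_{P0^\tau}(w)$ is the function that is constant on each cell $Q\in\mathcal{Q}_\tau$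 with value the minimizer of $\big|\frac1{|Q|}\int_Q w\,dx-\omega\big|$ over all $\omega\in W$ with $|\{x\in Q:w(x)=\omega\}|>0$ (the smallest minimizer if it is not unique). *)

theory Defs
  imports "HOL-Analysis.Analysis" "HOL-Probability.Essential_Supremum"
begin

text \<open>Near every boundary point the set is the strict epigraph, in some direction \<open>e\<close>, of a
  Lipschitz function \<open>\<gamma>\<close> of the coordinates orthogonal to \<open>e\<close>.\<close>

definition lipschitz_boundary :: "'a::euclidean_space set \<Rightarrow> bool" where
  "lipschitz_boundary \<Omega> \<longleftrightarrow>
     (\<forall>x\<in>frontier \<Omega>. \<exists>r>0. \<exists>e L. \<exists>\<gamma> :: 'a \<Rightarrow> real.
        norm e = 1 \<and> L-lipschitz_on {y. y \<bullet> e = 0} \<gamma> \<and>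
        \<Omega> \<inter> ball x r = {y \<in> ball x r. \<gamma> (y - (y \<bullet> e) *\<^sub>R e) < y \<bullet> e})"

definition bounded_lipschitz_domain :: "'a::euclidean_space set \<Rightarrow> bool" where
  "bounded_lipschitz_domain \<Omega> \<longleftrightarrow>
     \<Omega> \<noteq> {} \<and> open \<Omega> \<and> connected \<Omega> \<and> bounded \<Omega> \<and> lipschitz_boundary \<Omega>"

definition is_cell :: "real \<Rightarrow> 'a::euclidean_space set \<Rightarrow> bool" where
  "is_cell s Q \<longleftrightarrow> s > 0 \<and> (\<exists>z. Q = cbox z (z + s *\<^sub>R (\<Sum>b\<in>Basis. b)))"

text \<open>As \<open>\<Omega>\<close> is open and connected, "finite union of cubes" is understood for the closures.
  The cubes may overlap and have different side lengths.\<close>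

definition finite_union_of_cubes :: "'a::euclidean_space set \<Rightarrow> bool" where
  "finite_union_of_cubes \<Omega> \<longleftrightarrow>
     (\<exists>\<C>. finite \<C> \<and> (\<forall>C\<in>\<C>. \<exists>s. is_cell s C) \<and> closure \<Omega> = \<Union>\<C>)"

text \<open>Elements of Lebesgue and Sobolev spaces are represented by functions on the whole space of
  which only the values almost everywhere in \<open>\<Omega>\<close> matter.\<close>

definition L1 :: "'a::euclidean_space set \<Rightarrow> ('a \<Rightarrow> 'b::euclidean_space) set" where
  "L1 \<Omega> = {f. integrable (lebesgue_on \<Omega>) f}"

definition L2 :: "'a::euclidean_space set \<Rightarrow> ('a \<Rightarrow> 'b::euclidean_space) set" where
  "L2 \<Omega> = {f \<in> borel_measurable (lebesgue_on \<Omega>).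
              integrable (lebesgue_on \<Omega>) (\<lambda>x. (norm (f x))\<^sup>2)}"

definition Linf_norm :: "'a::euclidean_space set \<Rightarrow> ('a \<Rightarrow> 'b::euclidean_space) \<Rightarrow> ereal" where
  "Linf_norm \<Omega> f = esssup (lebesgue_on \<Omega>) (\<lambda>x. ereal (norm (f x)))"

definition Linf :: "'a::euclidean_space set \<Rightarrow> ('a \<Rightarrow> 'b::euclidean_space) set" where
  "Linf \<Omega> = {f \<in> borel_measurable (lebesgue_on \<Omega>). Linf_norm \<Omega> f < \<infinity>}"

definition locally_integrable :: "'a::euclidean_space set \<Rightarrow> ('a \<Rightarrow> 'b::euclidean_space) \<Rightarrow> bool" where
  "locally_integrable \<Omega> f \<longleftrightarrow> (\<forall>K. compact K \<and> K \<subseteq> \<Omega> \<longrightarrow> integrable (lebesgue_on K) f)"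

definition C1_c :: "'a::euclidean_space set \<Rightarrow> ('a \<Rightarrow> 'b::euclidean_space) set" where
  "C1_c \<Omega> = {f. (\<forall>x\<in>\<Omega>. f differentiable (at x)) \<and>
                (\<forall>v. continuous_on \<Omega> (\<lambda>x. frechet_derivative f (at x) v)) \<and>
                (\<exists>K. compact K \<and> K \<subseteq> \<Omega> \<and> (\<forall>x\<in>\<Omega> - K. f x = 0))}"

definition grad :: "('a::euclidean_space \<Rightarrow> real) \<Rightarrow> 'a \<Rightarrow> 'a" where
  "grad \<psi> x = (\<Sum>b\<in>Basis. frechet_derivative \<psi> (at x) b *\<^sub>R b)"

definition divergence :: "('a::euclidean_space \<Rightarrow> 'a) \<Rightarrow> 'a \<Rightarrow> real" where
  "divergence \<phi> x = (\<Sum>b\<in>Basis. frechet_derivative \<phi> (at x) b \<bullet> b)"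

text \<open>Weak derivatives are tested with \<open>C\<^sup>1\<close> functions of compact support, and \<open>W\<^sub>0\<close>-spaces are
  closures of such functions, as in Gilbarg and Trudinger; by mollification this is the same as
  using \<open>C\<^sup>\<infinity>\<close> functions of compact support.\<close>

definition weak_partial ::
    "'a::euclidean_space set \<Rightarrow> 'a \<Rightarrow> ('a \<Rightarrow> real) \<Rightarrow> ('a \<Rightarrow> real) \<Rightarrow> bool" where
  "weak_partial \<Omega> b u v \<longleftrightarrow> locally_integrable \<Omega> u \<and> locally_integrable \<Omega> v \<and>
     (\<forall>\<psi>\<in>C1_c \<Omega>. (LINT x|lebesgue_on \<Omega>. u x * frechet_derivative \<psi> (at x) b)
                = - (LINT x|lebesgue_on \<Omega>. v x * \<psi> x))"

text \<open>\<open>weak_div \<Omega> \<phi> g\<close>: the function \<open>g\<close> is a version of the distributional divergence of \<open>\<phi>\<close>.\<close>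

definition weak_div ::
    "'a::euclidean_space set \<Rightarrow> ('a \<Rightarrow> 'a) \<Rightarrow> ('a \<Rightarrow> real) \<Rightarrow> bool" where
  "weak_div \<Omega> \<phi> g \<longleftrightarrow> locally_integrable \<Omega> \<phi> \<and> locally_integrable \<Omega> g \<and>
     (\<forall>\<psi>\<in>C1_c \<Omega>. (LINT x|lebesgue_on \<Omega>. \<phi> x \<bullet> grad \<psi> x)
                = - (LINT x|lebesgue_on \<Omega>. g x * \<psi> x))"

text \<open>First-order Sobolev space over \<open>X\<close>: with \<open>X = L\<^sup>p(\<Omega>)\<close> this is \<open>W\<^sup>1\<^sup>,\<^sup>p(\<Omega>)\<close>.\<close>

definition sobolev1 ::
    "'a::euclidean_space set \<Rightarrow> ('a \<Rightarrow> real) set \<Rightarrow> ('a \<Rightarrow> real) set" where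
  "sobolev1 \<Omega> X = {u \<in> X. \<forall>b\<in>Basis. \<exists>v\<in>X. weak_partial \<Omega> b u v}"

definition H1 :: "'a::euclidean_space set \<Rightarrow> ('a \<Rightarrow> real) set" where
  "H1 \<Omega> = sobolev1 \<Omega> (L2 \<Omega>)"

definition W11_0 :: "'a::euclidean_space set \<Rightarrow> ('a \<Rightarrow> real) set" where
  "W11_0 \<Omega> = {u \<in> L1 \<Omega>. \<exists>D. (\<forall>b\<in>Basis. D b \<in> L1 \<Omega> \<and> weak_partial \<Omega> b u (D b)) \<and>
     (\<exists>\<psi>. (\<forall>n::nat. \<psi> n \<in> C1_c \<Omega>) \<and>
        (\<lambda>n. LINT x|lebesgue_on \<Omega>. \<bar>\<psi> n x - u x\<bar>) \<longlonglongrightarrow> 0 \<and>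
        (\<forall>b\<in>Basis.
          (\<lambda>n. LINT x|lebesgue_on \<Omega>. \<bar>frechet_derivative (\<psi> n) (at x) b - D b x\<bar>) \<longlonglongrightarrow> 0))}"

text \<open>\<open>W\<^sub>0\<^sup>1\<^sup>,\<^sup>\<infinity>\<close> is \<open>W\<^sup>1\<^sup>,\<^sup>\<infinity> \<inter> W\<^sub>0\<^sup>1\<^sup>,\<^sup>1\<close>, the functions in \<open>W\<^sup>1\<^sup>,\<^sup>\<infinity>\<close> with zero trace (the closure of
  smooth functions with respect to the \<open>W\<^sup>1\<^sup>,\<^sup>\<infinity>\<close>-norm would be a smaller space).\<close>

definition W1inf_0 :: "'a::euclidean_space set \<Rightarrow> ('a \<Rightarrow> 'a) set" where
  "W1inf_0 \<Omega> = {\<phi>. \<forall>i\<in>Basis. (\<lambda>x. \<phi> x \<bullet> i) \<in> sobolev1 \<Omega> (Linf \<Omega>) \<inter> W11_0 \<Omega>}"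

definition Hdiv :: "'a::euclidean_space set \<Rightarrow> ('a \<Rightarrow> 'a) set" where
  "Hdiv \<Omega> = {\<phi> \<in> L2 \<Omega>. \<exists>g\<in>L2 \<Omega>. weak_div \<Omega> \<phi> g}"

definition TV :: "'a::euclidean_space set \<Rightarrow> ('a \<Rightarrow> real) \<Rightarrow> ereal" where
  "TV \<Omega> w = Sup {ereal (LINT x|lebesgue_on \<Omega>. w x * divergence \<phi> x) | \<phi>.
                    \<phi> \<in> C1_c \<Omega> \<and> (\<forall>x\<in>\<Omega>. norm (\<phi> x) \<le> 1)}"

definition BV_W :: "int set \<Rightarrow> 'a::euclidean_space set \<Rightarrow> ('a \<Rightarrow> real) set" where
  "BV_W W \<Omega> = {w \<in> L1 \<Omega>. (AE x in lebesgue_on \<Omega>. w x \<in> real_of_int ` W) \<and> TV \<Omega> w < \<infinity>}"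

definition is_mesh :: "'a::euclidean_space set \<Rightarrow> real \<Rightarrow> 'a set set \<Rightarrow> bool" where
  "is_mesh \<Omega> s \<Q> \<longleftrightarrow> s > 0 \<and> finite \<Q> \<and> (\<forall>Q\<in>\<Q>. is_cell s Q) \<and>
     (\<forall>Q\<in>\<Q>. \<forall>Q'\<in>\<Q>. Q \<noteq> Q' \<longrightarrow> interior Q \<inter> interior Q' = {} \<and>
        (Q \<inter> Q' = {} \<or> (Q \<inter> Q') face_of Q \<and> (Q \<inter> Q') face_of Q')) \<and>
     negligible ((\<Union>\<Q> - \<Omega>) \<union> (\<Omega> - \<Union>\<Q>))"

definition admissible_mesh_pair ::
    "'a::euclidean_space set \<Rightarrow> real \<Rightarrow> real \<Rightarrow> 'a set set \<Rightarrow> 'a set set \<Rightarrow> bool" where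
  "admissible_mesh_pair \<Omega> h t \<Q> \<P> \<longleftrightarrow> h > 0 \<and> 0 < t \<and> t \<le> h \<and>
     is_mesh \<Omega> h \<Q> \<and> is_mesh \<Omega> t \<P> \<and> (\<forall>Q\<in>\<Q>. \<exists>\<S>\<subseteq>\<P>. Q = \<Union>\<S>)"

text \<open>For \<open>h \<in> H\<close>, the TV mesh is \<open>\<Q> h\<close> and the input mesh is \<open>\<P> h\<close>, of size \<open>\<tau> h\<close>.\<close>

definition admissible_family ::
    "'a::euclidean_space set \<Rightarrow> real set \<Rightarrow> (real \<Rightarrow> real) \<Rightarrow>
     (real \<Rightarrow> 'a set set) \<Rightarrow> (real \<Rightarrow> 'a set set) \<Rightarrow> bool" where
  "admissible_family \<Omega> H \<tau> \<Q> \<P> \<longleftrightarrow> H \<subseteq> {0<..} \<and> 0 islimpt H \<and>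
     (\<forall>h\<in>H. admissible_mesh_pair \<Omega> h (\<tau> h) (\<Q> h) (\<P> h))"

definition RT0_local :: "('a::euclidean_space \<Rightarrow> 'a) set" where
  "RT0_local = {p. \<exists>a c. p = (\<lambda>x. \<Sum>i\<in>Basis. (a \<bullet> i + (c \<bullet> i) * (x \<bullet> i)) *\<^sub>R i)}"

definition RT0 :: "'a::euclidean_space set \<Rightarrow> 'a set set \<Rightarrow> ('a \<Rightarrow> 'a) set" where
  "RT0 \<Omega> \<Q> = {\<phi> \<in> Hdiv \<Omega>. \<forall>Q\<in>\<Q>. \<exists>p\<in>RT0_local. AE x in lebesgue_on Q. \<phi> x = p x}"

text \<open>The outer unit normal is only used for unions of cubes, for which it exists at exactly those
  boundary points near which the domain is a half space; the remaining boundary points (edges and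
  corners) form a null set of the boundary.\<close>

definition outer_unit_normal :: "'a::euclidean_space set \<Rightarrow> 'a \<Rightarrow> 'a \<Rightarrow> bool" where
  "outer_unit_normal \<Omega> x n \<longleftrightarrow> x \<in> frontier \<Omega> \<and> norm n = 1 \<and>
     (\<exists>r>0. \<Omega> \<inter> ball x r = {y \<in> ball x r. (y - x) \<bullet> n < 0})"

text \<open>The boundary values of a Raviart-Thomas function are those of its continuous version on each
  closed cell.\<close>

definition RT0_0 :: "'a::euclidean_space set \<Rightarrow> 'a set set \<Rightarrow> ('a \<Rightarrow> 'a) set" where
  "RT0_0 \<Omega> \<Q> = {\<phi> \<in> RT0 \<Omega> \<Q>.
     \<forall>Q\<in>\<Q>. \<forall>p\<in>RT0_local. (AE x in lebesgue_on Q. \<phi> x = p x) \<longrightarrow>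
       (\<forall>x\<in>Q. \<forall>n. outer_unit_normal \<Omega> x n \<longrightarrow> p x \<bullet> n = 0)}"

definition TV_h :: "'a::euclidean_space set \<Rightarrow> 'a set set \<Rightarrow> ('a \<Rightarrow> real) \<Rightarrow> ereal" where
  "TV_h \<Omega> \<Q> w = Sup {ereal (LINT x|lebesgue_on \<Omega>. w x * g x) | \<phi> g.
                        \<phi> \<in> RT0_0 \<Omega> \<Q> \<and> weak_div \<Omega> \<phi> g \<and> Linf_norm \<Omega> \<phi> \<le> 1}"

definition cell_mean :: "('a::euclidean_space \<Rightarrow> real) \<Rightarrow> 'a set \<Rightarrow> real" where
  "cell_mean w Q = (1 / measure lebesgue Q) * (LINT x|lebesgue_on Q. w x)"

definition attained_values :: "int set \<Rightarrow> ('a::euclidean_space \<Rightarrow> real) \<Rightarrow> 'a set \<Rightarrow> int set" where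
  "attained_values W w Q = {\<omega>\<in>W. emeasure lebesgue {x\<in>Q. w x = real_of_int \<omega>} > 0}"

definition cell_round :: "int set \<Rightarrow> ('a::euclidean_space \<Rightarrow> real) \<Rightarrow> 'a set \<Rightarrow> int" where
  "cell_round W w Q = Min {\<omega>. is_arg_min (\<lambda>\<omega>. \<bar>cell_mean w Q - real_of_int \<omega>\<bar>)
                                          (\<lambda>\<omega>. \<omega> \<in> attained_values W w Q) \<omega>}"

text \<open>The value on the null set of points that are in no cell interior is immaterial.\<close>

definition rounding ::
    "int set \<Rightarrow> 'a::euclidean_space set set \<Rightarrow> ('a \<Rightarrow> real) \<Rightarrow> 'a \<Rightarrow> real" where
  "rounding W \<P> w x =
     (if \<exists>Q\<in>\<P>. x \<in> interior Q
      then real_of_int (cell_round W w (THE Q. Q \<in> \<P> \<and> x \<in> interior Q)) else 0)"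

end

theory Submission
  imports Defs
begin

text \<open>The competitor for \<open>TV\<^sup>h\<close> is the Raviart-Thomas interpolant of \<open>-\<phi>\<close>, scaled down so that its
  norm is at most \<open>1\<close>. On a cell of side \<open>h\<close> a face flux of \<open>\<phi>\<close> differs from the cell mean by at most
  \<open>h \<parallel>D\<phi>\<parallel>\<^sub>\<infinity>\<close>, and the cell mean has norm at most \<open>1\<close>, so the scaling factor is \<open>1 / (1 + O(h))\<close>. The
  divergence of the interpolant is the cell mean of \<open>div \<phi>\<close>. Replacing \<open>div \<phi>\<close> by its cell means, and
  \<open>w\<close> by its rounding, costs at most \<open>\<parallel>div \<phi>\<parallel>\<^sub>\<infinity>\<close> times the \<open>L\<^sup>1\<close> distance of \<open>w\<close> to its cell
  means on the two meshes (up to constants), because the rounded value is at least as close to the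
  cell mean as \<open>w\<close> itself. By the Poincare inequality for functions of bounded variation this is
  \<open>O(h TV(w))\<close>, so the total error is \<open>O(h)\<close>.

  Face fluxes are defined by volume integrals over a cell. For \<open>C\<^sup>1\<close> functions they are face
  integrals, hence agree from both sides of a face and vanish on the boundary; both properties
  pass to the \<open>W\<^sup>1\<^sup>,\<^sup>1\<close> limit, so no trace theorem is needed.\<close>

section \<open>Continuously differentiable functions and test functions\<close>

text \<open>\<open>TV\<close> is known only as a supremum over smooth fields, and \<open>w\<close>
  is never approximated by smooth functions. The Poincare inequality is therefore reduced to
  translations: on a cell, \<open>w\<close> minus its mean is an average of differences
  \<open>w x - w y\<close>, and the \<open>L1\<close> size of a translation difference is found by
  pairing it with a \<open>C1\<close> function, onto which the translation is moved and where it can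
  be differentiated. All cells are treated at once, so that only the total variation over the whole
  of \<Omega> enters and \<open>TV\<close> never has to be localised.

  One constant \<open>K = d M\<close>, with \<open>d\<close> the dimension and \<open>M\<close> a
  bound for the derivative of each component of \<phi> along its own direction, does two jobs: it
  bounds the divergence, and \<open>1 + K h\<close> bounds the norm of the unscaled interpolant.
  Diagonal derivatives suffice because component \<open>k\<close> of a Raviart-Thomas field varies
  in direction \<open>k\<close> only.\<close>

definition C1_fun :: "('a::euclidean_space \<Rightarrow> 'b::euclidean_space) \<Rightarrow> bool" where
  "C1_fun f \<longleftrightarrow> (\<forall>x. f differentiable (at x)) \<and>
     (\<forall>v. continuous_on UNIV (\<lambda>x. frechet_derivative f (at x) v))"

text \<open>\<open>C1_c\<close> leaves the values outside \<Omega> arbitrary. Here the function is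
  smooth on the whole space and vanishes off the compact set, so it can be translated and integrated
  over the whole space.\<close>

definition test_fun :: "'a::euclidean_space set \<Rightarrow> ('a \<Rightarrow> 'b::euclidean_space) set" where
  "test_fun U = {f. C1_fun f \<and> (\<exists>K. compact K \<and> K \<subseteq> U \<and> (\<forall>x. x \<notin> K \<longrightarrow> f x = 0))}"

lemma C1_funI:
  assumes "\<And>x. (f has_derivative f' x) (at x)" "\<And>v. continuous_on UNIV (\<lambda>x. f' x v)"
  shows "C1_fun f"
proof -
  have "frechet_derivative f (at x) = f' x" for x
    using frechet_derivative_at[OF assms(1)] by simp
  then show ?thesis
    unfolding C1_fun_def using assms by (auto simp: differentiable_def)
qed

lemma C1_fun_has_derivative:
  "C1_fun f \<Longrightarrow> (f has_derivative frechet_derivative f (at x)) (at x)"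
  unfolding C1_fun_def by (simp add: frechet_derivative_works)

lemma C1_fun_cont_deriv: "C1_fun f \<Longrightarrow> continuous_on UNIV (\<lambda>x. frechet_derivative f (at x) v)"
  unfolding C1_fun_def by simp

lemma C1_fun_continuous: "C1_fun f \<Longrightarrow> continuous_on S f"
  unfolding C1_fun_def
  by (meson differentiable_imp_continuous_within continuous_at_imp_continuous_on)

lemma C1_fun_const [intro!]: "C1_fun (\<lambda>x. c)"
  by (rule C1_funI[where f'="\<lambda>x v. 0"]) auto

lemma C1_fun_linear [intro]: "bounded_linear f \<Longrightarrow> C1_fun f"
  by (rule C1_funI[where f'="\<lambda>x. f"]) (auto simp: bounded_linear_imp_has_derivative)

lemma C1_fun_add [intro]: "C1_fun f \<Longrightarrow> C1_fun g \<Longrightarrow> C1_fun (\<lambda>x. f x + g x)"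
  by (rule C1_funI[OF has_derivative_add[OF C1_fun_has_derivative C1_fun_has_derivative]])
     (auto intro!: continuous_intros C1_fun_cont_deriv)

lemma C1_fun_scaleR [intro]:
  fixes f :: "'a::euclidean_space \<Rightarrow> real"
  assumes "C1_fun f" "C1_fun g" shows "C1_fun (\<lambda>x. f x *\<^sub>R g x)"
proof (rule C1_funI[OF has_derivative_scaleR[OF C1_fun_has_derivative C1_fun_has_derivative]])
  fix v
  note c = C1_fun_cont_deriv[of f] C1_fun_cont_deriv[of g] C1_fun_continuous[of f] C1_fun_continuous[of g]
  show "continuous_on UNIV (\<lambda>x. f x *\<^sub>R frechet_derivative g (at x) v + frechet_derivative f (at x) v *\<^sub>R g x)"
    by (rule continuous_on_add; rule continuous_on_scaleR; simp add: c assms)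
qed (fact assms)+

lemma C1_fun_mult [intro]:
  fixes f g :: "'a::euclidean_space \<Rightarrow> real"
  shows "C1_fun f \<Longrightarrow> C1_fun g \<Longrightarrow> C1_fun (\<lambda>x. f x * g x)"
  using C1_fun_scaleR[of f g] by simp

lemma C1_fun_sum [intro]: "(\<And>i. i \<in> I \<Longrightarrow> C1_fun (f i)) \<Longrightarrow> C1_fun (\<lambda>x. \<Sum>i\<in>I. f i x)"
  by (induction I rule: infinite_finite_induct) auto

lemma C1_fun_prod:
  fixes f :: "'i \<Rightarrow> 'a::euclidean_space \<Rightarrow> real"
  shows "(\<And>i. i \<in> I \<Longrightarrow> C1_fun (f i)) \<Longrightarrow> C1_fun (\<lambda>x. \<Prod>i\<in>I. f i x)"
  by (induction I rule: infinite_finite_induct) auto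

lemma C1_fun_compose_real:
  fixes f :: "'a::euclidean_space \<Rightarrow> real"
  assumes "C1_fun f" "\<And>t. (\<beta> has_real_derivative \<beta>' t) (at t)" "continuous_on UNIV \<beta>'"
  shows "C1_fun (\<lambda>x. \<beta> (f x))"
proof (rule C1_funI)
  fix x
  show "((\<lambda>x. \<beta> (f x)) has_derivative (\<lambda>v. frechet_derivative f (at x) v * \<beta>' (f x))) (at x)"
    using DERIV_compose_FDERIV[OF assms(2) C1_fun_has_derivative[OF assms(1)]] .
next
  fix v
  have "continuous_on UNIV (\<lambda>x. \<beta>' (f x))"
    using continuous_on_compose2[OF assms(3) C1_fun_continuous[OF assms(1)]] by auto
  then show "continuous_on UNIV (\<lambda>x. frechet_derivative f (at x) v * \<beta>' (f x))"
    by (intro continuous_intros C1_fun_cont_deriv assms)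
qed

lemma C1_fun_compose_translation:
  assumes "C1_fun f" shows "C1_fun (\<lambda>x. f (x + a))"
    and "frechet_derivative (\<lambda>x. f (x + a)) (at x) v = frechet_derivative f (at (x + a)) v"
proof -
  have *: "((\<lambda>x. f (x + a)) has_derivative frechet_derivative f (at (x + a))) (at x)" for x
  proof -
    have "((\<lambda>x. x + a) has_derivative (\<lambda>x. x)) (at x)" by (auto intro!: derivative_eq_intros)
    then show ?thesis
      using has_derivative_compose[of "\<lambda>x. x + a" "\<lambda>x. x" x UNIV f "frechet_derivative f (at (x+a))"]
        C1_fun_has_derivative[OF assms, of "x+a"] by simp
  qed
  have "continuous_on UNIV (\<lambda>x. frechet_derivative f (at (x + a)) v)" for v
    by (rule continuous_on_compose2[OF C1_fun_cont_deriv[OF assms, of v], of UNIV "\<lambda>x. x + a"])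
       (auto intro!: continuous_intros)
  then show "C1_fun (\<lambda>x. f (x + a))" using * by (intro C1_funI) 
  show "frechet_derivative (\<lambda>x. f (x + a)) (at x) v = frechet_derivative f (at (x + a)) v"
    using frechet_derivative_at[OF *, of x] by simp
qed

lemma test_fun_imp_C1_c: "f \<in> test_fun U \<Longrightarrow> f \<in> C1_c U"
  unfolding test_fun_def C1_c_def C1_fun_def by (blast intro: continuous_on_subset)

lemma test_funD: "f \<in> test_fun U \<Longrightarrow> C1_fun f"
  unfolding test_fun_def by auto

lemma test_fun_eq_0: "f \<in> test_fun U \<Longrightarrow> x \<notin> U \<Longrightarrow> f x = 0"
  unfolding test_fun_def by auto

lemma test_fun_deriv_support:
  assumes "C1_fun f" "closed K" "\<And>x. x \<notin> K \<Longrightarrow> f x = 0" "x \<notin> K"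
  shows "frechet_derivative f (at x) v = 0"
proof -
  have "((\<lambda>x. 0) has_derivative (\<lambda>v. 0)) (at x)" by simp
  then have "(f has_derivative (\<lambda>v. 0)) (at x)"
    by (rule has_derivative_transform_within_open[where s="-K"]) (use assms in auto)
  then show ?thesis using frechet_derivative_at by metis
qed

lemma compact_support_bounded:
  fixes f :: "'a::euclidean_space \<Rightarrow> 'b::euclidean_space"
  assumes "continuous_on UNIV f" "compact K" "\<And>x. x \<notin> K \<Longrightarrow> f x = 0"
  obtains B where "B \<ge> 0" "\<And>x. norm (f x) \<le> B"
proof -
  have "bounded (f ` K)"
    using assms by (meson compact_continuous_image compact_imp_bounded continuous_on_subset subset_UNIV)
  then obtain B where "B > 0" "\<And>x. x \<in> K \<Longrightarrow> norm (f x) \<le> B"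
    unfolding bounded_pos by auto
  then show ?thesis using assms(3) that[of B] by (metis less_imp_le norm_zero)
qed

lemma compact_support_integrable:
  fixes f :: "'a::euclidean_space \<Rightarrow> 'b::euclidean_space"
  assumes "continuous_on UNIV f" "compact K" "\<And>x. x \<notin> K \<Longrightarrow> f x = 0"
  shows "integrable lborel f"
proof -
  have "(\<lambda>x. indicator K x *\<^sub>R f x) = f" using assms(3) by (auto simp: indicator_def)
  then show ?thesis
    using borel_integrable_compact[OF assms(2), of f] assms(1) continuous_on_subset
    by (metis subset_UNIV)
qed

text \<open>Extension by zero is \<open>C1\<close> on each of the two open sets \<Omega> and
  \<open>- K\<close>, and these cover the space.\<close>

lemma C1_c_extend:
  fixes f :: "'a::euclidean_space \<Rightarrow> 'b::euclidean_space"
  assumes "open \<Omega>" "f \<in> C1_c \<Omega>"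
  defines "g \<equiv> (\<lambda>x. if x \<in> \<Omega> then f x else 0)"
  shows "g \<in> test_fun \<Omega>"
    and "x \<in> \<Omega> \<Longrightarrow> frechet_derivative g (at x) v = frechet_derivative f (at x) v"
proof -
  obtain K where K: "compact K" "K \<subseteq> \<Omega>" "\<forall>x\<in>\<Omega> - K. f x = 0"
    and f: "\<And>x. x \<in> \<Omega> \<Longrightarrow> f differentiable (at x)"
    and c: "\<And>v. continuous_on \<Omega> (\<lambda>x. frechet_derivative f (at x) v)"
    using assms(2) unfolding C1_c_def by blast
  have g0: "g x = 0" if "x \<notin> K" for x using K that by (auto simp: g_def)
  have oK: "open (-K)" using K by (auto dest: compact_imp_closed)
  have d1: "(g has_derivative frechet_derivative f (at x)) (at x)" if "x \<in> \<Omega>" for x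
    using f[OF that] unfolding frechet_derivative_works
    by (rule has_derivative_transform_within_open[where s=\<Omega>]) (use assms(1) that in \<open>auto simp: g_def\<close>)
  have d2: "(g has_derivative (\<lambda>v. 0)) (at x)" if "x \<notin> K" for x
    by (rule has_derivative_transform_within_open[where s="-K" and f="\<lambda>x. 0"])
       (use oK that g0 in auto)
  have fd1: "frechet_derivative g (at x) = frechet_derivative f (at x)" if "x \<in> \<Omega>" for x
    using frechet_derivative_at[OF d1[OF that]] by simp
  have fd2: "frechet_derivative g (at x) = (\<lambda>v. 0)" if "x \<notin> K" for x
    using frechet_derivative_at[OF d2[OF that]] by simp
  have "C1_fun g"
    unfolding C1_fun_def
  proof safe
    fix x show "g differentiable (at x)" using d1 d2 K(2) by (cases "x \<in> \<Omega>") (auto simp: differentiable_def)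
  next
    fix v
    have "continuous_on (\<Omega> \<union> -K) (\<lambda>x. frechet_derivative g (at x) v)"
    proof (rule continuous_on_open_Un[OF assms(1) oK])
      show "continuous_on \<Omega> (\<lambda>x. frechet_derivative g (at x) v)"
        using c[of v] by (rule continuous_on_eq) (simp add: fd1)
      show "continuous_on (-K) (\<lambda>x. frechet_derivative g (at x) v)"
        by (rule continuous_on_eq[OF continuous_on_const[of _ 0]]) (simp add: fd2)
    qed
    moreover have "\<Omega> \<union> -K = UNIV" using K by auto
    ultimately show "continuous_on UNIV (\<lambda>x. frechet_derivative g (at x) v)" by simp
  qed
  then show "g \<in> test_fun \<Omega>" using K g0 unfolding test_fun_def by blast
  show "x \<in> \<Omega> \<Longrightarrow> frechet_derivative g (at x) v = frechet_derivative f (at x) v"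
    using fd1 by simp
qed

section \<open>The \<open>L\<^sup>1\<close> norm by duality with test functions\<close>

lemma C1_fun_real_polynomial:
  fixes p :: "'a::euclidean_space \<Rightarrow> real"
  shows "real_polynomial_function p \<Longrightarrow> C1_fun p"
  by (induction rule: real_polynomial_function.induct) auto

text \<open>Squaring removes the kink of the positive part. Test functions only have to be
  \<open>C1\<close>, so this function takes the place of the usual exponential in all bumps and
  cutoffs.\<close>

lemma DERIV_positive_part_square:
  "((\<lambda>t::real. (max 0 t)\<^sup>2) has_real_derivative 2 * max 0 t) (at t)"
proof -
  consider "t > 0" | "t < 0" | "t = 0" by linarith
  then show ?thesis
  proof cases
    case 1
    have "((\<lambda>t::real. t\<^sup>2) has_real_derivative 2 * max 0 t) (at t)"
      using 1 by (auto intro!: derivative_eq_intros)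
    then show ?thesis
      by (rule has_field_derivative_transform_within_open[where S="{0<..}"]) (use 1 in auto)
  next
    case 2
    have "((\<lambda>t::real. 0) has_real_derivative 2 * max 0 t) (at t)"
      using 2 by auto
    then show ?thesis
      by (rule has_field_derivative_transform_within_open[where S="{..<0}"]) (use 2 in auto)
  next
    case 3
    have "((\<lambda>h::real. (max 0 h)\<^sup>2 / h) \<longlongrightarrow> 0) (at 0)"
    proof (rule Lim_null_comparison)
      show "\<forall>\<^sub>F h in at 0. norm ((max 0 h)\<^sup>2 / h) \<le> \<bar>h::real\<bar>"
        by (rule always_eventually) (auto simp: max_def power2_eq_square)
      show "((\<lambda>h. \<bar>h::real\<bar>) \<longlongrightarrow> 0) (at 0)"
        by (rule tendsto_eq_intros | simp)+
    qed
    then show ?thesis using 3 by (simp add: DERIV_def)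
  qed
qed

lemma C1_fun_positive_part_square:
  fixes f :: "'a::euclidean_space \<Rightarrow> real"
  assumes "C1_fun f" shows "C1_fun (\<lambda>x. (max 0 (f x))\<^sup>2)"
  by (rule C1_fun_compose_real[OF assms DERIV_positive_part_square]) (auto intro!: continuous_intros)

lemma C1_fun_affine_coordinate: "C1_fun (\<lambda>x. x \<bullet> b - c)" "C1_fun (\<lambda>x. c - x \<bullet> b)"
proof -
  have "C1_fun (\<lambda>x. x \<bullet> b)" "C1_fun (\<lambda>x. x \<bullet> (- b))"
    by (intro C1_fun_linear bounded_linear_inner_left)+
  from C1_fun_add[OF this(1) C1_fun_const[of "- c"]] C1_fun_add[OF this(2) C1_fun_const[of c]]
  show "C1_fun (\<lambda>x. x \<bullet> b - c)" "C1_fun (\<lambda>x. c - x \<bullet> b)" by auto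
qed

text \<open>A product of squared positive distances to the faces is positive exactly inside a box,
  and a sum of such nonnegative products is positive exactly on the union.\<close>

lemma box_union_bump:
  fixes a c :: "'i \<Rightarrow> 'a::euclidean_space"
  assumes "finite I"
  obtains q where "C1_fun q" "\<And>x. q x \<ge> (0::real)" "\<And>x. q x > 0 \<longleftrightarrow> x \<in> (\<Union>i\<in>I. box (a i) (c i))"
proof
  define r where "r i x = (\<Prod>b\<in>Basis. (max 0 (x \<bullet> b - a i \<bullet> b))\<^sup>2 * (max 0 (c i \<bullet> b - x \<bullet> b))\<^sup>2)"
    for i and x :: 'a
  have r0: "r i x \<ge> 0" for i x unfolding r_def by (intro prod_nonneg) auto
  have rpos: "r i x > 0 \<longleftrightarrow> x \<in> box (a i) (c i)" for i x
  proof -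
    have "r i x \<noteq> 0 \<longleftrightarrow> x \<in> box (a i) (c i)"
      by (auto simp: r_def mem_box max_def)
    then show ?thesis using r0[of i x] by linarith
  qed
  show "C1_fun (\<lambda>x. \<Sum>i\<in>I. r i x)"
    unfolding r_def
    by (intro C1_fun_sum C1_fun_prod C1_fun_mult C1_fun_positive_part_square C1_fun_affine_coordinate)
  show "(\<Sum>i\<in>I. r i x) \<ge> 0" for x using r0 by (simp add: sum_nonneg)
  show "(\<Sum>i\<in>I. r i x) > 0 \<longleftrightarrow> x \<in> (\<Union>i\<in>I. box (a i) (c i))" for x
  proof -
    have "(\<Sum>i\<in>I. r i x) \<noteq> 0 \<longleftrightarrow> (\<exists>i\<in>I. r i x \<noteq> 0)"
      using sum_nonneg_eq_0_iff[OF assms, of "\<lambda>i. r i x"] r0 by auto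
    then show ?thesis
      using rpos r0 sum_nonneg[of I "\<lambda>i. r i x"] by (auto simp: less_le)
  qed
qed

lemma box_union_cutoffs:
  fixes a c :: "'i \<Rightarrow> 'a::euclidean_space"
  assumes "finite I" and U: "U = (\<Union>i\<in>I. box (a i) (c i))"
  shows "\<exists>ct :: nat \<Rightarrow> 'a \<Rightarrow> real. (\<forall>n. ct n \<in> test_fun U) \<and> (\<forall>n x. 0 \<le> ct n x \<and> ct n x \<le> 1) \<and>
    (\<forall>x\<in>U. (\<lambda>n. ct n x) \<longlonglongrightarrow> 1)"
proof -
  obtain q where q: "C1_fun q" "\<And>x. q x \<ge> (0::real)" "\<And>x. q x > 0 \<longleftrightarrow> x \<in> U"
    using box_union_bump[OF assms(1), of a c] U by metis
  \<comment> \<open>Subtracting \<open>1\<close> cuts off where \<open>n q < 1\<close>, so that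
    \<open>ct n\<close> is supported in the closed set \<open>{1 \<le> n q}\<close> inside
    \<open>U\<close>. The map from \<open>y\<close> to \<open>y / (1 + y)\<close> brings the values
    below 1, and they tend to 1 wherever \<open>q > 0\<close>.\<close>
  define y where "y n x = (max 0 (real n * q x - 1))\<^sup>2" for n x
  define ct where "ct n x = y n x / (1 + y n x)" for n x
  have y0: "y n x \<ge> 0" for n x by (simp add: y_def)
  have C: "C1_fun (ct n)" for n
  proof -
    have "C1_fun (\<lambda>x. (\<lambda>t. (max 0 t)\<^sup>2 / (1 + (max 0 t)\<^sup>2)) (real n * q x + (-1)))"
    proof (rule C1_fun_compose_real[where f="\<lambda>x. real n * q x + (-1)" and \<beta>="\<lambda>t. (max 0 t)\<^sup>2 / (1 + (max 0 t)\<^sup>2)"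
        and \<beta>'="\<lambda>t. 2 * max 0 t / (1 + (max 0 t)\<^sup>2)\<^sup>2"])
      show "C1_fun (\<lambda>x. real n * q x + (-1))"
        by (intro C1_fun_add C1_fun_mult C1_fun_const q(1))
      have nz: "1 + (max 0 t)\<^sup>2 \<noteq> 0" for t :: real
        using zero_le_power2[of "max 0 t"] by linarith
      show "((\<lambda>t::real. (max 0 t)\<^sup>2 / (1 + (max 0 t)\<^sup>2)) has_real_derivative
         2 * max 0 t / (1 + (max 0 t)\<^sup>2)\<^sup>2) (at t)" for t
        by (rule derivative_eq_intros DERIV_positive_part_square refl nz)+
           (use nz[of t] in \<open>simp add: power2_eq_square field_simps\<close>)
      show "continuous_on UNIV (\<lambda>t::real. 2 * max 0 t / (1 + (max 0 t)\<^sup>2)\<^sup>2)"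
        using nz by (intro continuous_intros) auto
    qed
    then show ?thesis by (simp add: ct_def[abs_def] y_def)
  qed
  show ?thesis
  proof (intro exI[of _ ct] conjI allI ballI)
    fix n
    show "ct n \<in> test_fun U"
    proof -
      let ?K = "{x. 1 \<le> real n * q x}"
      have "closed ?K"
        by (intro closed_Collect_le continuous_intros C1_fun_continuous q(1))
      moreover have sub: "?K \<subseteq> U"
      proof
        fix x assume "x \<in> ?K"
        then have "q x \<noteq> 0" by auto
        then show "x \<in> U" using q(2)[of x] q(3)[of x] by linarith
      qed
      moreover have "bounded U"
        unfolding U using assms(1) by (intro bounded_UN) (auto simp: bounded_box)
      ultimately have "compact ?K" by (meson bounded_subset compact_eq_bounded_closed)
      moreover have "ct n x = 0" if "x \<notin> ?K" for x using that by (simp add: ct_def y_def)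
      ultimately show ?thesis using C sub unfolding test_fun_def by blast
    qed
    show "0 \<le> ct n x" "ct n x \<le> 1" for x using y0[of n x] by (auto simp: ct_def divide_simps)
  next
    fix x assume "x \<in> U"
    then have qx: "q x > 0" using q by auto
    have "filterlim (\<lambda>n. q x * real n) at_top sequentially"
      by (rule filterlim_tendsto_pos_mult_at_top[OF tendsto_const qx filterlim_real_sequentially])
    then have "filterlim (\<lambda>n. -1 + q x * real n) at_top sequentially"
      by (rule filterlim_tendsto_add_at_top[OF tendsto_const])
    then have lin: "filterlim (\<lambda>n. real n * q x - 1) at_top sequentially"
      by (simp add: mult.commute)
    have "filterlim (\<lambda>n. (real n * q x - 1)^2) at_top sequentially"
      by (intro filterlim_pow_at_top lin) auto
    moreover have "\<forall>\<^sub>F n in sequentially. real n * q x - 1 \<ge> 0"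
      using lin unfolding filterlim_at_top by blast
    then have "\<forall>\<^sub>F n in sequentially. (real n * q x - 1)^2 = y n x"
      by eventually_elim (auto simp: y_def)
    ultimately have "filterlim (\<lambda>n. y n x) at_top sequentially"
      using filterlim_cong[OF refl refl, of "\<lambda>n. (real n * q x - 1)^2" "\<lambda>n. y n x"] by simp
    then have "filterlim (\<lambda>n. 1 + y n x) at_top sequentially"
      by (intro filterlim_tendsto_add_at_top[OF tendsto_const])
    then have "(\<lambda>n. 1 - inverse (1 + y n x)) \<longlonglongrightarrow> 1 - 0"
      by (intro tendsto_diff tendsto_const tendsto_inverse_0_at_top)
    moreover have "1 - inverse (1 + y n x) = ct n x" for n
      using y0[of n x] by (auto simp: ct_def divide_simps)
    ultimately show "(\<lambda>n. ct n x) \<longlonglongrightarrow> 1" by simp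
  qed
qed

lemma test_fun_mult:
  fixes f g :: "'a::euclidean_space \<Rightarrow> real"
  assumes "f \<in> test_fun U" "C1_fun g" shows "(\<lambda>x. f x * g x) \<in> test_fun U"
  using assms unfolding test_fun_def by auto

text \<open>The ideal test function is \<open>sgn F\<close>. It is almost everywhere a limit of
  continuous functions, these are uniformly close to polynomials on a ball containing
  \<open>U\<close>, and the cutoffs turn polynomials into test functions. Dominated convergence with
  majorant \<open>\<bar>F\<bar>\<close> passes the bound to the limit.\<close>

lemma L1_norm_by_test_functions:
  fixes F :: "'a::euclidean_space \<Rightarrow> real" and a c :: "'i \<Rightarrow> 'a"
  assumes F: "integrable lebesgue F" and "finite I" and U: "U = (\<Union>i\<in>I. box (a i) (c i))"
    and B: "\<And>g. g \<in> test_fun U \<Longrightarrow> (\<And>x. \<bar>g x\<bar> \<le> 1) \<Longrightarrow> (LINT x|lebesgue. F x * g x) \<le> B"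
  shows "(LINT x|lebesgue. indicator U x * \<bar>F x\<bar>) \<le> B"
proof -
  obtain ct :: "nat \<Rightarrow> 'a \<Rightarrow> real" where ct: "\<And>n. ct n \<in> test_fun U" "\<And>n x. 0 \<le> ct n x" "\<And>n x. ct n x \<le> 1"
    "\<And>x. x \<in> U \<Longrightarrow> (\<lambda>n. ct n x) \<longlonglongrightarrow> 1"
    using box_union_cutoffs[OF assms(2) U] by metis
  have "open U" unfolding U by (auto intro: open_box)
  have "bounded U"
    unfolding U using assms(2) by (intro bounded_UN) (auto simp: bounded_box)
  then obtain R where R: "U \<subseteq> cball 0 R" by (auto simp: bounded_any_center[of U 0] subset_eq dist_norm)
  have [measurable]: "U \<in> sets lebesgue" using \<open>open U\<close> by (auto intro: borel_open)
  have Fm[measurable]: "F \<in> borel_measurable lebesgue" using F by auto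
  have "(\<lambda>x. sgn (F x)) measurable_on UNIV"
    by (intro lebesgue_measurable_imp_measurable_on_real) auto
  then obtain N k where N: "negligible N" and k: "\<And>n. continuous_on UNIV (k n)"
    and lim: "\<And>x. x \<notin> N \<Longrightarrow> (\<lambda>n. k n x) \<longlonglongrightarrow> sgn (F x)"
    unfolding measurable_on_def by auto
  \<comment> \<open>Clipping does not disturb the limit, because \<open>sgn\<close> takes its values
    in \<open>[-1, 1]\<close>.\<close>
  define k' where "k' n x = max (-1) (min 1 (k n x))" for n x
  have k'1: "\<bar>k' n x\<bar> \<le> 1" for n x by (auto simp: k'_def)
  have "\<exists>p. real_polynomial_function p \<and> (\<forall>x\<in>cball 0 R. \<bar>k' n x - p x\<bar> < 1 / real (Suc n))" for n
  proof -
    have "continuous_on (cball 0 R) (k' n)"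
      unfolding k'_def by (intro continuous_intros continuous_on_subset[OF k]) auto
    then show ?thesis
    proof (rule Stone_Weierstrass_real_polynomial_function[OF compact_cball, of _ _ _ "1 / real (Suc n)"])
      fix g assume "real_polynomial_function g" "\<And>x. x \<in> cball 0 R \<Longrightarrow> \<bar>k' n x - g x\<bar> < 1 / real (Suc n)"
      then show ?thesis by (intro exI[of _ g]) simp
    qed simp
  qed
  then have "\<exists>p. \<forall>n. real_polynomial_function (p n) \<and> (\<forall>x\<in>cball 0 R. \<bar>k' n x - p n x\<bar> < 1 / real (Suc n))"
    by (intro choice allI)
  then obtain p where "\<forall>n. real_polynomial_function (p n) \<and> (\<forall>x\<in>cball 0 R. \<bar>k' n x - p n x\<bar> < 1 / real (Suc n))"
    by (rule exE)
  then have p: "\<And>n. real_polynomial_function (p n)"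
     "\<And>n x. x \<in> cball 0 R \<Longrightarrow> \<bar>k' n x - p n x\<bar> < 1 / real (Suc n)" by simp_all
  \<comment> \<open>The polynomial may exceed the clipped function by up to
    \<open>1 / (n + 1)\<close>; the divisor restores the bound 1 and tends to 1.\<close>
  define g where "g n x = ct n x * (p n x * (1 / (1 + 1 / real (Suc n))))" for n x
  have gt: "g n \<in> test_fun U" for n
    unfolding g_def[abs_def]
    by (rule test_fun_mult[OF ct(1) C1_fun_mult[OF C1_fun_real_polynomial[OF p(1)] C1_fun_const]])
  have gb: "\<bar>g n x\<bar> \<le> 1" for n x
  proof (cases "x \<in> U")
    case True
    then have "\<bar>p n x\<bar> \<le> 1 + 1 / real (Suc n)" using p(2)[of x n] R k'1[of n x] by auto
    then have "\<bar>p n x * (1 / (1 + 1 / real (Suc n)))\<bar> \<le> 1"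
      by (simp add: abs_mult divide_simps) 
    then have "\<bar>ct n x\<bar> * \<bar>p n x * (1 / (1 + 1 / real (Suc n)))\<bar> \<le> 1 * 1"
      using ct(2,3)[of n x] by (intro mult_mono) auto
    then show ?thesis by (simp add: g_def abs_mult)
  next
    case False then show ?thesis using test_fun_eq_0[OF gt False] by simp
  qed
  have gm[measurable]: "g n \<in> borel_measurable lebesgue" for n
    using borel_measurable_continuous_onI[OF C1_fun_continuous[OF test_funD[OF gt]]]
    by (intro measurable_completion) simp
  have "(\<lambda>n. LINT x|lebesgue. F x * g n x) \<longlonglongrightarrow> (LINT x|lebesgue. indicator U x * \<bar>F x\<bar>)"
  proof (rule integral_dominated_convergence[where w="\<lambda>x. \<bar>F x\<bar>"])
    show "(\<lambda>x. indicator U x * \<bar>F x\<bar>) \<in> borel_measurable lebesgue"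
      by measurable
    show "AE x in lebesgue. norm (F x * g n x) \<le> \<bar>F x\<bar>" for n
      using gb by (auto simp: abs_mult mult_left_le)
    have "(\<lambda>n. F x * g n x) \<longlonglongrightarrow> indicator U x * \<bar>F x\<bar>" if "x \<notin> N" for x
    proof (cases "x \<in> U")
      case True
      have "(\<lambda>n. k' n x) \<longlonglongrightarrow> max (-1) (min 1 (sgn (F x)))"
        unfolding k'_def by (intro tendsto_intros lim that)
      moreover have "max (-1) (min 1 (sgn (F x))) = sgn (F x)" by (auto simp: sgn_if)
      ultimately have 1: "(\<lambda>n. k' n x) \<longlonglongrightarrow> sgn (F x)" by simp
      have "(\<lambda>n. p n x - k' n x) \<longlonglongrightarrow> 0"
      proof (rule Lim_null_comparison)
        show "\<forall>\<^sub>F n in sequentially. norm (p n x - k' n x) \<le> 1 / real (Suc n)"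
        proof (rule always_eventually, rule allI)
          fix n
          have "\<bar>k' n x - p n x\<bar> < 1 / real (Suc n)" using p(2) R True by blast
          then show "norm (p n x - k' n x) \<le> 1 / real (Suc n)" unfolding real_norm_def by linarith
        qed
        show "(\<lambda>n. 1 / real (Suc n)) \<longlonglongrightarrow> 0" by (rule lim_inverse_n'[THEN LIMSEQ_Suc])
      qed
      from tendsto_add[OF this 1] have 2: "(\<lambda>n. p n x) \<longlonglongrightarrow> sgn (F x)" by simp
      have "(\<lambda>n. 1 + 1 / real (Suc n)) \<longlonglongrightarrow> 1 + 0"
        by (intro tendsto_add tendsto_const lim_inverse_n'[THEN LIMSEQ_Suc])
      then have "(\<lambda>n. g n x) \<longlonglongrightarrow> 1 * (sgn (F x) * (1 / (1 + 0)))"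
        unfolding g_def by (intro tendsto_mult tendsto_divide tendsto_const ct True 2) auto
      then have "(\<lambda>n. F x * g n x) \<longlonglongrightarrow> F x * sgn (F x)" by (intro tendsto_intros) simp
      then show ?thesis using True by (simp add: abs_sgn)
    next
      case False then show ?thesis using test_fun_eq_0[OF gt False] by simp
    qed
    note pw = this
    show "AE x in lebesgue. (\<lambda>n. F x * g n x) \<longlonglongrightarrow> indicator U x * \<bar>F x\<bar>"
      using AE_not_in[OF N[unfolded negligible_iff_null_sets]] by (rule AE_mp) (rule AE_I2, simp add: pw)
    show "integrable lebesgue (\<lambda>x. \<bar>F x\<bar>)" using F by simp
    show "(\<lambda>x. F x * g n x) \<in> borel_measurable lebesgue" for n by measurable
  qed
  then show ?thesis
    proof (rule LIMSEQ_le_const2)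
    show "\<exists>N. \<forall>n\<ge>N. (LINT x|lebesgue. F x * g n x) \<le> B" using B[OF gt gb] by blast
  qed
qed

section \<open>Fluxes of smooth functions through faces\<close>

text \<open>Cells are named by their lower corner: a mesh becomes a finite set of points, and
  crossing a face in direction \<open>k\<close> becomes a translation by
  \<open>s *\<^sub>R k\<close>.\<close>

definition cell :: "real \<Rightarrow> 'a::euclidean_space \<Rightarrow> 'a set" where
  "cell s z = cbox z (z + s *\<^sub>R One)"

definition open_cell :: "real \<Rightarrow> 'a::euclidean_space \<Rightarrow> 'a set" where
  "open_cell s z = box z (z + s *\<^sub>R One)"

lemma mem_cell: "x \<in> cell s z \<longleftrightarrow> (\<forall>b\<in>Basis. z \<bullet> b \<le> x \<bullet> b \<and> x \<bullet> b \<le> z \<bullet> b + s)"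
  by (auto simp: cell_def mem_box inner_add_left)

lemma mem_open_cell: "x \<in> open_cell s z \<longleftrightarrow> (\<forall>b\<in>Basis. z \<bullet> b < x \<bullet> b \<and> x \<bullet> b < z \<bullet> b + s)"
  by (auto simp: open_cell_def mem_box inner_add_left)

section \<open>Integration along lines by translation invariance\<close>

lemma nn_integral_lborel_translate:
  fixes c :: "'a::euclidean_space"
  assumes [measurable]: "f \<in> borel_measurable borel"
  shows "(\<integral>\<^sup>+x. f (x + c) \<partial>lborel) = (\<integral>\<^sup>+x. f x \<partial>lborel)"
proof -
  have "(\<integral>\<^sup>+x. f x \<partial>lborel) = (\<integral>\<^sup>+x. f x \<partial>distr lborel borel ((+) c))"
    by (simp add: lborel_distr_plus)
  also have "\<dots> = (\<integral>\<^sup>+x. f (x + c) \<partial>lborel)"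
    by (subst nn_integral_distr) (auto simp: add.commute)
  finally show ?thesis by simp
qed

lemma integral_lborel_translate:
  fixes c :: "'a::euclidean_space" and f :: "'a \<Rightarrow> real"
  assumes [measurable]: "f \<in> borel_measurable borel"
  shows "(LINT x|lborel. f (x + c)) = (LINT x|lborel. f x)"
proof -
  have "(LINT x|lborel. f x) = (LINT x|distr lborel borel ((+) c). f x)"
    by (simp add: lborel_distr_plus)
  also have "\<dots> = (LINT x|lborel. f (x + c))"
    by (subst integral_distr) (auto simp: add.commute)
  finally show ?thesis by simp
qed

text \<open>Integration along lines in direction \<open>k\<close> without choosing coordinates: the inner integral is
  constant along these lines, and translation invariance replaces the splitting of the space.\<close>

lemma line_Fubini:
  fixes u :: "'a::euclidean_space \<Rightarrow> real" and k :: 'a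
  assumes u: "integrable lborel u" and k: "norm k = 1" and s: "s \<ge> 0"
  shows "s * (LINT x|lborel. u x) =
    (LINT x|lborel. indicator {x. a \<le> x \<bullet> k \<and> x \<bullet> k \<le> a + s} x * (LINT t|lborel. u (x + t *\<^sub>R k)))"
proof -
  define S where "S = {x :: 'a. a \<le> x \<bullet> k \<and> x \<bullet> k \<le> a + s}"
  have [measurable]: "S \<in> sets borel" unfolding S_def by measurable
  have um[measurable]: "u \<in> borel_measurable borel" using u by auto
  define N where "N = (\<integral>\<^sup>+t. (\<integral>\<^sup>+y. indicator S (y - t *\<^sub>R k) * ennreal \<bar>u y\<bar> \<partial>lborel) \<partial>lborel)"
  \<comment> \<open>For fixed \<open>y\<close> the shifts \<open>t\<close> that bring it into the
    slab form an interval of length \<open>s\<close>, since \<open>k\<close> is a unit vector. This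
    is the factor \<open>s\<close> of the statement.\<close>
  have ind: "indicator S (y - t *\<^sub>R k) = indicator {y \<bullet> k - a - s .. y \<bullet> k - a} t" for y t
    using k by (auto simp: S_def inner_diff_left dot_square_norm indicator_def)
  have N: "N < \<infinity>"
  proof -
    have "N = (\<integral>\<^sup>+y. (\<integral>\<^sup>+t. indicator S (y - t *\<^sub>R k) * ennreal \<bar>u y\<bar> \<partial>(lborel::real measure)) \<partial>lborel)"
      unfolding N_def by (intro lborel_pair.Fubini') measurable
    also have "\<dots> = (\<integral>\<^sup>+y. ennreal s * ennreal \<bar>u y\<bar> \<partial>lborel)"
      unfolding ind using s by (intro nn_integral_cong) (simp add: nn_integral_multc)
    also have "\<dots> = ennreal s * (\<integral>\<^sup>+y. ennreal \<bar>u y\<bar> \<partial>lborel)"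
      by (rule nn_integral_cmult) auto
    also have "\<dots> < \<infinity>"
      using u by (auto simp: integrable_iff_bounded ennreal_mult_less_top)
    finally show ?thesis .
  qed
  have i1: "integrable (lborel \<Otimes>\<^sub>M lborel) (\<lambda>(x, t). indicator S (x - t *\<^sub>R k) * u x)"
  proof (rule integrableI_bounded)
    have "(\<integral>\<^sup>+p. ennreal (norm (case p of (x, t) \<Rightarrow> indicator S (x - t *\<^sub>R k) * u x)) \<partial>(lborel \<Otimes>\<^sub>M lborel)) = N"
      unfolding N_def
      by (subst lborel_pair.nn_integral_snd[symmetric])
         (auto simp: abs_mult ennreal_mult split_beta' intro!: nn_integral_cong split: split_indicator)
    then show "(\<integral>\<^sup>+p. ennreal (norm (case p of (x, t) \<Rightarrow> indicator S (x - t *\<^sub>R k) * u x)) \<partial>(lborel \<Otimes>\<^sub>M lborel)) < \<infinity>"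
      using N by simp
  qed measurable
  have i2: "integrable (lborel \<Otimes>\<^sub>M lborel) (\<lambda>(x, t). indicator S x * u (x + t *\<^sub>R k))"
  proof (rule integrableI_bounded)
    have "(\<integral>\<^sup>+p. ennreal (norm (case p of (x, t) \<Rightarrow> indicator S x * u (x + t *\<^sub>R k))) \<partial>(lborel \<Otimes>\<^sub>M lborel))
       = (\<integral>\<^sup>+t. (\<integral>\<^sup>+y. indicator S y * ennreal \<bar>u (y + t *\<^sub>R k)\<bar> \<partial>lborel) \<partial>lborel)"
      by (subst lborel_pair.nn_integral_snd[symmetric])
         (auto simp: abs_mult ennreal_mult split_beta' intro!: nn_integral_cong split: split_indicator)
    also have "\<dots> = N" unfolding N_def
    proof (rule nn_integral_cong)
      fix t :: real
      show "(\<integral>\<^sup>+y. indicator S y * ennreal \<bar>u (y + t *\<^sub>R k)\<bar> \<partial>lborel) =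
        (\<integral>\<^sup>+y. indicator S (y - t *\<^sub>R k) * ennreal \<bar>u y\<bar> \<partial>lborel)"
        using nn_integral_lborel_translate[of "\<lambda>y. indicator S (y - t *\<^sub>R k) * ennreal \<bar>u y\<bar>" "t *\<^sub>R k"]
        by simp
    qed
    finally show "(\<integral>\<^sup>+p. ennreal (norm (case p of (x, t) \<Rightarrow> indicator S x * u (x + t *\<^sub>R k))) \<partial>(lborel \<Otimes>\<^sub>M lborel)) < \<infinity>"
      using N by simp
  qed measurable
  have "s * (LINT x|lborel. u x) = (LINT x|lborel. (LINT t|lborel. indicator S (x - t *\<^sub>R k) * u x))"
  proof -
    have "(LINT t|lborel. indicator S (x - t *\<^sub>R k) * u x) = s * u x" for x
      unfolding ind using s by simp
    then show ?thesis by (simp only: integral_mult_right_zero[symmetric])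
  qed
  also have "\<dots> = (LINT t|lborel. (LINT x|lborel. indicator S (x - t *\<^sub>R k) * u x))"
    by (rule lborel_pair.Fubini_integral[OF i1, symmetric])
  also have "\<dots> = (LINT t|lborel. (LINT x|lborel. indicator S x * u (x + t *\<^sub>R k)))"
  proof (rule Bochner_Integration.integral_cong[OF refl])
    fix t :: real
    show "(LINT x|lborel. indicator S (x - t *\<^sub>R k) * u x) = (LINT x|lborel. indicator S x * u (x + t *\<^sub>R k))"
      using integral_lborel_translate[of "\<lambda>y. indicator S (y - t *\<^sub>R k) * u y" "t *\<^sub>R k"] by simp
  qed
  also have "\<dots> = (LINT x|lborel. (LINT t|lborel. indicator S x * u (x + t *\<^sub>R k)))"
    by (rule lborel_pair.Fubini_integral[OF i2])
  finally show ?thesis unfolding S_def by simp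
qed

text \<open>The left integrand is the derivative along \<open>k\<close> of
  \<open>((x - z) \<bullet> k - c) * f x\<close>. On each line through the cell it integrates to
  \<open>s - c\<close> times the value of \<open>f\<close> on the upper face plus \<open>c\<close>
  times the value on the lower face, so \<open>c = 0\<close> and \<open>c = s\<close> each select
  one face. The right integrand is constant along these lines; the free shift \<open>r\<close> moves
  the cell over which it is sampled to the position that \<open>face_int\<close> expects.\<close>

lemma flux_identity:
  fixes f :: "'a::euclidean_space \<Rightarrow> real"
  assumes f: "C1_fun f" and k: "k \<in> Basis" and s: "s > 0"
  shows "s * (LINT x|lborel. indicator (cell s z) x * (f x + ((x - z) \<bullet> k - c) * frechet_derivative f (at x) k))
    = (LINT x|lborel. indicator (cell s (z + r *\<^sub>R k)) x *
        ((s - c) * f (x + (z \<bullet> k + s - x \<bullet> k) *\<^sub>R k) + c * f (x + (z \<bullet> k - x \<bullet> k) *\<^sub>R k)))"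
proof -
  let ?D = "\<lambda>x. frechet_derivative f (at x) k"
  define v where "v x = f x + ((x - z) \<bullet> k - c) * ?D x" for x
  have kk: "k \<bullet> k = 1" "norm k = 1" using k by (auto simp: inner_same_Basis)
  have kj: "k \<bullet> j = 0" if "j \<in> Basis" "j \<noteq> k" for j using that k inner_not_same_Basis by metis
  have contv: "continuous_on UNIV v"
    unfolding v_def by (intro continuous_intros C1_fun_continuous[OF f] C1_fun_cont_deriv[OF f])
  have int: "integrable lborel (\<lambda>x. indicator (cell s z) x * v x)"
    using borel_integrable_compact[of "cell s z" v] continuous_on_subset[OF contv] by (auto simp: cell_def)
  define S where "S = {x. z \<bullet> k + r \<le> x \<bullet> k \<and> x \<bullet> k \<le> z \<bullet> k + r + s}"
  have "indicator S x * (LINT t|lborel. indicator (cell s z) (x + t *\<^sub>R k) * v (x + t *\<^sub>R k)) =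
     indicator (cell s (z + r *\<^sub>R k)) x *
        ((s - c) * f (x + (z \<bullet> k + s - x \<bullet> k) *\<^sub>R k) + c * f (x + (z \<bullet> k - x \<bullet> k) *\<^sub>R k))" for x
  proof -
    \<comment> \<open>The conditions on the coordinates orthogonal to \<open>k\<close>: they do not
      change along the line and do not see the shift \<open>r\<close>.\<close>
    define P where "P \<longleftrightarrow> (\<forall>j\<in>Basis - {k}. z \<bullet> j \<le> x \<bullet> j \<and> x \<bullet> j \<le> z \<bullet> j + s)"
    have c1: "x + t *\<^sub>R k \<in> cell s z \<longleftrightarrow> P \<and> t \<in> {z \<bullet> k - x \<bullet> k .. z \<bullet> k - x \<bullet> k + s}" for t
    proof -
      have "(\<forall>j\<in>Basis - {k}. z \<bullet> j \<le> (x + t *\<^sub>R k) \<bullet> j \<and> (x + t *\<^sub>R k) \<bullet> j \<le> z \<bullet> j + s) \<longleftrightarrow> P"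
        unfolding P_def by (intro ball_cong refl) (simp add: inner_add_left kj)
      moreover have "x + t *\<^sub>R k \<in> cell s z \<longleftrightarrow> (z \<bullet> k \<le> (x + t *\<^sub>R k) \<bullet> k \<and> (x + t *\<^sub>R k) \<bullet> k \<le> z \<bullet> k + s) \<and>
        (\<forall>j\<in>Basis - {k}. z \<bullet> j \<le> (x + t *\<^sub>R k) \<bullet> j \<and> (x + t *\<^sub>R k) \<bullet> j \<le> z \<bullet> j + s)"
        using k unfolding mem_cell by blast
      ultimately show ?thesis using kk by (auto simp: inner_add_left)
    qed
    have c2: "x \<in> cell s (z + r *\<^sub>R k) \<longleftrightarrow> P \<and> x \<in> S"
    proof -
      have "(\<forall>j\<in>Basis - {k}. (z + r *\<^sub>R k) \<bullet> j \<le> x \<bullet> j \<and> x \<bullet> j \<le> (z + r *\<^sub>R k) \<bullet> j + s) \<longleftrightarrow> P"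
        unfolding P_def by (intro ball_cong refl) (simp add: inner_add_left kj)
      moreover have "x \<in> cell s (z + r *\<^sub>R k) \<longleftrightarrow> ((z + r *\<^sub>R k) \<bullet> k \<le> x \<bullet> k \<and> x \<bullet> k \<le> (z + r *\<^sub>R k) \<bullet> k + s) \<and>
        (\<forall>j\<in>Basis - {k}. (z + r *\<^sub>R k) \<bullet> j \<le> x \<bullet> j \<and> x \<bullet> j \<le> (z + r *\<^sub>R k) \<bullet> j + s)"
        using k unfolding mem_cell by blast
      ultimately show ?thesis using kk by (auto simp: S_def inner_add_left)
    qed
    show ?thesis
    proof (cases P)
      case False
      then show ?thesis by (simp add: c1 c2 indicator_def)
    next
      case True
      let ?a = "z \<bullet> k - x \<bullet> k" let ?b = "z \<bullet> k - x \<bullet> k + s"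
      let ?F = "\<lambda>t. (t - ?a - c) * f (x + t *\<^sub>R k)"
      have "(LINT t|lborel. indicator {?a..?b} t *\<^sub>R v (x + t *\<^sub>R k)) = ?F ?b - ?F ?a"
      proof (rule integral_FTC_Icc)
        show "?a \<le> ?b" using s by simp
        show "continuous_on {?a..?b} (\<lambda>t. v (x + t *\<^sub>R k))"
          by (rule continuous_on_compose2[OF contv]) (auto intro!: continuous_intros)
        fix t
        have "((\<lambda>t. f (x + t *\<^sub>R k)) has_derivative (\<lambda>h. frechet_derivative f (at (x + t *\<^sub>R k)) (h *\<^sub>R k))) (at t)"
          by (rule has_derivative_compose[OF _ C1_fun_has_derivative[OF f]]) (auto intro!: derivative_eq_intros)
        moreover have "frechet_derivative f (at (x + t *\<^sub>R k)) (h *\<^sub>R k) = ?D (x + t *\<^sub>R k) * h" for h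
          by (simp add: linear_scale[OF has_derivative_linear[OF C1_fun_has_derivative[OF f]]] mult.commute)
        ultimately have "((\<lambda>t. f (x + t *\<^sub>R k)) has_real_derivative ?D (x + t *\<^sub>R k)) (at t)"
          by (simp add: has_field_derivative_def)
        then have "(?F has_real_derivative v (x + t *\<^sub>R k)) (at t)"
          by (auto intro!: derivative_eq_intros simp: v_def inner_diff_left inner_add_left kk algebra_simps)
        then show "(?F has_vector_derivative v (x + t *\<^sub>R k)) (at t within {?a..?b})"
          by (simp add: has_real_derivative_iff_has_vector_derivative has_vector_derivative_at_within)
      qed
      then show ?thesis using True by (simp add: c1 c2 indicator_def algebra_simps)
    qed
  qed
  then show ?thesis
    using line_Fubini[OF int kk(2), of s "z \<bullet> k + r"] s unfolding S_def v_def by simp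
qed

text \<open>The integrand depends only on the projection of \<open>x\<close> to the lower face
  orthogonal to \<open>k\<close> of the cell at \<open>y\<close>. The value is thus \<open>s\<close>
  times the surface integral over that face, written without surface measure.\<close>

definition face_int :: "real \<Rightarrow> 'a::euclidean_space \<Rightarrow> 'a \<Rightarrow> ('a \<Rightarrow> real) \<Rightarrow> real" where
  "face_int s k y f = (LINT x|lborel. indicator (cell s y) x * f (x + ((y - x) \<bullet> k) *\<^sub>R k))"

lemma flux_upper:
  fixes f :: "'a::euclidean_space \<Rightarrow> real"
  assumes "C1_fun f" "k \<in> Basis" "s > 0"
  shows "(LINT x|lborel. indicator (cell s z) x * (f x + ((x - z) \<bullet> k) * frechet_derivative f (at x) k))
    = face_int s k (z + s *\<^sub>R k) f"
proof -
  have kk: "k \<bullet> k = 1" using assms by (auto simp: inner_same_Basis)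
  have "s * (LINT x|lborel. indicator (cell s z) x * (f x + ((x - z) \<bullet> k) * frechet_derivative f (at x) k))
    = s * face_int s k (z + s *\<^sub>R k) f"
    using flux_identity[OF assms, of z 0 s]
    by (simp add: face_int_def inner_diff_left inner_add_left kk mult.left_commute)
  then show ?thesis using assms by simp
qed

lemma flux_lower:
  fixes f :: "'a::euclidean_space \<Rightarrow> real"
  assumes "C1_fun f" "k \<in> Basis" "s > 0"
  shows "(LINT x|lborel. indicator (cell s z) x * (f x + ((x - z) \<bullet> k - s) * frechet_derivative f (at x) k))
    = face_int s k z f"
proof -
  have "s * (LINT x|lborel. indicator (cell s z) x * (f x + ((x - z) \<bullet> k - s) * frechet_derivative f (at x) k))
    = s * face_int s k z f"
    using flux_identity[OF assms, of z s 0]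
    by (simp add: face_int_def inner_diff_left mult.left_commute)
  then show ?thesis using assms by simp
qed

lemma cell_minus_open_cell: "cell s z - open_cell s z \<in> null_sets lborel"
  unfolding cell_def open_cell_def
  using negligible_frontier_interval[of z "z + s *\<^sub>R One"] by (simp add: negligible_iff_null_sets null_sets_completion_iff)

text \<open>The boundary of the cell is a null set, so only the relative interior of the face
  counts. Edges must be excluded because across an edge point a neighbouring cell need not be
  aligned with this one.\<close>

lemma face_int_eq_0:
  assumes "k \<in> Basis" "\<And>p. p \<bullet> k = y \<bullet> k \<Longrightarrow> (\<And>j. j \<in> Basis - {k} \<Longrightarrow> y \<bullet> j < p \<bullet> j \<and> p \<bullet> j < y \<bullet> j + s) \<Longrightarrow> f p = 0"
  shows "face_int s k y f = 0"
  unfolding face_int_def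
proof (rule integral_eq_zero_AE)
  have kk: "k \<bullet> k = 1" using assms by (auto simp: inner_same_Basis)
  have kj: "k \<bullet> j = 0" if "j \<in> Basis" "j \<noteq> k" for j using that assms(1) inner_not_same_Basis by metis
  have "AE x in lborel. x \<notin> cell s y - open_cell s y"
    by (rule AE_not_in[OF cell_minus_open_cell])
  then show "AE x in lborel. indicator (cell s y) x * f (x + ((y - x) \<bullet> k) *\<^sub>R k) = 0"
  proof eventually_elim
    case (elim x)
    show ?case
    proof (cases "x \<in> open_cell s y")
      case True
      have "f (x + ((y - x) \<bullet> k) *\<^sub>R k) = 0"
        by (rule assms(2)) (use True in \<open>auto simp: inner_add_left inner_diff_left kk kj mem_open_cell\<close>)
      then show ?thesis by simp
    next
      case False
      then show ?thesis using elim by (auto simp: indicator_def)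
    qed
  qed
qed

section \<open>A Poincare inequality on cells\<close>

text \<open>\<open>w\<close> is merely integrable, so the shift sits on \<open>g\<close>. The
  difference quotients are dominated by \<open>L * \<bar>w x\<bar>\<close>, with \<open>L\<close> a
  bound for the derivative of \<open>g\<close> along \<open>v\<close>.\<close>

lemma DERIV_integral_translated:
  fixes w g :: "'a::euclidean_space \<Rightarrow> real"
  assumes w: "integrable lborel w" and g: "g \<in> test_fun U"
  shows "((\<lambda>t. LINT x|lborel. w x * g (x - t *\<^sub>R v)) has_real_derivative
     (LINT x|lborel. w x * - frechet_derivative g (at (x - t *\<^sub>R v)) v)) (at t)"
proof -
  let ?D = "\<lambda>x. frechet_derivative g (at x) v"
  have C: "C1_fun g" using g by (rule test_funD)
  have contg: "continuous_on UNIV g" by (rule C1_fun_continuous[OF C])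
  have contD: "continuous_on UNIV ?D" by (rule C1_fun_cont_deriv[OF C])
  have [measurable]: "w \<in> borel_measurable borel" "g \<in> borel_measurable borel" "?D \<in> borel_measurable borel"
    using w contg contD by (auto intro: borel_measurable_continuous_onI)
  obtain K where K: "compact K" "\<And>x. x \<notin> K \<Longrightarrow> g x = 0" using g unfolding test_fun_def by blast
  obtain B where B: "B \<ge> 0" "\<And>x. norm (g x) \<le> B"
    using compact_support_bounded[OF contg K] by blast
  obtain L where L: "L \<ge> 0" "\<And>x. norm (?D x) \<le> L"
    using compact_support_bounded[OF contD K(1) test_fun_deriv_support[OF C compact_imp_closed[OF K(1)] K(2)]] by blast
  have der: "((\<lambda>t. g (x - t *\<^sub>R v)) has_real_derivative - ?D (x - t *\<^sub>R v)) (at t)" for x t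
  proof -
    have "((\<lambda>t. g (x - t *\<^sub>R v)) has_derivative (\<lambda>h. frechet_derivative g (at (x - t *\<^sub>R v)) (- h *\<^sub>R v))) (at t)"
      by (rule has_derivative_compose[OF _ C1_fun_has_derivative[OF C]]) (auto intro!: derivative_eq_intros)
    moreover have "(\<lambda>h. frechet_derivative g (at (x - t *\<^sub>R v)) (- h *\<^sub>R v)) = (*) (- ?D (x - t *\<^sub>R v))"
      by (rule ext, subst linear_scale[OF has_derivative_linear[OF C1_fun_has_derivative[OF C]]]) simp
    ultimately show ?thesis by (simp only: has_field_derivative_def)
  qed
  have lip: "\<bar>g (x - t *\<^sub>R v) - g (x - r *\<^sub>R v)\<bar> \<le> L * \<bar>t - r\<bar>" for x t r
    using field_differentiable_bound[OF convex_UNIV der, of x L t r] L(2) by auto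
  have int: "integrable lborel (\<lambda>x. w x * g (x - t *\<^sub>R v))" for t
  proof (rule Bochner_Integration.integrable_bound)
    show "integrable lborel (\<lambda>x. B * \<bar>w x\<bar>)" using w by simp
    show "AE x in lborel. norm (w x * g (x - t *\<^sub>R v)) \<le> norm (B * \<bar>w x\<bar>)"
      using B by (intro AE_I2) (simp add: abs_mult mult.commute[of B] mult_left_mono)
  qed measurable
  show ?thesis
    unfolding DERIV_def tendsto_at_iff_sequentially
  proof (intro allI impI)
    fix h :: "nat \<Rightarrow> real"
    assume h: "\<forall>i. h i \<in> UNIV - {0}" "h \<longlonglongrightarrow> 0"
    have "(\<lambda>i. LINT x|lborel. (w x * g (x - (t + h i) *\<^sub>R v) - w x * g (x - t *\<^sub>R v)) / h i)
        \<longlonglongrightarrow> (LINT x|lborel. w x * - ?D (x - t *\<^sub>R v))"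
    proof (rule integral_dominated_convergence[where w="\<lambda>x. L * \<bar>w x\<bar>"])
      show "integrable lborel (\<lambda>x. L * \<bar>w x\<bar>)" using w by simp
      show "AE x in lborel. (\<lambda>i. (w x * g (x - (t + h i) *\<^sub>R v) - w x * g (x - t *\<^sub>R v)) / h i)
         \<longlonglongrightarrow> w x * - ?D (x - t *\<^sub>R v)"
      proof (rule AE_I2)
        fix x
        have "(\<lambda>i. (g (x - (t + h i) *\<^sub>R v) - g (x - t *\<^sub>R v)) / h i) \<longlonglongrightarrow> - ?D (x - t *\<^sub>R v)"
          using der[of x t] h unfolding DERIV_def tendsto_at_iff_sequentially by (auto simp: o_def)
        then have "(\<lambda>i. w x * ((g (x - (t + h i) *\<^sub>R v) - g (x - t *\<^sub>R v)) / h i)) \<longlonglongrightarrow> w x * - ?D (x - t *\<^sub>R v)"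
          by (intro tendsto_mult_left)
        then show "(\<lambda>i. (w x * g (x - (t + h i) *\<^sub>R v) - w x * g (x - t *\<^sub>R v)) / h i)
         \<longlonglongrightarrow> w x * - ?D (x - t *\<^sub>R v)" by (simp add: right_diff_distrib)
      qed
      show "AE x in lborel. norm ((w x * g (x - (t + h i) *\<^sub>R v) - w x * g (x - t *\<^sub>R v)) / h i) \<le> L * \<bar>w x\<bar>" for i
      proof (rule AE_I2)
        fix x
        have hi: "h i \<noteq> 0" using h by auto
        have "norm ((w x * g (x - (t + h i) *\<^sub>R v) - w x * g (x - t *\<^sub>R v)) / h i)
          = \<bar>w x\<bar> * \<bar>g (x - (t + h i) *\<^sub>R v) - g (x - t *\<^sub>R v)\<bar> / \<bar>h i\<bar>"
          by (simp add: right_diff_distrib[symmetric] abs_mult)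
        also have "\<dots> \<le> \<bar>w x\<bar> * (L * \<bar>h i\<bar>) / \<bar>h i\<bar>"
          using lip[of x "t + h i" t] by (intro divide_right_mono mult_left_mono) auto
        finally show "norm ((w x * g (x - (t + h i) *\<^sub>R v) - w x * g (x - t *\<^sub>R v)) / h i) \<le> L * \<bar>w x\<bar>"
          using hi by (simp add: mult.commute)
      qed
    qed measurable
    moreover have "(LINT x|lborel. (w x * g (x - (t + h i) *\<^sub>R v) - w x * g (x - t *\<^sub>R v)) / h i)
      = ((LINT x|lborel. w x * g (x - (t + h i) *\<^sub>R v)) - (LINT x|lborel. w x * g (x - t *\<^sub>R v))) / h i" for i
      using int by simp
    ultimately show "((\<lambda>h. ((LINT x|lborel. w x * g (x - (t + h) *\<^sub>R v)) - (LINT x|lborel. w x * g (x - t *\<^sub>R v))) / h) \<circ> h)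
      \<longlonglongrightarrow> (LINT x|lborel. w x * - ?D (x - t *\<^sub>R v))"
      by (simp only: o_def)
  qed
qed

text \<open>By the mean value theorem for \<open>t \<mapsto> \<integral> w(x) g(x - t v) dx\<close> the left-hand side is, for some \<open>z\<close>, an
  integral of \<open>w\<close> against the divergence of the field \<open>- g(x - z v) v\<close>.\<close>

lemma translation_difference_bound:
  fixes w g :: "'a::euclidean_space \<Rightarrow> real"
  assumes w: "integrable lborel w" and g: "g \<in> test_fun U" "\<And>x. \<bar>g x\<bar> \<le> 1"
    and U: "\<And>x t. x \<in> U \<Longrightarrow> 0 \<le> t \<Longrightarrow> t \<le> 1 \<Longrightarrow> x + t *\<^sub>R v \<in> \<Omega>"
    and T: "\<And>\<psi>. \<psi> \<in> test_fun \<Omega> \<Longrightarrow> (\<And>x. norm (\<psi> x) \<le> 1) \<Longrightarrow> (LINT x|lborel. w x * divergence \<psi> x) \<le> T"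
  shows "(LINT x|lborel. (w (x + v) - w x) * g x) \<le> norm v * T"
proof (cases "v = 0")
  case True then show ?thesis by simp
next
  case False
  let ?D = "\<lambda>x. frechet_derivative g (at x)"
  have C: "C1_fun g" using g(1) by (rule test_funD)
  have contg: "continuous_on UNIV g" by (rule C1_fun_continuous[OF C])
  obtain K where K: "compact K" "K \<subseteq> U" "\<And>x. x \<notin> K \<Longrightarrow> g x = 0" using g unfolding test_fun_def by blast
  have [measurable]: "w \<in> borel_measurable borel" "g \<in> borel_measurable borel"
    using w contg by (auto intro: borel_measurable_continuous_onI)
  define m where "m t = (LINT x|lborel. w x * g (x - t *\<^sub>R v))" for t
  have "\<exists>z>0. z < 1 \<and> m 1 - m 0 = (1 - 0) * (LINT x|lborel. w x * - ?D (x - z *\<^sub>R v) v)"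
    unfolding m_def using DERIV_integral_translated[OF w g(1)] by (intro MVT2) auto
  then obtain z where z: "0 < z" "z < 1" and mz: "m 1 - m 0 = (LINT x|lborel. w x * - ?D (x - z *\<^sub>R v) v)"
    by auto
  \<comment> \<open>Normalising makes \<psi> admissible for \<open>T\<close>, and the lost length
    returns as the factor \<open>norm v\<close>. The support of \<psi> is that of \<open>g\<close>
    shifted by \<open>z *\<^sub>R v\<close>, which stays in \<Omega> because
    \<open>0 < z < 1\<close>.\<close>
  define e where "e = (- 1 / norm v) *\<^sub>R v"
  define \<psi> where "\<psi> x = g (x + (- z *\<^sub>R v)) *\<^sub>R e" for x
  have C': "C1_fun (\<lambda>x. g (x + (- z *\<^sub>R v)))" by (rule C1_fun_compose_translation(1)[OF C])
  have "\<psi> \<in> test_fun \<Omega>"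
  proof -
    have "C1_fun \<psi>" unfolding \<psi>_def by (intro C1_fun_scaleR C' C1_fun_const)
    moreover have "compact ((+) (z *\<^sub>R v) ` K)" by (intro compact_translation K)
    moreover have "(+) (z *\<^sub>R v) ` K \<subseteq> \<Omega>"
      using U[of _ z] K(2) z by (force simp: add.commute)
    moreover have "\<psi> x = 0" if "x \<notin> (+) (z *\<^sub>R v) ` K" for x
    proof -
      have "x + (- z *\<^sub>R v) \<notin> K" using that by (metis (no_types, lifting) add.commute add_diff_cancel_left' image_eqI uminus_add_conv_diff diff_add_cancel scaleR_minus_left)
      then show ?thesis using K(3) by (simp add: \<psi>_def)
    qed
    ultimately show ?thesis unfolding test_fun_def by blast
  qed
  moreover have "norm (\<psi> x) \<le> 1" for x using g(2) False by (simp add: \<psi>_def e_def)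
  ultimately have le: "(LINT x|lborel. w x * divergence \<psi> x) \<le> T" by (rule T)
  have div: "divergence \<psi> x = (- ?D (x - z *\<^sub>R v) v) / norm v" for x
  proof -
    have "(\<psi> has_derivative (\<lambda>h. ?D (x - z *\<^sub>R v) h *\<^sub>R e)) (at x)"
      unfolding \<psi>_def
      using has_derivative_scaleR_left[OF C1_fun_has_derivative[OF C', of x], of e]
        C1_fun_compose_translation(2)[OF C, of "- z *\<^sub>R v" x] by simp
    then have fd: "frechet_derivative \<psi> (at x) = (\<lambda>h. ?D (x - z *\<^sub>R v) h *\<^sub>R e)"
      using frechet_derivative_at by metis
    have lin: "linear (?D (x - z *\<^sub>R v))"
      using has_derivative_linear[OF C1_fun_has_derivative[OF C]] .
    have "divergence \<psi> x = (\<Sum>b\<in>Basis. (e \<bullet> b) * ?D (x - z *\<^sub>R v) b)"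
      unfolding divergence_def fd by (simp add: mult.commute)
    also have "\<dots> = ?D (x - z *\<^sub>R v) (\<Sum>b\<in>Basis. (e \<bullet> b) *\<^sub>R b)"
      by (simp add: linear_sum[OF lin] linear_scale[OF lin])
    also have "\<dots> = ?D (x - z *\<^sub>R v) e" by (simp add: euclidean_representation)
    also have "\<dots> = (- ?D (x - z *\<^sub>R v) v) / norm v" unfolding e_def by (subst linear_scale[OF lin]) simp
    finally show ?thesis .
  qed
  have int: "integrable lborel (\<lambda>x. w x * g (x - t *\<^sub>R v))" for t
  proof (rule Bochner_Integration.integrable_bound[OF w])
    show "AE x in lborel. norm (w x * g (x - t *\<^sub>R v)) \<le> norm (w x)"
      using g(2) by (auto simp: abs_mult mult_left_le)
  qed measurable
  have "(LINT x|lborel. (w (x + v) - w x) * g x) = (LINT x|lborel. w (x + v) * g x - w x * g x)"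
    by (simp add: left_diff_distrib)
  also have "\<dots> = (LINT x|lborel. w (x + v) * g x) - m 0"
  proof (subst Bochner_Integration.integral_diff)
    show "integrable lborel (\<lambda>x. w x * g x)" using int[of 0] by simp
    have "integrable (distr lborel borel ((+) v)) (\<lambda>x. w x * g (x - 1 *\<^sub>R v))"
      using int[of 1] by (simp add: lborel_distr_plus)
    then show "integrable lborel (\<lambda>x. w (x + v) * g x)"
      by (subst (asm) integrable_distr_eq) (auto simp: add.commute)
  qed (simp add: m_def)
  also have "(LINT x|lborel. w (x + v) * g x) = m 1"
    unfolding m_def using integral_lborel_translate[of "\<lambda>x. w x * g (x - v)" v] by simp
  also have "m 1 - m 0 = norm v * (LINT x|lborel. w x * divergence \<psi> x)"
    unfolding mz div using False by (subst integral_mult_right_zero[symmetric]) (simp add: field_simps)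
  also have "\<dots> \<le> norm v * T" using le by (intro mult_left_mono) auto
  finally show ?thesis .
qed


section \<open>Oscillation over a family of disjoint cells\<close>

lemma open_cell_translate: "x + v \<in> open_cell s z \<longleftrightarrow> x \<in> open_cell s (z - v)"
  by (auto simp: mem_open_cell inner_diff_left inner_add_left algebra_simps)

lemma open_cell_Int_box:
  "\<exists>a c. open_cell s z \<inter> open_cell s z' = box a (c :: 'a::euclidean_space)"
  unfolding open_cell_def box_Int_box by blast

lemma open_cell_segment:
  assumes "x \<in> open_cell s z" "x + v \<in> open_cell s z" "0 \<le> t" "t \<le> 1"
  shows "x + t *\<^sub>R v \<in> open_cell s z"
proof -
  have "convex (open_cell s z)" unfolding open_cell_def by (rule convex_box)
  from convexD_alt[OF this assms(1,2), of t] assms(3,4) show ?thesis by (simp add: algebra_simps)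
qed

lemma open_cell_sets [measurable]: "open_cell s z \<in> sets borel"
  unfolding open_cell_def by measurable

lemma cell_sets [measurable]: "cell s z \<in> sets borel"
  unfolding cell_def by measurable

lemma emeasure_open_cell:
  "s \<ge> 0 \<Longrightarrow> emeasure lborel (open_cell s (z :: 'a::euclidean_space)) = ennreal (s ^ DIM('a))"
  unfolding open_cell_def by (subst emeasure_lborel_box) (auto simp: inner_add_left)

text \<open>If \<open>x\<close> and \<open>x + v\<close> lie in the same cell, convexity keeps the
  segment between them in that cell and hence in \<Omega>, as the bound for a single translation
  requires. A cell meets a shifted cell in a box, so the duality with test functions applies to the
  union.\<close>

lemma translation_difference_cells:
  fixes w :: "'a::euclidean_space \<Rightarrow> real" and s T :: real
  assumes w: "integrable lborel w" and Z: "finite Z" and sub: "\<And>z. z \<in> Z \<Longrightarrow> open_cell s z \<subseteq> \<Omega>"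
    and T: "\<And>\<psi>. \<psi> \<in> test_fun \<Omega> \<Longrightarrow> (\<And>x. norm (\<psi> x) \<le> 1) \<Longrightarrow> (LINT x|lborel. w x * divergence \<psi> x) \<le> T"
  shows "(\<integral>\<^sup>+x. indicator (\<Union>z\<in>Z. open_cell s z \<inter> open_cell s (z - v)) x * ennreal \<bar>w (x + v) - w x\<bar> \<partial>lborel)
     \<le> ennreal (norm v * T)"
proof -
  have [measurable]: "w \<in> borel_measurable borel" using w by auto
  have "\<forall>z. \<exists>a c. open_cell s z \<inter> open_cell s (z - v) = box a c" using open_cell_Int_box by blast
  then obtain a c where ac: "\<And>z. open_cell s z \<inter> open_cell s (z - v) = box (a z) (c z)" by metis
  define U where "U = (\<Union>z\<in>Z. open_cell s z \<inter> open_cell s (z - v))"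
  have U: "U = (\<Union>z\<in>Z. box (a z) (c z))" unfolding U_def ac ..
  have [measurable]: "U \<in> sets borel" unfolding U by (auto intro!: borel_open)
  have "integrable (distr lborel borel ((+) v)) w" using w by (simp add: lborel_distr_plus)
  then have wv: "integrable lborel (\<lambda>x. w (x + v))"
    by (subst (asm) integrable_distr_eq) (auto simp: add.commute)
  let ?F = "\<lambda>x. w (x + v) - w x"
  have F: "integrable lborel ?F" using w wv by simp
  have "(LINT x|lebesgue. indicator U x * \<bar>?F x\<bar>) \<le> norm v * T"
  proof (rule L1_norm_by_test_functions[OF _ Z U])
    show "integrable lebesgue ?F" using F by (simp add: integrable_completion)
    fix g :: "'a \<Rightarrow> real"
    assume g: "g \<in> test_fun U" "\<And>x. \<bar>g x\<bar> \<le> 1"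
    have [measurable]: "g \<in> borel_measurable borel"
      using C1_fun_continuous[OF test_funD[OF g(1)]] by (auto intro: borel_measurable_continuous_onI)
    have "(LINT x|lborel. ?F x * g x) \<le> norm v * T"
    proof (rule translation_difference_bound[OF w g _ T])
      fix y and r :: real assume y: "y \<in> U" "0 \<le> r" "r \<le> 1"
      then obtain z where z: "z \<in> Z" "y \<in> open_cell s z" "y \<in> open_cell s (z - v)"
        unfolding U_def by blast
      show "y + r *\<^sub>R v \<in> \<Omega>"
        using open_cell_segment[OF z(2) iffD2[OF open_cell_translate z(3)] y(2,3)] sub[OF z(1)] by blast
    qed (use g in auto)
    then show "(LINT x|lebesgue. ?F x * g x) \<le> norm v * T" by (subst integral_completion) auto
  qed
  then have le: "(LINT x|lborel. indicator U x * \<bar>?F x\<bar>) \<le> norm v * T" by (subst (asm) integral_completion) auto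
  have int: "integrable lborel (\<lambda>x. indicator U x * \<bar>?F x\<bar>)"
    by (rule Bochner_Integration.integrable_bound[OF F]) (auto simp: indicator_def)
  have "(\<integral>\<^sup>+x. indicator U x * ennreal \<bar>?F x\<bar> \<partial>lborel) = (\<integral>\<^sup>+x. ennreal (indicator U x * \<bar>?F x\<bar>) \<partial>lborel)"
    by (intro nn_integral_cong) (auto simp: indicator_def)
  also have "\<dots> = ennreal (LINT x|lborel. indicator U x * \<bar>?F x\<bar>)"
    by (intro nn_integral_eq_integral int) auto
  also have "\<dots> \<le> ennreal (norm v * T)" using le by (rule ennreal_leI)
  finally show ?thesis unfolding U_def .
qed

text \<open>Substituting \<open>y = x + v\<close> turns pairs of points in a common cell into points
  and shifts, and each shift is covered by the translation bound. Two points of one cell differ by a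
  \<open>v\<close> in a cube of side \<open>2 * s\<close>, where \<open>norm v\<close> is at most
  the dimension times \<open>s\<close>; the two factors of the bound are the volume of this cube and
  the estimate for one shift.\<close>

lemma double_difference_cells:
  fixes w :: "'a::euclidean_space \<Rightarrow> real" and s T :: real
  assumes w: "integrable lborel w" and Z: "finite Z" and sub: "\<And>z. z \<in> Z \<Longrightarrow> open_cell s z \<subseteq> \<Omega>"
    and s: "s > 0" and disj: "\<And>z z'. z \<in> Z \<Longrightarrow> z' \<in> Z \<Longrightarrow> z \<noteq> z' \<Longrightarrow> open_cell s z \<inter> open_cell s z' = {}"
    and T: "\<And>\<psi>. \<psi> \<in> test_fun \<Omega> \<Longrightarrow> (\<And>x. norm (\<psi> x) \<le> 1) \<Longrightarrow> (LINT x|lborel. w x * divergence \<psi> x) \<le> T"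
    and T0: "T \<ge> 0"
  shows "(\<integral>\<^sup>+x. (\<integral>\<^sup>+y. (\<Sum>z\<in>Z. indicator (open_cell s z) x * indicator (open_cell s z) y) * ennreal \<bar>w y - w x\<bar> \<partial>lborel) \<partial>lborel)
     \<le> ennreal ((2 * s) ^ DIM('a) * (DIM('a) * s * T))" (is "?L \<le> _")
proof -
  have [measurable]: "w \<in> borel_measurable borel" using w by auto
  let ?I = "\<lambda>x y. (\<Sum>z\<in>Z. indicator (open_cell s z) x * indicator (open_cell s z) y :: ennreal)"
  have "?L = (\<integral>\<^sup>+x. (\<integral>\<^sup>+v. ?I x (v + x) * ennreal \<bar>w (v + x) - w x\<bar> \<partial>lborel) \<partial>lborel)"
  proof (rule nn_integral_cong)
    fix x :: 'a
    show "(\<integral>\<^sup>+y. ?I x y * ennreal \<bar>w y - w x\<bar> \<partial>lborel) = (\<integral>\<^sup>+v. ?I x (v + x) * ennreal \<bar>w (v + x) - w x\<bar> \<partial>lborel)"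
      by (rule nn_integral_lborel_translate[of "\<lambda>y. ?I x y * ennreal \<bar>w y - w x\<bar>" x, symmetric]) measurable
  qed
  also have "\<dots> = (\<integral>\<^sup>+v. (\<integral>\<^sup>+x. ?I x (v + x) * ennreal \<bar>w (v + x) - w x\<bar> \<partial>lborel) \<partial>lborel)"
    by (intro lborel_pair.Fubini') measurable
  also have "\<dots> \<le> (\<integral>\<^sup>+v. ennreal (DIM('a) * s * T) * indicator (cbox (- s *\<^sub>R One) (s *\<^sub>R One :: 'a)) v \<partial>lborel)"
  proof (rule nn_integral_mono)
    fix v :: 'a
    let ?U = "\<Union>z\<in>Z. open_cell s z \<inter> open_cell s (z - v)"
    have I: "?I x (v + x) = indicator ?U x" for x
    proof -
      have "?I x (v + x) = (\<Sum>z\<in>Z. indicator (open_cell s z \<inter> open_cell s (z - v)) x)"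
        using open_cell_translate[of x v] by (intro sum.cong refl) (simp add: indicator_def add.commute[of v x])
      also have "\<dots> = indicator ?U x"
      proof (rule indicator_UN_disjoint[OF Z, symmetric])
        show "disjoint_family_on (\<lambda>z. open_cell s z \<inter> open_cell s (z - v)) Z"
          using disj unfolding disjoint_family_on_def by blast
      qed
      finally show ?thesis .
    qed
    show "(\<integral>\<^sup>+x. ?I x (v + x) * ennreal \<bar>w (v + x) - w x\<bar> \<partial>lborel)
       \<le> ennreal (DIM('a) * s * T) * indicator (cbox (- s *\<^sub>R One) (s *\<^sub>R One)) v"
    proof (cases "v \<in> cbox (- s *\<^sub>R One) (s *\<^sub>R One)")
      case True
      have "norm v \<le> (\<Sum>b\<in>Basis. \<bar>v \<bullet> b\<bar>)" by (rule norm_le_l1)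
      also have "\<dots> \<le> (\<Sum>b\<in>(Basis::'a set). s)"
      proof (intro sum_mono)
        fix b :: 'a assume "b \<in> Basis"
        with True have "- s \<le> v \<bullet> b" "v \<bullet> b \<le> s" by (simp_all add: mem_box)
        then show "\<bar>v \<bullet> b\<bar> \<le> s" by linarith
      qed
      finally have "norm v \<le> DIM('a) * s" by simp
      then have "norm v * T \<le> DIM('a) * s * T" using T0 by (rule mult_right_mono)
      then have n: "ennreal (norm v * T) \<le> ennreal (DIM('a) * s * T)" by (rule ennreal_leI)
      have "(\<integral>\<^sup>+x. indicator ?U x * ennreal \<bar>w (x + v) - w x\<bar> \<partial>lborel) \<le> ennreal (norm v * T)"
        by (rule translation_difference_cells[OF w Z sub T])
      from order_trans[OF this n] show ?thesis using True unfolding I unfolding add.commute[of v] by simp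
    next
      case False
      have "?U = {}"
      proof (rule ccontr)
        assume "?U \<noteq> {}"
        then obtain x z where "x \<in> open_cell s z" "x \<in> open_cell s (z - v)" by blast
        then have xz: "x \<in> open_cell s z" "x + v \<in> open_cell s z" by (simp_all add: open_cell_translate)
        have "- s \<le> v \<bullet> b \<and> v \<bullet> b \<le> s" if b: "b \<in> Basis" for b
          using bspec[OF xz(1)[unfolded mem_open_cell] b] bspec[OF xz(2)[unfolded mem_open_cell] b]
          unfolding inner_add_left by linarith
        then show False using False by (simp add: mem_box)
      qed
      then show ?thesis unfolding I by simp
    qed
  qed
  also have "\<dots> = ennreal (DIM('a) * s * T) * ennreal ((2 * s) ^ DIM('a))"
  proof -
    have "emeasure lborel (cbox (- s *\<^sub>R One) (s *\<^sub>R One :: 'a)) = ennreal (\<Prod>b\<in>Basis. (s *\<^sub>R One - (- s *\<^sub>R One :: 'a)) \<bullet> b)"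
      using s by (intro emeasure_lborel_cbox) simp
    also have "(\<Prod>b\<in>Basis. (s *\<^sub>R One - (- s *\<^sub>R One :: 'a)) \<bullet> b) = (\<Prod>b\<in>(Basis :: 'a set). 2 * s)"
      by (intro prod.cong refl) (simp add: inner_add_left)
    finally show ?thesis by (subst nn_integral_cmult_indicator) auto
  qed
  finally show ?thesis using s T0 by (simp add: ennreal_mult[symmetric] mult.commute)
qed

text \<open>\<open>w x - m z\<close> is the mean over \<open>y\<close> in the cell of
  \<open>w x - w y\<close>, so its integral costs at most the double integral of the differences
  divided by the volume of a cell. This division turns \<open>(2 * s)\<close> to the power of the
  dimension into a pure power of \<open>2\<close> and leaves one factor \<open>s\<close>.\<close>

theorem Poincare_cells:
  fixes w :: "'a::euclidean_space \<Rightarrow> real" and s T :: real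
  assumes w: "integrable lborel w" and Z: "finite Z" and sub: "\<And>z. z \<in> Z \<Longrightarrow> open_cell s z \<subseteq> \<Omega>"
    and s: "s > 0" and disj: "\<And>z z'. z \<in> Z \<Longrightarrow> z' \<in> Z \<Longrightarrow> z \<noteq> z' \<Longrightarrow> open_cell s z \<inter> open_cell s z' = {}"
    and T: "\<And>\<psi>. \<psi> \<in> test_fun \<Omega> \<Longrightarrow> (\<And>x. norm (\<psi> x) \<le> 1) \<Longrightarrow> (LINT x|lborel. w x * divergence \<psi> x) \<le> T"
    and T0: "T \<ge> 0"
  defines "m \<equiv> \<lambda>z. (LINT x|lborel. indicator (open_cell s z) x * w x) / s ^ DIM('a)"
  shows "(\<Sum>z\<in>Z. LINT x|lborel. indicator (open_cell s z) x * \<bar>w x - m z\<bar>) \<le> 2 ^ DIM('a) * DIM('a) * s * T"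
proof -
  let ?d = "DIM('a)"
  let ?O = "open_cell s :: 'a \<Rightarrow> 'a set"
  have [measurable]: "w \<in> borel_measurable borel" using w by auto
  have sd: "s ^ ?d > 0" using s by simp
  have em: "emeasure lborel (?O z) = ennreal (s ^ ?d)" for z :: 'a by (rule emeasure_open_cell) (use s in simp)
  have mm: "measure lborel (?O z) = s ^ ?d" for z using em sd by (simp add: measure_def)
  have iw: "integrable lborel (\<lambda>x. indicator (?O z) x * w x)" for z
    using integrable_real_mult_indicator[of "?O z" lborel w] w by (simp add: mult.commute)
  have ii: "integrable lborel (\<lambda>x. indicator (?O z) x * c :: real)" for z c
    using em by (intro integrable_mult_left integrable_real_indicator) auto
  have iF: "integrable lborel (\<lambda>x. indicator (?O z) x * \<bar>w x - c\<bar>)" for z c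
  proof -
    have "integrable lborel (\<lambda>x. \<bar>indicator (?O z) x * w x - indicator (?O z) x * c\<bar>)"
      by (intro integrable_abs Bochner_Integration.integrable_diff iw ii)
    then show ?thesis by (simp add: right_diff_distrib[symmetric] abs_mult)
  qed
  have pt: "ennreal (indicator (?O z) x * \<bar>w x - m z\<bar>) \<le>
     ennreal (1 / s ^ ?d) * (\<integral>\<^sup>+y. indicator (?O z) x * indicator (?O z) y * ennreal \<bar>w y - w x\<bar> \<partial>lborel)" for z x
  proof (cases "x \<in> ?O z")
    case True
    have "(LINT y|lborel. indicator (?O z) y * w y - indicator (?O z) y * w x) = s ^ ?d * m z - s ^ ?d * w x"
      using iw ii s by (simp add: m_def mm)
    then have "s ^ ?d * \<bar>w x - m z\<bar> = \<bar>LINT y|lborel. indicator (?O z) y * w y - indicator (?O z) y * w x\<bar>"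
      using sd by (simp add: abs_mult right_diff_distrib[symmetric] abs_minus_commute)
    also have "\<dots> \<le> (LINT y|lborel. \<bar>indicator (?O z) y * w y - indicator (?O z) y * w x\<bar>)"
      by (rule integral_abs_bound)
    also have "\<dots> = (LINT y|lborel. indicator (?O z) y * \<bar>w y - w x\<bar>)"
      by (simp add: right_diff_distrib[symmetric] abs_mult)
    finally have "\<bar>w x - m z\<bar> \<le> 1 / s ^ ?d * (LINT y|lborel. indicator (?O z) y * \<bar>w y - w x\<bar>)"
      using sd by (simp add: field_simps)
    then have "ennreal \<bar>w x - m z\<bar> \<le> ennreal (1 / s ^ ?d) * ennreal (LINT y|lborel. indicator (?O z) y * \<bar>w y - w x\<bar>)"
      using sd by (subst ennreal_mult[symmetric]) (auto intro!: ennreal_leI)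
    also have "ennreal (LINT y|lborel. indicator (?O z) y * \<bar>w y - w x\<bar>) = (\<integral>\<^sup>+y. ennreal (indicator (?O z) y * \<bar>w y - w x\<bar>) \<partial>lborel)"
      by (intro nn_integral_eq_integral[symmetric] iF) auto
    finally show ?thesis using True by (simp add: ennreal_mult ennreal_indicator)
  next
    case False then show ?thesis by simp
  qed
  have "ennreal (\<Sum>z\<in>Z. LINT x|lborel. indicator (?O z) x * \<bar>w x - m z\<bar>) = (\<Sum>z\<in>Z. \<integral>\<^sup>+x. ennreal (indicator (?O z) x * \<bar>w x - m z\<bar>) \<partial>lborel)"
  proof -
    have "(\<Sum>z\<in>Z. \<integral>\<^sup>+x. ennreal (indicator (?O z) x * \<bar>w x - m z\<bar>) \<partial>lborel) = (\<Sum>z\<in>Z. ennreal (LINT x|lborel. indicator (?O z) x * \<bar>w x - m z\<bar>))"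
      by (intro sum.cong refl nn_integral_eq_integral iF) auto
    then show ?thesis by (simp add: sum_ennreal integral_nonneg_AE)
  qed
  also have "\<dots> \<le> (\<Sum>z\<in>Z. \<integral>\<^sup>+x. ennreal (1 / s ^ ?d) * (\<integral>\<^sup>+y. indicator (?O z) x * indicator (?O z) y * ennreal \<bar>w y - w x\<bar> \<partial>lborel) \<partial>lborel)"
    by (intro sum_mono nn_integral_mono pt)
  also have "\<dots> = ennreal (1 / s ^ ?d) * (\<Sum>z\<in>Z. \<integral>\<^sup>+x. (\<integral>\<^sup>+y. indicator (?O z) x * indicator (?O z) y * ennreal \<bar>w y - w x\<bar> \<partial>lborel) \<partial>lborel)"
    by (subst sum_distrib_left) (intro sum.cong refl nn_integral_cmult, measurable)
  also have "\<dots> = ennreal (1 / s ^ ?d) * (\<integral>\<^sup>+x. (\<integral>\<^sup>+y. (\<Sum>z\<in>Z. indicator (?O z) x * indicator (?O z) y) * ennreal \<bar>w y - w x\<bar> \<partial>lborel) \<partial>lborel)"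
    by (simp add: sum_distrib_right nn_integral_sum)
  also have "\<dots> \<le> ennreal (1 / s ^ ?d) * ennreal ((2 * s) ^ ?d * (?d * s * T))"
    by (intro mult_left_mono double_difference_cells[OF w Z sub s disj T T0]) auto
  also have "\<dots> = ennreal (2 ^ ?d * ?d * s * T)"
    using s sd T0 by (subst ennreal_mult[symmetric]) (auto simp: power_mult_distrib)
  finally show ?thesis using s T0 by (subst (asm) ennreal_le_iff) auto
qed

section \<open>Geometry of cube meshes\<close>

lemma closed_cell: "closed (cell s z)"
  unfolding cell_def by (rule closed_cbox)

lemma interior_cell: "interior (cell s z) = open_cell s z"
  unfolding cell_def open_cell_def by (rule interior_cbox)

lemma closure_open_cell:
  assumes "s > 0" shows "closure (open_cell s z) = cell s z"
proof -
  have "z + (s / 2) *\<^sub>R One \<in> open_cell s z" using assms by (simp add: mem_open_cell inner_add_left)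
  then show ?thesis unfolding cell_def open_cell_def by (intro closure_box) auto
qed

lemma cell_inject:
  assumes "s > 0" "cell s z = cell s z'" shows "z = z'"
proof -
  have "z \<in> cell s z" "z' \<in> cell s z'" using assms(1) by (auto simp: mem_cell)
  then have "z \<in> cell s z'" "z' \<in> cell s z" using assms(2) by auto
  then have "\<forall>b\<in>Basis. z \<bullet> b \<le> z' \<bullet> b \<and> z' \<bullet> b \<le> z \<bullet> b" by (simp add: mem_cell)
  then have "\<And>b. b \<in> Basis \<Longrightarrow> z \<bullet> b = z' \<bullet> b" by (simp add: order_antisym)
  then show ?thesis by (rule euclidean_eqI)
qed

text \<open>The finitely many cells that miss \<open>x\<close> have a closed union, so a small ball
  around \<open>x\<close> meets only cells that contain \<open>x\<close>.\<close>

lemma finite_cells_near: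
  assumes "finite Z"
  obtains \<delta> where "\<delta> > 0" "\<And>y z. z \<in> Z \<Longrightarrow> y \<in> cell s z \<Longrightarrow> dist x y < \<delta> \<Longrightarrow> x \<in> cell s z"
proof -
  have "closed (\<Union>z\<in>{z\<in>Z. x \<notin> cell s z}. cell s z)"
    using assms by (intro closed_UN) (auto simp: closed_cell)
  then have "open (- (\<Union>z\<in>{z\<in>Z. x \<notin> cell s z}. cell s z))" by (simp only: open_Compl)
  moreover have "x \<in> - (\<Union>z\<in>{z\<in>Z. x \<notin> cell s z}. cell s z)" by auto
  ultimately obtain \<delta> where d: "\<delta> > 0" "ball x \<delta> \<subseteq> - (\<Union>z\<in>{z\<in>Z. x \<notin> cell s z}. cell s z)"
    by (meson open_contains_ball)
  show thesis
  proof (rule that[OF d(1)])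
    fix y z assume "z \<in> Z" "y \<in> cell s z" "dist x y < \<delta>"
    then show "x \<in> cell s z" using d(2) by (auto simp: subset_eq)
  qed
qed

text \<open>The term \<open>(1 + \<sigma>) / 2 * s\<close> is \<open>s\<close> for the upper face
  and \<open>0\<close> for the lower face orthogonal to \<open>k\<close>. The assumption
  \<open>neighbour\<close> says that a face with a relatively interior point in \<Omega> has an
  aligned cell on its other side; this is the only form in which conformity of the mesh is used
  later.\<close>

locale cube_mesh =
  fixes \<Omega> :: "'a::euclidean_space set" and s :: real and Z :: "'a set"
  assumes open_domain: "open \<Omega>"
    and bounded_domain: "bounded \<Omega>"
    and side_pos: "s > 0"
    and finite_corners: "finite Z"
    and cells_disjoint: "\<lbrakk>z \<in> Z; z' \<in> Z; z \<noteq> z'\<rbrakk> \<Longrightarrow> open_cell s z \<inter> open_cell s z' = {}"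
    and cells_cover: "\<Omega> \<subseteq> (\<Union>z\<in>Z. cell s z)"
    and open_cell_subset: "z \<in> Z \<Longrightarrow> open_cell s z \<subseteq> \<Omega>"
    and neighbour: "\<lbrakk>z \<in> Z; k \<in> Basis; \<sigma> \<in> {1, -1}; p \<in> \<Omega>; p \<bullet> k = z \<bullet> k + (1 + \<sigma>) / 2 * s;
      \<And>j. j \<in> Basis - {k} \<Longrightarrow> z \<bullet> j < p \<bullet> j \<and> p \<bullet> j < z \<bullet> j + s\<rbrakk> \<Longrightarrow> z + (\<sigma> * s) *\<^sub>R k \<in> Z"

text \<open>\<open>is_mesh\<close> ties the cells to \<Omega> only up to null sets. The exact
  inclusions are recovered because a nonempty open set is never negligible.\<close>

lemma is_mesh_imp_cube_mesh:
  fixes \<Omega> :: "'a::euclidean_space set"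
  assumes mesh: "is_mesh \<Omega> s \<Q>" and dom: "bounded_lipschitz_domain \<Omega>"
  defines "Z \<equiv> {z. cell s z \<in> \<Q>}"
  shows "cube_mesh \<Omega> s Z" and "\<Q> = cell s ` Z"
proof -
  have s: "s > 0" and fin: "finite \<Q>" and cells: "\<And>Q. Q \<in> \<Q> \<Longrightarrow> is_cell s Q"
    and pw: "\<And>Q Q'. Q \<in> \<Q> \<Longrightarrow> Q' \<in> \<Q> \<Longrightarrow> Q \<noteq> Q' \<Longrightarrow> interior Q \<inter> interior Q' = {} \<and>
        (Q \<inter> Q' = {} \<or> (Q \<inter> Q') face_of Q \<and> (Q \<inter> Q') face_of Q')"
    and neg: "negligible ((\<Union>\<Q> - \<Omega>) \<union> (\<Omega> - \<Union>\<Q>))"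
    using mesh unfolding is_mesh_def by blast+
  have op: "open \<Omega>" and bd: "bounded \<Omega>" and lip: "lipschitz_boundary \<Omega>"
    using dom unfolding bounded_lipschitz_domain_def by auto
  show Q: "\<Q> = cell s ` Z"
  proof
    show "\<Q> \<subseteq> cell s ` Z"
    proof
      fix Q assume "Q \<in> \<Q>"
      then obtain z where "Q = cell s z" using cells[of Q] unfolding is_cell_def cell_def by auto
      then show "Q \<in> cell s ` Z" using \<open>Q \<in> \<Q>\<close> by (auto simp: Z_def)
    qed
  qed (auto simp: Z_def)
  have finZ: "finite Z"
    by (rule finite_imageD[of "cell s"]) (use fin Q cell_inject[OF s] in \<open>auto simp: inj_on_def\<close>)
  have pwz: "open_cell s z \<inter> open_cell s z' = {}"
    "cell s z \<inter> cell s z' \<noteq> {} \<Longrightarrow> (cell s z \<inter> cell s z') face_of cell s z"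
    if "z \<in> Z" "z' \<in> Z" "z \<noteq> z'" for z z'
    using pw[of "cell s z" "cell s z'"] that cell_inject[OF s, of z z'] by (auto simp: Z_def interior_cell)
  have cover: "\<Omega> \<subseteq> (\<Union>z\<in>Z. cell s z)"
  proof -
    have "closed (\<Union>\<Q>)" unfolding Q using finZ by (intro closed_UN) (auto simp: closed_cell)
    then have "open (\<Omega> - \<Union>\<Q>)" using op by (intro open_Diff)
    moreover have "negligible (\<Omega> - \<Union>\<Q>)" by (rule negligible_subset[OF neg]) auto
    ultimately have "\<Omega> - \<Union>\<Q> = {}" using open_not_negligible by blast
    then show ?thesis using Q by auto
  qed
  \<comment> \<open>A mesh determines \<open>\<Omega>\<close> only up to a null set; the Lipschitz boundary excludes slits in a cell.\<close>
  have sub: "open_cell s z \<subseteq> \<Omega>" if z: "z \<in> Z" for z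
  proof (rule ccontr)
    assume "\<not> open_cell s z \<subseteq> \<Omega>"
    then obtain x where x: "x \<in> open_cell s z" "x \<notin> \<Omega>" by blast
    have oc: "open (open_cell s z)" unfolding open_cell_def by (rule open_box)
    have "open_cell s z - \<Omega> \<subseteq> (\<Union>\<Q> - \<Omega>) \<union> (\<Omega> - \<Union>\<Q>)"
      using z interior_subset[of "cell s z"] unfolding Z_def interior_cell by auto
    then have small: "V = {}" if "open V" "V \<subseteq> open_cell s z - \<Omega>" for V
      using that neg open_not_negligible negligible_subset by (metis order_trans)
    have "x \<in> closure \<Omega>"
    proof (rule ccontr)
      assume "x \<notin> closure \<Omega>"
      moreover have "open (open_cell s z - closure \<Omega>)" using oc by (intro open_Diff) auto
      moreover have "open_cell s z - closure \<Omega> \<subseteq> open_cell s z - \<Omega>" using closure_subset[of \<Omega>] by auto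
      ultimately show False using small[of "open_cell s z - closure \<Omega>"] x by auto
    qed
    then have "x \<in> frontier \<Omega>" using x op by (simp add: frontier_def interior_open)
    then obtain r e L \<gamma> where r: "r > 0" "norm e = 1" "L-lipschitz_on {y. y \<bullet> e = 0} \<gamma>"
      "\<Omega> \<inter> ball x r = {y \<in> ball x r. (\<gamma> :: 'a \<Rightarrow> real) (y - (y \<bullet> e) *\<^sub>R e) < y \<bullet> e}"
      using lip unfolding lipschitz_boundary_def by blast
    have ee: "e \<bullet> e = 1" using r(2) by (simp add: norm_eq_1)
    \<comment> \<open>The part of the cell strictly below the graph is open and outside \<Omega>,
      hence empty. But \<open>x\<close> lies on or below the graph, so a small step from
      \<open>x\<close> against \<open>e\<close> enters it.\<close>
    define V where "V = (open_cell s z \<inter> ball x r) \<inter> {y. y \<bullet> e < \<gamma> (y - (y \<bullet> e) *\<^sub>R e)}"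
    have "continuous_on UNIV (\<lambda>y. \<gamma> (y - (y \<bullet> e) *\<^sub>R e))"
      by (rule continuous_on_compose2[OF lipschitz_on_continuous_on[OF r(3)]])
         (auto intro!: continuous_intros simp: inner_diff_left ee)
    then have "open {y. y \<bullet> e < \<gamma> (y - (y \<bullet> e) *\<^sub>R e)}"
      by (intro open_Collect_less continuous_intros)
    then have "open V" unfolding V_def using oc by (intro open_Int) auto
    moreover have "V \<subseteq> open_cell s z - \<Omega>"
    proof
      fix y assume y: "y \<in> V"
      have "y \<notin> \<Omega>"
      proof
        assume "y \<in> \<Omega>"
        then have "y \<in> {y \<in> ball x r. \<gamma> (y - (y \<bullet> e) *\<^sub>R e) < y \<bullet> e}" using y r(4) unfolding V_def by blast
        then show False using y unfolding V_def by simp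
      qed
      then show "y \<in> open_cell s z - \<Omega>" using y unfolding V_def by blast
    qed
    ultimately have "V = {}" by (rule small)
    have "open (open_cell s z \<inter> ball x r)" "x \<in> open_cell s z \<inter> ball x r" using oc x r by auto
    then obtain \<epsilon> where eps: "\<epsilon> > 0" "cball x \<epsilon> \<subseteq> open_cell s z \<inter> ball x r"
      by (meson open_contains_cball)
    define y where "y = x - \<epsilon> *\<^sub>R e"
    have "y \<in> cball x \<epsilon>" using eps r(2) by (simp add: y_def dist_norm)
    then have "y \<in> open_cell s z \<inter> ball x r" using eps by blast
    moreover have "y \<bullet> e < \<gamma> (y - (y \<bullet> e) *\<^sub>R e)"
    proof -
      have "x \<notin> {y \<in> ball x r. \<gamma> (y - (y \<bullet> e) *\<^sub>R e) < y \<bullet> e}" unfolding r(4)[symmetric] using x(2) by blast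
      then have "\<not> \<gamma> (x - (x \<bullet> e) *\<^sub>R e) < x \<bullet> e" using r(1) by simp
      moreover have "y - (y \<bullet> e) *\<^sub>R e = x - (x \<bullet> e) *\<^sub>R e"
        by (simp add: y_def inner_diff_left ee algebra_simps)
      moreover have "y \<bullet> e = x \<bullet> e - \<epsilon>" by (simp add: y_def inner_diff_left ee)
      ultimately show ?thesis using eps(1) by simp
    qed
    ultimately show False using \<open>V = {}\<close> unfolding V_def by blast
  qed
  show "cube_mesh \<Omega> s Z"
  proof
    fix z k p and \<sigma> :: real
    assume z: "z \<in> Z" and k: "k \<in> Basis" and sg: "\<sigma> \<in> {1, -1}" and p: "p \<in> \<Omega>"
      and pk: "p \<bullet> k = z \<bullet> k + (1 + \<sigma>) / 2 * s"
      and pj: "\<And>j. j \<in> Basis - {k} \<Longrightarrow> z \<bullet> j < p \<bullet> j \<and> p \<bullet> j < z \<bullet> j + s"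
    have kk: "k \<bullet> k = 1" "norm k = 1" using k by (auto simp: inner_same_Basis)
    have kj: "i \<bullet> j = 0" if "i \<in> Basis" "j \<in> Basis" "j \<noteq> i" for i j :: 'a using that inner_not_same_Basis by metis
    have pz: "p \<in> cell s z"
      unfolding mem_cell
    proof
      fix b :: 'a assume "b \<in> Basis"
      then show "z \<bullet> b \<le> p \<bullet> b \<and> p \<bullet> b \<le> z \<bullet> b + s"
        using pj[of b] pk sg s by (cases "b = k") auto
    qed
    obtain r where r: "r > 0" "ball p r \<subseteq> \<Omega>" using op p by (meson open_contains_ball)
    obtain \<delta> where d: "\<delta> > 0" "\<And>y z'. z' \<in> Z \<Longrightarrow> y \<in> cell s z' \<Longrightarrow> dist p y < \<delta> \<Longrightarrow> p \<in> cell s z'"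
      using finite_cells_near[OF finZ, of s p] by metis
    \<comment> \<open>A step of this length through the face at \<open>p\<close> stays in \<Omega>,
      so it ends in some cell \<open>z'\<close>; since it is shorter than \<delta>, that cell also
      contains \<open>p\<close>.\<close>
    define \<epsilon> where "\<epsilon> = min r \<delta> / 2"
    have eps: "\<epsilon> > 0" "\<epsilon> < r" "\<epsilon> < \<delta>" using r d by (auto simp: \<epsilon>_def)
    define q where "q = p + (\<sigma> * \<epsilon>) *\<^sub>R k"
    have dq: "dist p q = \<epsilon>" using sg eps kk by (auto simp: q_def dist_norm)
    then have "q \<in> \<Omega>" using r eps by (auto simp: subset_eq)
    then obtain z' where z': "z' \<in> Z" "q \<in> cell s z'" using cover by auto
    have pz': "p \<in> cell s z'" using d(2)[OF z'] dq eps by simp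
    have qk: "q \<bullet> k = p \<bullet> k + \<sigma> * \<epsilon>" by (simp add: q_def inner_add_left kk)
    have "q \<notin> cell s z"
    proof
      assume "q \<in> cell s z"
      then have "z \<bullet> k \<le> q \<bullet> k \<and> q \<bullet> k \<le> z \<bullet> k + s" using k by (auto simp: mem_cell)
      then show False using pk qk sg eps s by auto
    qed
    then have ne: "z \<noteq> z'" using z' by auto
    have face: "(cell s z \<inter> cell s z') face_of cell s z" using pwz(2)[OF z z'(1) ne] pz pz' by auto
    \<comment> \<open>\<open>p\<close> lies strictly between two points \<open>a\<close> and
      \<open>b\<close> on opposite sides of the cell in direction \<open>j\<close>. A face that
      contains \<open>p\<close> contains both of them, so \<open>z'\<close> spans the same interval
      in direction \<open>j\<close>.\<close>
    have zj: "z' \<bullet> j = z \<bullet> j" if j: "j \<in> Basis" "j \<noteq> k" for j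
    proof -
      define a where "a = p + (z \<bullet> j - p \<bullet> j) *\<^sub>R j"
      define b where "b = p + (z \<bullet> j + s - p \<bullet> j) *\<^sub>R j"
      have jj: "j \<bullet> j = 1" using j by (auto simp: inner_same_Basis)
      have aj: "a \<bullet> j = z \<bullet> j" "b \<bullet> j = z \<bullet> j + s" by (auto simp: a_def b_def inner_add_left jj)
      have ai: "a \<bullet> i = p \<bullet> i" "b \<bullet> i = p \<bullet> i" if "i \<in> Basis" "i \<noteq> j" for i
        using kj[OF j(1) that] by (auto simp: a_def b_def inner_add_left)
      have "z \<bullet> i \<le> a \<bullet> i \<and> a \<bullet> i \<le> z \<bullet> i + s \<and> z \<bullet> i \<le> b \<bullet> i \<and> b \<bullet> i \<le> z \<bullet> i + s" if "i \<in> Basis" for i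
        using aj ai[OF that] pz[unfolded mem_cell] that s by (cases "i = j") auto
      then have ab: "a \<in> cell s z" "b \<in> cell s z" by (auto simp: mem_cell)
      have lt: "z \<bullet> j < p \<bullet> j" "p \<bullet> j < z \<bullet> j + s" using pj[of j] j by auto
      define u where "u = (p \<bullet> j - z \<bullet> j) / s"
      have u: "0 < u" "u < 1" using lt s by (auto simp: u_def divide_simps)
      have "(1 - u) *\<^sub>R a + u *\<^sub>R b = p + ((1 - u) * (z \<bullet> j - p \<bullet> j) + u * (z \<bullet> j + s - p \<bullet> j)) *\<^sub>R j"
        by (simp add: a_def b_def algebra_simps)
      also have "(1 - u) * (z \<bullet> j - p \<bullet> j) + u * (z \<bullet> j + s - p \<bullet> j) = 0"
        using s by (simp add: u_def field_simps)
      finally have "p = (1 - u) *\<^sub>R a + u *\<^sub>R b" by simp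
      moreover have "a \<noteq> b" using aj s by auto
      ultimately have "p \<in> open_segment a b" using u unfolding in_segment by blast
      then have "a \<in> cell s z'" "b \<in> cell s z'"
        using face ab pz pz' unfolding face_of_def by blast+
      then have "z' \<bullet> j \<le> a \<bullet> j" "b \<bullet> j \<le> z' \<bullet> j + s" using j by (auto simp: mem_cell)
      then show ?thesis using aj by simp
    qed
    have zk: "z' \<bullet> k \<le> q \<bullet> k" "q \<bullet> k \<le> z' \<bullet> k + s" "z' \<bullet> k \<le> p \<bullet> k" "p \<bullet> k \<le> z' \<bullet> k + s"
      using z'(2) pz' k by (auto simp: mem_cell)
    \<comment> \<open>All other coordinates agree, so corners closer than \<open>s\<close> in
      direction \<open>k\<close> would put the midpoint of the two centres into both open
      cells.\<close>
    have far: "\<bar>z' \<bullet> k - z \<bullet> k\<bar> \<ge> s"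
    proof (rule ccontr)
      assume "\<not> s \<le> \<bar>z' \<bullet> k - z \<bullet> k\<bar>"
      define x where "x = (1/2) *\<^sub>R (z + z') + (s/2) *\<^sub>R One"
      have "z \<bullet> i < x \<bullet> i \<and> x \<bullet> i < z \<bullet> i + s \<and> z' \<bullet> i < x \<bullet> i \<and> x \<bullet> i < z' \<bullet> i + s" if "i \<in> Basis" for i
      proof (cases "i = k")
        case True
        then show ?thesis using \<open>\<not> s \<le> \<bar>z' \<bullet> k - z \<bullet> k\<bar>\<close> s k by (auto simp: x_def inner_add_left field_simps)
      next
        case False
        then show ?thesis using zj[OF that False] s that by (simp add: x_def inner_add_left)
      qed
      then have "x \<in> open_cell s z" "x \<in> open_cell s z'" by (auto simp: mem_open_cell)
      then show False using pwz(1)[OF z z'(1) ne] by auto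
    qed
    have "z' = z + (\<sigma> * s) *\<^sub>R k"
    proof (rule euclidean_eqI)
      fix i :: 'a assume i: "i \<in> Basis"
      show "z' \<bullet> i = (z + (\<sigma> * s) *\<^sub>R k) \<bullet> i"
      proof (cases "i = k")
        case True
        have "z' \<bullet> k = z \<bullet> k + \<sigma> * s" using sg zk far pk qk eps s by auto
        then show ?thesis using True by (simp add: inner_add_left kk)
      next
        case False
        then show ?thesis using zj[OF i False] kj[OF k i False] by (simp add: inner_add_left)
      qed
    qed
    then show "z + (\<sigma> * s) *\<^sub>R k \<in> Z" using z' by simp
  qed (use op bd s finZ pwz cover sub in auto)
qed


section \<open>Outer normals of a meshed domain\<close>

context cube_mesh
begin

lemma cell_subset_closure: "z \<in> Z \<Longrightarrow> cell s z \<subseteq> closure \<Omega>"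
  using closure_mono[OF open_cell_subset] closure_open_cell[OF side_pos] by metis

lemma closure_subset_cells: "closure \<Omega> \<subseteq> (\<Union>z\<in>Z. cell s z)"
  by (rule closure_minimal[OF cells_cover]) (intro closed_UN finite_corners ballI closed_cell)

text \<open>Near \<open>x\<close> all cells stay on the inner side of the tangent plane, while the
  points of that plane still belong to cells. Cells are products of intervals, which allows this
  only if \<open>n\<close> is plus or minus a basis vector. A cell at \<open>x\<close> then cannot
  extend beyond \<open>x\<close> in direction \<open>n\<close>, so \<open>x\<close> is on its outer
  face and nothing lies across that face.\<close>

lemma outer_unit_normal_cell:
  assumes n: "outer_unit_normal \<Omega> x n" and z: "z \<in> Z" "x \<in> cell s z"
  obtains k \<sigma> where "k \<in> Basis" "\<sigma> \<in> {1, -1}" "n = \<sigma> *\<^sub>R k" "x \<bullet> k = z \<bullet> k + (1 + \<sigma>) / 2 * s"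
    "z + (\<sigma> * s) *\<^sub>R k \<notin> Z"
proof -
  obtain r where r: "r > 0" "\<Omega> \<inter> ball x r = {y \<in> ball x r. (y - x) \<bullet> n < 0}" and nn: "norm n = 1"
    using n unfolding outer_unit_normal_def by blast
  have below: "(y - x) \<bullet> n \<le> 0" if "z' \<in> Z" "y \<in> cell s z'" "dist x y < r" for y z'
  proof (rule ccontr)
    assume pos: "\<not> (y - x) \<bullet> n \<le> 0"
    have "open (ball x r \<inter> {y. 0 < (y - x) \<bullet> n})"
      by (intro open_Int open_ball open_Collect_less continuous_intros)
    moreover have "y \<in> ball x r \<inter> {y. 0 < (y - x) \<bullet> n}" using pos that by auto
    moreover have "y \<in> closure \<Omega>" using cell_subset_closure that by auto
    ultimately have "(ball x r \<inter> {y. 0 < (y - x) \<bullet> n}) \<inter> \<Omega> \<noteq> {}"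
      using open_Int_closure_eq_empty by blast
    then obtain u where u: "u \<in> \<Omega> \<inter> ball x r" "0 < (u - x) \<bullet> n" by blast
    from u(1) have "(u - x) \<bullet> n < 0" unfolding r(2) by simp
    then show False using u(2) by simp
  qed
  have on: "y \<in> closure \<Omega>" if "(y - x) \<bullet> n = 0" "dist x y < r" for y
  proof (rule ccontr)
    assume "y \<notin> closure \<Omega>"
    then have "open (ball x r - closure \<Omega>)" "y \<in> ball x r - closure \<Omega>" using that by auto
    then obtain e where e: "e > 0" "cball y e \<subseteq> ball x r - closure \<Omega>" by (meson open_contains_cball)
    define u where "u = y - e *\<^sub>R n"
    have "u \<in> cball y e" using e nn by (simp add: u_def dist_norm)
    then have "u \<in> ball x r - closure \<Omega>" using e(2) by (rule rev_subsetD)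
    moreover have "(u - x) \<bullet> n = (y - x) \<bullet> n - e" using nn by (simp add: u_def inner_diff_left norm_eq_1)
    ultimately have "u \<in> \<Omega> \<inter> ball x r" unfolding r(2) using that e(1) by simp
    then show False using \<open>u \<in> ball x r - closure \<Omega>\<close> closure_subset[of \<Omega>] by blast
  qed
  obtain \<delta> where d: "\<delta> > 0" "\<And>y z. z \<in> Z \<Longrightarrow> y \<in> cell s z \<Longrightarrow> dist x y < \<delta> \<Longrightarrow> x \<in> cell s z"
    using finite_cells_near[OF finite_corners, of s x] by metis
  have kj: "i \<bullet> j = 0" if "i \<in> Basis" "j \<in> Basis" "i \<noteq> j" for i j :: 'a using that inner_not_same_Basis by metis
  have kk: "i \<bullet> i = 1" "norm i = 1" if "i \<in> Basis" for i :: 'a using that by (auto simp: inner_same_Basis)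
  \<comment> \<open>If \<open>n\<close> had two nonzero components, the tangent vector \<open>v\<close> below would leave all cones of cells at \<open>x\<close>.\<close>
  have prod0: "(n \<bullet> i) * (n \<bullet> j) = 0" if ij: "i \<in> Basis" "j \<in> Basis" "i \<noteq> j" for i j
  proof -
    define v where "v = (n \<bullet> j) *\<^sub>R i - (n \<bullet> i) *\<^sub>R j"
    define e where "e = min r \<delta> / 4"
    have e: "e > 0" "e * 2 < r" "e * 2 < \<delta>" using r d by (auto simp: e_def)
    have n1: "\<bar>n \<bullet> i\<bar> \<le> 1" "\<bar>n \<bullet> j\<bar> \<le> 1" using Basis_le_norm[of _ n] ij nn by auto
    have "norm v \<le> norm ((n \<bullet> j) *\<^sub>R i) + norm ((n \<bullet> i) *\<^sub>R j)" unfolding v_def by (rule norm_triangle_ineq4)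
    also have "\<dots> \<le> 2" using n1 kk ij by simp
    finally have v2: "norm v \<le> 2" .
    have ve: "dist x (x + e *\<^sub>R v) \<le> e * 2" using v2 e by (simp add: dist_norm mult_left_mono)
    have "(x + e *\<^sub>R v - x) \<bullet> n = 0" by (simp add: v_def inner_diff_left inner_commute[of n])
    then have "x + e *\<^sub>R v \<in> closure \<Omega>" using on ve e by simp
    then obtain z' where z': "z' \<in> Z" "x + e *\<^sub>R v \<in> cell s z'" using closure_subset_cells by blast
    have xz': "x \<in> cell s z'" using d(2)[OF z'] ve e by simp
    have vi: "v \<bullet> i = n \<bullet> j" "v \<bullet> j = - (n \<bullet> i)"
      using kk ij kj[OF ij] kj[of j i] by (auto simp: v_def inner_diff_left)
    \<comment> \<open>A cell that contains \<open>x\<close> and \<open>x + e *\<^sub>R v\<close>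
      also contains the point that takes only coordinate \<open>l\<close> from the latter. With
      \<open>l = i\<close> and \<open>l = j\<close> the half space condition bounds the product of
      the two components of \<open>n\<close> from both sides by 0.\<close>
    have mv: "(x + (e * (v \<bullet> l)) *\<^sub>R l - x) \<bullet> n \<le> 0" if l: "l \<in> Basis" "\<bar>v \<bullet> l\<bar> \<le> 1" for l
    proof (rule below[OF z'(1)])
      have "(x + (e * (v \<bullet> l)) *\<^sub>R l) \<bullet> b = (if b = l then (x + e *\<^sub>R v) \<bullet> b else x \<bullet> b)" if "b \<in> Basis" for b
        using kj[OF l(1) that] kk l by (auto simp: inner_add_left)
      then show "x + (e * (v \<bullet> l)) *\<^sub>R l \<in> cell s z'" using z'(2) xz' unfolding mem_cell by auto
      have "norm (e * (v \<bullet> l)) \<le> e" using l(2) e by (simp add: abs_mult mult_left_le)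
      then show "dist x (x + (e * (v \<bullet> l)) *\<^sub>R l) < r" using e kk l by (simp add: dist_norm)
    qed
    have "e * (n \<bullet> j) * (n \<bullet> i) \<le> 0" using mv[OF ij(1)] n1 unfolding vi by (simp add: inner_commute[of _ n])
    moreover have "e * - (n \<bullet> i) * (n \<bullet> j) \<le> 0" using mv[OF ij(2)] n1 unfolding vi by (simp add: inner_commute[of _ n])
    ultimately have "e * ((n \<bullet> i) * (n \<bullet> j)) = 0" by (simp add: algebra_simps)
    then show ?thesis using e by simp
  qed
  have "n \<noteq> 0" using nn by auto
  then obtain k where k: "k \<in> Basis" "n \<bullet> k \<noteq> 0" using euclidean_all_zero_iff by metis
  have nk: "n = (n \<bullet> k) *\<^sub>R k"
  proof (rule euclidean_eqI)
    fix b :: 'a assume b: "b \<in> Basis"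
    show "n \<bullet> b = ((n \<bullet> k) *\<^sub>R k) \<bullet> b"
    proof (cases "b = k")
      case False
      then show ?thesis using prod0[OF k(1) b] k kj[OF k(1) b] by auto
    qed (simp add: kk k)
  qed
  define \<sigma> where "\<sigma> = n \<bullet> k"
  have "norm n = \<bar>\<sigma>\<bar>" using nk kk[OF k(1)] by (metis \<sigma>_def norm_scaleR mult.right_neutral)
  then have sg: "\<sigma> \<in> {1, -1}" using nn by auto
  define e where "e = min r s / 2"
  have e: "e > 0" "e < r" "e < s" using r side_pos by (auto simp: e_def)
  have out: "x + (e * \<sigma>) *\<^sub>R k \<notin> cell s z'" if "z' \<in> Z" for z'
  proof
    assume "x + (e * \<sigma>) *\<^sub>R k \<in> cell s z'"
    from below[OF that this] have "(e * \<sigma>) * (n \<bullet> k) \<le> 0"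
      using e kk k sg by (auto simp: dist_norm abs_mult inner_commute[of _ n])
    then show False using e sg by (auto simp: \<sigma>_def[symmetric])
  qed
  have coord: "(x + (e * \<sigma>) *\<^sub>R k) \<bullet> b = (if b = k then x \<bullet> k + e * \<sigma> else x \<bullet> b)" if "b \<in> Basis" for b
    using kj[OF k(1) that] kk k by (auto simp: inner_add_left)
  have xk: "x \<bullet> k = z \<bullet> k + (1 + \<sigma>) / 2 * s"
  proof (rule ccontr)
    assume ne: "x \<bullet> k \<noteq> z \<bullet> k + (1 + \<sigma>) / 2 * s"
    have zk: "z \<bullet> k \<le> x \<bullet> k" "x \<bullet> k \<le> z \<bullet> k + s" using z k by (auto simp: mem_cell)
    \<comment> \<open>The room left in the cell in the direction of \<open>n\<close>, capped by
      \<open>e\<close> to stay within the ball. It would be positive off the outer face, and moving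
      by it would leave the half space inside a cell.\<close>
    define c where "c = min e (if \<sigma> = 1 then z \<bullet> k + s - x \<bullet> k else x \<bullet> k - z \<bullet> k)"
    have c: "c > 0" "c \<le> e" using ne zk sg e by (auto simp: c_def)
    have "(x + (c * \<sigma>) *\<^sub>R k) \<bullet> b = (if b = k then x \<bullet> k + c * \<sigma> else x \<bullet> b)" if "b \<in> Basis" for b
      using kj[OF k(1) that] kk k by (auto simp: inner_add_left)
    moreover have "z \<bullet> k \<le> x \<bullet> k + c * \<sigma>" "x \<bullet> k + c * \<sigma> \<le> z \<bullet> k + s"
      using zk sg c by (auto simp: c_def)
    ultimately have "x + (c * \<sigma>) *\<^sub>R k \<in> cell s z" using z(2) unfolding mem_cell by auto
    from below[OF z(1) this] have "(c * \<sigma>) * (n \<bullet> k) \<le> 0"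
      using c e kk k sg by (auto simp: dist_norm abs_mult inner_commute[of _ n])
    then show False using c sg by (auto simp: \<sigma>_def[symmetric])
  qed
  have notin: "z + (\<sigma> * s) *\<^sub>R k \<notin> Z"
  proof
    assume *: "z + (\<sigma> * s) *\<^sub>R k \<in> Z"
    have "(z + (\<sigma> * s) *\<^sub>R k) \<bullet> b = (if b = k then z \<bullet> k + \<sigma> * s else z \<bullet> b)" if "b \<in> Basis" for b
      using kj[OF k(1) that] kk k by (auto simp: inner_add_left)
    moreover have "z \<bullet> k + \<sigma> * s \<le> x \<bullet> k + e * \<sigma>" "x \<bullet> k + e * \<sigma> \<le> z \<bullet> k + \<sigma> * s + s"
      using xk sg e by (auto simp: field_simps)
    ultimately have "x + (e * \<sigma>) *\<^sub>R k \<in> cell s (z + (\<sigma> * s) *\<^sub>R k)"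
      using z(2) unfolding mem_cell by (auto simp: coord)
    then show False using out[OF *] by simp
  qed
  show thesis using that[OF k(1) sg _ xk notin] nk unfolding \<sigma>_def by simp
qed

end

section \<open>Face fluxes of Sobolev functions with zero trace\<close>

lemma integral_lebesgue_on:
  fixes f :: "'a::euclidean_space \<Rightarrow> 'b::{banach, second_countable_topology}"
  assumes "S \<in> sets lebesgue"
  shows "(LINT x|lebesgue_on S. f x) = (LINT x|lebesgue. indicator S x *\<^sub>R f x)"
  using assms by (simp add: integral_restrict_space)

lemma integrable_lebesgue_on:
  fixes f :: "'a::euclidean_space \<Rightarrow> 'b::{banach, second_countable_topology}"
  assumes "S \<in> sets lebesgue"
  shows "integrable (lebesgue_on S) f \<longleftrightarrow> integrable lebesgue (\<lambda>x. indicator S x *\<^sub>R f x)"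
  using assms by (simp add: integrable_restrict_space)

lemma integrable_lebesgue_on_subset:
  fixes f :: "'a::euclidean_space \<Rightarrow> 'b::{banach, second_countable_topology}"
  assumes f: "integrable (lebesgue_on S) f" and S: "S \<in> sets lebesgue" and T: "T \<in> sets lebesgue" "T \<subseteq> S"
  shows "integrable (lebesgue_on T) f"
proof -
  have "integrable lebesgue (\<lambda>x. indicator T x *\<^sub>R (indicator S x *\<^sub>R f x))"
    by (rule integrable_mult_indicator[OF T(1) f[unfolded integrable_lebesgue_on[OF S]]])
  moreover have "(\<lambda>x. indicator T x *\<^sub>R (indicator S x *\<^sub>R f x)) = (\<lambda>x. indicator T x *\<^sub>R f x)"
  proof
    fix x show "indicator T x *\<^sub>R (indicator S x *\<^sub>R f x) = indicator T x *\<^sub>R f x"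
      using T(2) by (cases "x \<in> T") auto
  qed
  ultimately show ?thesis unfolding integrable_lebesgue_on[OF T(1)] by simp
qed

lemma AE_lebesgue_on_iff:
  "S \<in> sets lebesgue \<Longrightarrow> (AE x in lebesgue_on S. P x) \<longleftrightarrow> (AE x in lebesgue. x \<in> S \<longrightarrow> P x)"
  by (simp add: AE_restrict_space_iff)

lemma AE_lebesgue_on_subset:
  assumes "AE x in lebesgue_on S. P x" "S \<in> sets lebesgue" "T \<in> sets lebesgue" "T \<subseteq> S"
  shows "AE x in lebesgue_on T. P x"
proof -
  have "AE x in lebesgue. x \<in> S \<longrightarrow> P x" using assms(1) AE_lebesgue_on_iff[OF assms(2), of P] by blast
  then have "AE x in lebesgue. x \<in> T \<longrightarrow> P x"
    by eventually_elim (use assms(4) in blast)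
  then show ?thesis using AE_lebesgue_on_iff[OF assms(3), of P] by blast
qed

lemma integrable_lebesgue_on_bounded:
  fixes f :: "'a::euclidean_space \<Rightarrow> 'b::{banach, second_countable_topology}"
  assumes "S \<in> lmeasurable" "f \<in> borel_measurable (lebesgue_on S)" "AE x in lebesgue_on S. norm (f x) \<le> B"
  shows "integrable (lebesgue_on S) f"
proof -
  interpret finite_measure "lebesgue_on S" using assms(1) by (rule finite_measure_lebesgue_on)
  show ?thesis using assms(3,2) by (rule integrable_const_bound)
qed

lemma borel_measurable_lebesgue_on:
  "f \<in> borel_measurable borel \<Longrightarrow> f \<in> borel_measurable (lebesgue_on S)"
  by (intro measurable_restrict_space1 measurable_completion) simp

lemma open_cell_lebesgue [simp]: "open_cell s z \<in> sets lebesgue"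
  using open_cell_sets by auto

lemma cell_lebesgue [simp]: "cell s z \<in> sets lebesgue"
  using cell_sets by auto

lemma open_cell_lmeasurable: "open_cell s z \<in> lmeasurable"
  unfolding open_cell_def by simp

lemma measure_open_cell:
  assumes "s > 0" shows "measure lebesgue (open_cell s (z :: 'a::euclidean_space)) = s ^ DIM('a)"
  using emeasure_open_cell[of s z] assms by (simp add: measure_def)

lemma integral_open_cell_eq_cell:
  fixes f :: "'a::euclidean_space \<Rightarrow> real"
  assumes [measurable]: "f \<in> borel_measurable borel"
  shows "(LINT x|lebesgue_on (open_cell s z). f x) = (LINT x|lborel. indicator (cell s z) x * f x)"
proof -
  have "(LINT x|lebesgue_on (open_cell s z). f x) = (LINT x|lborel. indicator (open_cell s z) x * f x)"
    by (simp add: integral_lebesgue_on integral_completion)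
  also have "\<dots> = (LINT x|lborel. indicator (cell s z) x * f x)"
  proof (rule integral_cong_AE)
    have "AE x in lborel. x \<notin> cell s z - open_cell s z" by (rule AE_not_in[OF cell_minus_open_cell])
    then show "AE x in lborel. indicator (open_cell s z) x * f x = indicator (cell s z) x * f x"
    proof eventually_elim
      case (elim x)
      have "x \<in> open_cell s z \<Longrightarrow> x \<in> cell s z" by (auto simp: mem_cell mem_open_cell less_imp_le)
      with elim show ?case by (auto simp: indicator_def)
    qed
  qed measurable
  finally show ?thesis .
qed

lemma negligible_cell_minus_open_cell: "negligible (cell s z - open_cell s z)"
  unfolding cell_def open_cell_def by (rule negligible_frontier_interval)

text \<open>\<open>c = 0\<close> stands for the upper face and \<open>c = s\<close> for the lower
  one. \<open>D\<close> is a separate argument because a weak derivative is not a function of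
  \<open>u\<close>, only a choice up to null sets.\<close>

definition cell_flux :: "real \<Rightarrow> ('a::euclidean_space \<Rightarrow> real) \<Rightarrow> ('a \<Rightarrow> real) \<Rightarrow> 'a \<Rightarrow> real \<Rightarrow> 'a \<Rightarrow> real" where
  "cell_flux s u D k c z = (LINT x|lebesgue_on (open_cell s z). u x + ((x - z) \<bullet> k - c) * D x)"

lemma cell_flux_C1:
  fixes f :: "'a::euclidean_space \<Rightarrow> real"
  assumes "C1_fun f" "k \<in> Basis" "s > 0"
  shows "cell_flux s f (\<lambda>x. frechet_derivative f (at x) k) k 0 z = face_int s k (z + s *\<^sub>R k) f"
    and "cell_flux s f (\<lambda>x. frechet_derivative f (at x) k) k s z = face_int s k z f"
proof -
  have [measurable]: "f \<in> borel_measurable borel" "(\<lambda>x. frechet_derivative f (at x) k) \<in> borel_measurable borel"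
    using C1_fun_continuous C1_fun_cont_deriv assms(1) by (auto intro!: borel_measurable_continuous_onI)
  show "cell_flux s f (\<lambda>x. frechet_derivative f (at x) k) k 0 z = face_int s k (z + s *\<^sub>R k) f"
    unfolding cell_flux_def using flux_upper[OF assms] by (subst integral_open_cell_eq_cell) simp_all
  show "cell_flux s f (\<lambda>x. frechet_derivative f (at x) k) k s z = face_int s k z f"
    unfolding cell_flux_def using flux_lower[OF assms] by (subst integral_open_cell_eq_cell) simp_all
qed

lemma open_cell_coordinate: "x \<in> open_cell s z \<Longrightarrow> k \<in> Basis \<Longrightarrow> 0 < (x - z) \<bullet> k \<and> (x - z) \<bullet> k < s"
  by (auto simp: mem_open_cell inner_diff_left)

lemma integrable_coordinate_mult:
  fixes D :: "'a::euclidean_space \<Rightarrow> real"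
  assumes D: "integrable (lebesgue_on (open_cell s z)) D" and k: "k \<in> Basis"
  shows "integrable (lebesgue_on (open_cell s z)) (\<lambda>x. ((x - z) \<bullet> k - c) * D x)"
proof (rule Bochner_Integration.integrable_bound)
  show "integrable (lebesgue_on (open_cell s z)) (\<lambda>x. (s + \<bar>c\<bar>) * D x)" using D by simp
  have "(\<lambda>x. (x - z) \<bullet> k - c) \<in> borel_measurable (lebesgue_on (open_cell s z))"
    by (rule borel_measurable_lebesgue_on) measurable
  then show "(\<lambda>x. ((x - z) \<bullet> k - c) * D x) \<in> borel_measurable (lebesgue_on (open_cell s z))"
    using D by (intro borel_measurable_times) auto
  show "AE x in lebesgue_on (open_cell s z). norm (((x - z) \<bullet> k - c) * D x) \<le> norm ((s + \<bar>c\<bar>) * D x)"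
  proof (rule AE_I2)
    fix x assume "x \<in> space (lebesgue_on (open_cell s z))"
    then have "x \<in> open_cell s z" by simp
    then have "\<bar>(x - z) \<bullet> k - c\<bar> \<le> \<bar>s + \<bar>c\<bar>\<bar>" using open_cell_coordinate[OF _ k] by fastforce
    then show "norm (((x - z) \<bullet> k - c) * D x) \<le> norm ((s + \<bar>c\<bar>) * D x)"
      by (simp add: abs_mult mult_right_mono)
  qed
qed

text \<open>The divergence theorem in one coordinate: the \<open>u\<close> terms cancel and the two
  weights of \<open>D\<close> differ by the constant \<open>s\<close>. It turns differences of face
  values into cell means of \<open>D\<close>.\<close>

lemma cell_flux_diff:
  fixes u D :: "'a::euclidean_space \<Rightarrow> real"
  assumes "integrable (lebesgue_on (open_cell s z)) u" "integrable (lebesgue_on (open_cell s z)) D" "k \<in> Basis"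
  shows "cell_flux s u D k 0 z - cell_flux s u D k s z = s * (LINT x|lebesgue_on (open_cell s z). D x)"
proof -
  have "cell_flux s u D k 0 z - cell_flux s u D k s z
    = (LINT x|lebesgue_on (open_cell s z). (u x + ((x - z) \<bullet> k - 0) * D x) - (u x + ((x - z) \<bullet> k - s) * D x))"
    unfolding cell_flux_def
    by (intro Bochner_Integration.integral_diff[symmetric] Bochner_Integration.integrable_add
        integrable_coordinate_mult assms)
  also have "\<dots> = (LINT x|lebesgue_on (open_cell s z). s * D x)"
    by (intro Bochner_Integration.integral_cong refl) (simp add: algebra_simps)
  finally show ?thesis by simp
qed

text \<open>The weight of \<open>D\<close> is bounded by \<open>s\<close> on the cell, for either
  face. The same bound gives the norm estimate of the interpolant and the continuity of fluxes in
  \<open>L1\<close>.\<close>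

lemma cell_flux_estimate:
  fixes u D :: "'a::euclidean_space \<Rightarrow> real"
  assumes u: "integrable (lebesgue_on (open_cell s z)) u" and D: "integrable (lebesgue_on (open_cell s z)) D"
    and k: "k \<in> Basis" and c: "c \<in> {0, s}"
  shows "\<bar>cell_flux s u D k c z - (LINT x|lebesgue_on (open_cell s z). u x)\<bar>
    \<le> s * (LINT x|lebesgue_on (open_cell s z). \<bar>D x\<bar>)"
proof -
  have "cell_flux s u D k c z - (LINT x|lebesgue_on (open_cell s z). u x)
    = (LINT x|lebesgue_on (open_cell s z). ((x - z) \<bullet> k - c) * D x)"
    unfolding cell_flux_def
    by (subst Bochner_Integration.integral_add) (use integrable_coordinate_mult[OF D k] u in auto)
  also have "\<bar>\<dots>\<bar> \<le> (LINT x|lebesgue_on (open_cell s z). \<bar>((x - z) \<bullet> k - c) * D x\<bar>)"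
    by (rule integral_abs_bound)
  also have "\<dots> \<le> (LINT x|lebesgue_on (open_cell s z). s * \<bar>D x\<bar>)"
  proof (rule integral_mono)
    fix x assume "x \<in> space (lebesgue_on (open_cell s z))"
    then have "\<bar>(x - z) \<bullet> k - c\<bar> \<le> s" using open_cell_coordinate[OF _ k] c by fastforce
    then show "\<bar>((x - z) \<bullet> k - c) * D x\<bar> \<le> s * \<bar>D x\<bar>" by (simp add: abs_mult mult_right_mono)
  qed (use integrable_coordinate_mult[OF D k] D in auto)
  finally show ?thesis by simp
qed

section \<open>Splitting the domain into cells, and limits of fluxes\<close>

context cube_mesh
begin

lemma domain_lebesgue [simp]: "\<Omega> \<in> sets lebesgue"
  using open_domain by auto

lemma domain_lmeasurable: "\<Omega> \<in> lmeasurable"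
  using open_domain bounded_domain by (rule lmeasurable_open[rotated])

lemma AE_domain_cells: "AE x in lebesgue. indicator \<Omega> x = (\<Sum>z\<in>Z. indicator (open_cell s z) x :: real)"
proof -
  have "negligible (\<Union>z\<in>Z. cell s z - open_cell s z)"
    using finite_corners by (intro negligible_Union) (auto simp: negligible_cell_minus_open_cell)
  then have "AE x in lebesgue. x \<notin> (\<Union>z\<in>Z. cell s z - open_cell s z)"
    by (intro AE_not_in) (simp add: negligible_iff_null_sets)
  then show ?thesis
  proof eventually_elim
    case (elim x)
    have "indicator (\<Union>z\<in>Z. open_cell s z) x = (\<Sum>z\<in>Z. indicator (open_cell s z) x :: real)"
      using cells_disjoint by (intro indicator_UN_disjoint finite_corners) (auto simp: disjoint_family_on_def)
    moreover have "x \<in> \<Omega> \<longleftrightarrow> x \<in> (\<Union>z\<in>Z. open_cell s z)"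
    proof
      assume "x \<in> \<Omega>"
      then obtain z where "z \<in> Z" "x \<in> cell s z" using cells_cover by auto
      then show "x \<in> (\<Union>z\<in>Z. open_cell s z)" using elim by auto
    next
      assume "x \<in> (\<Union>z\<in>Z. open_cell s z)"
      then show "x \<in> \<Omega>" using open_cell_subset by auto
    qed
    then have "indicator \<Omega> x = (indicator (\<Union>z\<in>Z. open_cell s z) x :: real)"
      unfolding indicator_def by (simp only:)
    ultimately show ?case by (simp only:)
  qed
qed

lemma integrable_open_cell:
  fixes f :: "'a \<Rightarrow> 'b::{banach, second_countable_topology}"
  shows "integrable (lebesgue_on \<Omega>) f \<Longrightarrow> z \<in> Z \<Longrightarrow> integrable (lebesgue_on (open_cell s z)) f"
  by (rule integrable_lebesgue_on_subset) (use open_cell_subset in auto)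

lemma integral_domain_cells:
  fixes f :: "'a \<Rightarrow> real"
  assumes "integrable (lebesgue_on \<Omega>) f"
  shows "(LINT x|lebesgue_on \<Omega>. f x) = (\<Sum>z\<in>Z. LINT x|lebesgue_on (open_cell s z). f x)"
proof -
  have "(\<Sum>z\<in>Z. LINT x|lebesgue_on (open_cell s z). f x) = (\<Sum>z\<in>Z. LINT x|lebesgue. indicator (open_cell s z) x * f x)"
    by (simp add: integral_lebesgue_on)
  also have "\<dots> = (LINT x|lebesgue. (\<Sum>z\<in>Z. indicator (open_cell s z) x * f x))"
    using integrable_open_cell[OF assms]
    by (intro Bochner_Integration.integral_sum[symmetric]) (simp add: integrable_lebesgue_on)
  also have "\<dots> = (LINT x|lebesgue. indicator \<Omega> x * f x)"
  proof (rule integral_cong_AE)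
    show "AE x in lebesgue. (\<Sum>z\<in>Z. indicator (open_cell s z) x * f x) = indicator \<Omega> x * f x"
      using AE_domain_cells by eventually_elim (simp add: sum_distrib_right)
    show "(\<lambda>x. \<Sum>z\<in>Z. indicator (open_cell s z) x * f x) \<in> borel_measurable lebesgue"
      using integrable_open_cell[OF assms]
      by (intro borel_measurable_sum) (auto simp: integrable_lebesgue_on dest!: borel_measurable_integrable)
    show "(\<lambda>x. indicator \<Omega> x * f x) \<in> borel_measurable lebesgue"
      using assms by (auto simp: integrable_lebesgue_on dest!: borel_measurable_integrable)
  qed
  finally show ?thesis by (simp add: integral_lebesgue_on)
qed

lemma integral_open_cell_le:
  fixes f :: "'a \<Rightarrow> real"
  assumes "integrable (lebesgue_on \<Omega>) f" "z \<in> Z" "\<And>x. f x \<ge> 0"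
  shows "(LINT x|lebesgue_on (open_cell s z). f x) \<le> (LINT x|lebesgue_on \<Omega>. f x)"
  unfolding integral_domain_cells[OF assms(1)]
  by (rule member_le_sum) (use assms finite_corners in auto)

text \<open>A relatively interior point of the face that belonged to \<Omega> would force a cell on
  the other side. Hence that part of the face lies outside \<Omega>, where test functions
  vanish.\<close>

lemma face_int_boundary:
  assumes f: "f \<in> test_fun \<Omega>" and z: "z \<in> Z" and k: "k \<in> Basis" and sg: "\<sigma> \<in> {1, -1}"
    and out: "z + (\<sigma> * s) *\<^sub>R k \<notin> Z"
  shows "face_int s k (z + ((1 + \<sigma>) / 2 * s) *\<^sub>R k) f = 0"
proof (rule face_int_eq_0[OF k])
  fix p assume pk: "p \<bullet> k = (z + ((1 + \<sigma>) / 2 * s) *\<^sub>R k) \<bullet> k"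
    and pj: "\<And>j. j \<in> Basis - {k} \<Longrightarrow> (z + ((1 + \<sigma>) / 2 * s) *\<^sub>R k) \<bullet> j < p \<bullet> j \<and> p \<bullet> j < (z + ((1 + \<sigma>) / 2 * s) *\<^sub>R k) \<bullet> j + s"
  have kk: "k \<bullet> k = 1" using k by (auto simp: inner_same_Basis)
  have kj: "k \<bullet> j = 0" if "j \<in> Basis - {k}" for j using that k inner_not_same_Basis by (metis DiffE singletonI)
  have "p \<notin> \<Omega>"
  proof
    assume "p \<in> \<Omega>"
    from neighbour[OF z k sg this] pk pj kj kk have "z + (\<sigma> * s) *\<^sub>R k \<in> Z"
      by (simp add: inner_add_left)
    then show False using out by simp
  qed
  then show "f p = 0" by (rule test_fun_eq_0[OF f])
qed


text \<open>What fluxes in direction \<open>k\<close> need from \<open>W11_0\<close>: one sequence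
  of globally defined test functions that converges together with its derivative along
  \<open>k\<close>.\<close>

definition (in -) zero_trace_limit :: "'a::euclidean_space set \<Rightarrow> 'a \<Rightarrow> ('a \<Rightarrow> real) \<Rightarrow> ('a \<Rightarrow> real) \<Rightarrow> bool" where
  "zero_trace_limit \<Omega> k u D \<longleftrightarrow> integrable (lebesgue_on \<Omega>) u \<and> integrable (lebesgue_on \<Omega>) D \<and>
     (\<exists>\<psi> :: nat \<Rightarrow> 'a \<Rightarrow> real. (\<forall>n. \<psi> n \<in> test_fun \<Omega>) \<and>
        (\<lambda>n. LINT x|lebesgue_on \<Omega>. \<bar>\<psi> n x - u x\<bar>) \<longlonglongrightarrow> 0 \<and>
        (\<lambda>n. LINT x|lebesgue_on \<Omega>. \<bar>frechet_derivative (\<psi> n) (at x) k - D x\<bar>) \<longlonglongrightarrow> 0)"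

lemma (in -) test_fun_integrable:
  fixes f :: "'a::euclidean_space \<Rightarrow> real"
  assumes f: "f \<in> test_fun U" and S: "S \<in> sets lebesgue"
  shows "integrable (lebesgue_on S) f" and "integrable (lebesgue_on S) (\<lambda>x. frechet_derivative f (at x) k)"
proof -
  obtain K where K: "compact K" "\<And>x. x \<notin> K \<Longrightarrow> f x = 0" using f unfolding test_fun_def by blast
  have C: "C1_fun f" using f by (rule test_funD)
  have "integrable lborel f" by (rule compact_support_integrable[OF C1_fun_continuous[OF C] K])
  moreover have "integrable lborel (\<lambda>x. frechet_derivative f (at x) k)"
    by (rule compact_support_integrable[OF C1_fun_cont_deriv[OF C] K(1) test_fun_deriv_support[OF C compact_imp_closed[OF K(1)] K(2)]])
  ultimately have "integrable lebesgue f" "integrable lebesgue (\<lambda>x. frechet_derivative f (at x) k)"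
    by (simp_all add: integrable_completion)
  then show "integrable (lebesgue_on S) f" "integrable (lebesgue_on S) (\<lambda>x. frechet_derivative f (at x) k)"
    using S by (auto simp: integrable_lebesgue_on intro: integrable_mult_indicator[where 'b=real, simplified])
qed

text \<open>A flux is linear in the pair of function and derivative, so
  \<open>cell_flux_estimate\<close> applied to the differences bounds the error by their
  \<open>L1\<close> norms on \<Omega>.\<close>

lemma cell_flux_limit:
  assumes u: "integrable (lebesgue_on \<Omega>) u" and D: "integrable (lebesgue_on \<Omega>) D"
    and \<psi>: "\<And>n. \<psi> n \<in> test_fun \<Omega>"
    and l1: "(\<lambda>n. LINT x|lebesgue_on \<Omega>. \<bar>\<psi> n x - u x\<bar>) \<longlonglongrightarrow> 0"
    and l2: "(\<lambda>n. LINT x|lebesgue_on \<Omega>. \<bar>frechet_derivative (\<psi> n) (at x) k - D x\<bar>) \<longlonglongrightarrow> 0"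
    and k: "k \<in> Basis" and z: "z \<in> Z" and c: "c \<in> {0, s}"
  shows "(\<lambda>n. cell_flux s (\<psi> n) (\<lambda>x. frechet_derivative (\<psi> n) (at x) k) k c z) \<longlonglongrightarrow> cell_flux s u D k c z"
proof -
  let ?M = "lebesgue_on (open_cell s z)"
  let ?P = "\<lambda>n x. frechet_derivative (\<psi> n) (at x) k"
  note iu = integrable_open_cell[OF u z] and iD = integrable_open_cell[OF D z]
  have i\<psi>: "integrable (lebesgue_on S) (\<psi> n)" "integrable (lebesgue_on S) (?P n)" if "S \<in> sets lebesgue" for n S
    using test_fun_integrable[OF \<psi> that] by auto
  have bound: "norm (cell_flux s (\<psi> n) (?P n) k c z - cell_flux s u D k c z)
     \<le> (LINT x|lebesgue_on \<Omega>. \<bar>\<psi> n x - u x\<bar>) + s * (LINT x|lebesgue_on \<Omega>. \<bar>?P n x - D x\<bar>)" for n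
  proof -
    have i1: "integrable ?M (\<lambda>x. \<psi> n x - u x)" and i2: "integrable ?M (\<lambda>x. ?P n x - D x)"
      using i\<psi> iu iD by auto
    have "cell_flux s (\<psi> n) (?P n) k c z - cell_flux s u D k c z
      = (LINT x|?M. (\<psi> n x + ((x - z) \<bullet> k - c) * ?P n x) - (u x + ((x - z) \<bullet> k - c) * D x))"
      unfolding cell_flux_def
      by (intro Bochner_Integration.integral_diff[symmetric] Bochner_Integration.integrable_add
          integrable_coordinate_mult i\<psi> iu iD k) simp_all
    also have "\<dots> = cell_flux s (\<lambda>x. \<psi> n x - u x) (\<lambda>x. ?P n x - D x) k c z"
      unfolding cell_flux_def by (intro Bochner_Integration.integral_cong refl) (simp add: algebra_simps)
    finally have "\<bar>cell_flux s (\<psi> n) (?P n) k c z - cell_flux s u D k c z\<bar>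
      \<le> \<bar>LINT x|?M. \<psi> n x - u x\<bar> + s * (LINT x|?M. \<bar>?P n x - D x\<bar>)"
      using cell_flux_estimate[OF i1 i2 k c] by linarith
    also have "\<dots> \<le> (LINT x|?M. \<bar>\<psi> n x - u x\<bar>) + s * (LINT x|?M. \<bar>?P n x - D x\<bar>)"
      using integral_abs_bound[of ?M "\<lambda>x. \<psi> n x - u x"] by simp
    also have "\<dots> \<le> (LINT x|lebesgue_on \<Omega>. \<bar>\<psi> n x - u x\<bar>) + s * (LINT x|lebesgue_on \<Omega>. \<bar>?P n x - D x\<bar>)"
      using side_pos i\<psi>[OF domain_lebesgue] u D z
      by (intro add_mono mult_left_mono integral_open_cell_le) auto
    finally show ?thesis by simp
  qed
  have "(\<lambda>n. (LINT x|lebesgue_on \<Omega>. \<bar>\<psi> n x - u x\<bar>) + s * (LINT x|lebesgue_on \<Omega>. \<bar>?P n x - D x\<bar>)) \<longlonglongrightarrow> 0 + s * 0"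
    by (intro tendsto_intros l1 l2)
  then have lim: "(\<lambda>n. (LINT x|lebesgue_on \<Omega>. \<bar>\<psi> n x - u x\<bar>) + s * (LINT x|lebesgue_on \<Omega>. \<bar>?P n x - D x\<bar>)) \<longlonglongrightarrow> 0"
    by (simp only: mult_zero_right add_0_right)
  have "(\<lambda>n. cell_flux s (\<psi> n) (?P n) k c z - cell_flux s u D k c z) \<longlonglongrightarrow> 0"
    by (rule Lim_null_comparison[OF always_eventually[OF allI[OF bound]] lim])
  then show ?thesis by (rule LIM_zero_cancel)
qed

lemma cell_flux_continuous:
  assumes u: "zero_trace_limit \<Omega> k u D" and k: "k \<in> Basis" and z: "z \<in> Z" "z + s *\<^sub>R k \<in> Z"
  shows "cell_flux s u D k 0 z = cell_flux s u D k s (z + s *\<^sub>R k)"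
proof -
  obtain \<psi> :: "nat \<Rightarrow> 'a \<Rightarrow> real" where \<psi>: "\<And>n. \<psi> n \<in> test_fun \<Omega>"
    and l: "(\<lambda>n. LINT x|lebesgue_on \<Omega>. \<bar>\<psi> n x - u x\<bar>) \<longlonglongrightarrow> 0"
      "(\<lambda>n. LINT x|lebesgue_on \<Omega>. \<bar>frechet_derivative (\<psi> n) (at x) k - D x\<bar>) \<longlonglongrightarrow> 0"
    and i: "integrable (lebesgue_on \<Omega>) u" "integrable (lebesgue_on \<Omega>) D"
    using u unfolding zero_trace_limit_def by blast
  have "(\<lambda>n. face_int s k (z + s *\<^sub>R k) (\<psi> n)) \<longlonglongrightarrow> cell_flux s u D k 0 z"
    using cell_flux_limit[OF i \<psi> l k z(1), of 0] cell_flux_C1(1)[OF test_funD[OF \<psi>] k side_pos] by simp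
  moreover have "(\<lambda>n. face_int s k (z + s *\<^sub>R k) (\<psi> n)) \<longlonglongrightarrow> cell_flux s u D k s (z + s *\<^sub>R k)"
    using cell_flux_limit[OF i \<psi> l k z(2), of s] cell_flux_C1(2)[OF test_funD[OF \<psi>] k side_pos] by simp
  ultimately show ?thesis by (rule LIMSEQ_unique)
qed

lemma cell_flux_boundary:
  assumes u: "zero_trace_limit \<Omega> k u D" and k: "k \<in> Basis" and z: "z \<in> Z"
  shows "z + s *\<^sub>R k \<notin> Z \<Longrightarrow> cell_flux s u D k 0 z = 0"
    and "z - s *\<^sub>R k \<notin> Z \<Longrightarrow> cell_flux s u D k s z = 0"
proof -
  obtain \<psi> :: "nat \<Rightarrow> 'a \<Rightarrow> real" where \<psi>: "\<And>n. \<psi> n \<in> test_fun \<Omega>"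
    and l: "(\<lambda>n. LINT x|lebesgue_on \<Omega>. \<bar>\<psi> n x - u x\<bar>) \<longlonglongrightarrow> 0"
      "(\<lambda>n. LINT x|lebesgue_on \<Omega>. \<bar>frechet_derivative (\<psi> n) (at x) k - D x\<bar>) \<longlonglongrightarrow> 0"
    and i: "integrable (lebesgue_on \<Omega>) u" "integrable (lebesgue_on \<Omega>) D"
    using u unfolding zero_trace_limit_def by blast
  { assume "z + s *\<^sub>R k \<notin> Z"
    then have "face_int s k (z + s *\<^sub>R k) (\<psi> n) = 0" for n
      using face_int_boundary[OF \<psi> z k, of 1] by simp
    then have "(\<lambda>n. 0) \<longlonglongrightarrow> cell_flux s u D k 0 z"
      using cell_flux_limit[OF i \<psi> l k z(1), of 0] cell_flux_C1(1)[OF test_funD[OF \<psi>] k side_pos] by simp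
    then show "cell_flux s u D k 0 z = 0" by (simp add: LIMSEQ_const_iff) }
  { assume "z - s *\<^sub>R k \<notin> Z"
    then have "face_int s k z (\<psi> n) = 0" for n
      using face_int_boundary[OF \<psi> z k, of "-1"] by simp
    then have "(\<lambda>n. 0) \<longlonglongrightarrow> cell_flux s u D k s z"
      using cell_flux_limit[OF i \<psi> l k z(1), of s] cell_flux_C1(2)[OF test_funD[OF \<psi>] k side_pos] by simp
    then show "cell_flux s u D k s z = 0" by (simp add: LIMSEQ_const_iff) }
qed

text \<open>Summation over faces: a face between two cells occurs once from each side with equal
  flux, and a face without a cell beyond it has flux 0. \<open>S\<close> is indexed by the lower
  corner of the cell above the face, so both sides read the same value.\<close>

lemma flux_cancellation:
  assumes u: "zero_trace_limit \<Omega> k u D" and k: "k \<in> Basis"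
  shows "(\<Sum>z\<in>Z. cell_flux s u D k 0 z * S (z + s *\<^sub>R k)) = (\<Sum>z\<in>Z. cell_flux s u D k s z * S z :: real)"
proof -
  let ?Y = "{z \<in> Z. z + s *\<^sub>R k \<in> Z}"
  have "(\<Sum>z\<in>Z. cell_flux s u D k 0 z * S (z + s *\<^sub>R k)) = (\<Sum>z\<in>?Y. cell_flux s u D k 0 z * S (z + s *\<^sub>R k))"
    by (rule sum.mono_neutral_right[OF finite_corners]) (auto simp: cell_flux_boundary(1)[OF u k])
  also have "\<dots> = (\<Sum>z\<in>?Y. cell_flux s u D k s (z + s *\<^sub>R k) * S (z + s *\<^sub>R k))"
    by (intro sum.cong refl) (simp add: cell_flux_continuous[OF u k])
  also have "\<dots> = (\<Sum>z\<in>(\<lambda>z. z + s *\<^sub>R k) ` ?Y. cell_flux s u D k s z * S z)"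
    by (rule sum.reindex_cong[symmetric, of "\<lambda>z. z + s *\<^sub>R k"]) (auto simp: inj_on_def)
  also have "\<dots> = (\<Sum>z\<in>Z. cell_flux s u D k s z * S z)"
  proof (rule sum.mono_neutral_left[OF finite_corners])
    show "\<forall>z\<in>Z - (\<lambda>z. z + s *\<^sub>R k) ` ?Y. cell_flux s u D k s z * S z = 0"
    proof
      fix z assume z: "z \<in> Z - (\<lambda>z. z + s *\<^sub>R k) ` ?Y"
      have "z - s *\<^sub>R k \<notin> Z"
      proof
        assume "z - s *\<^sub>R k \<in> Z"
        then have "z - s *\<^sub>R k \<in> ?Y" using z by simp
        then have "(z - s *\<^sub>R k) + s *\<^sub>R k \<in> (\<lambda>z. z + s *\<^sub>R k) ` ?Y" by (rule imageI)
        then show False using z by simp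
      qed
      then show "cell_flux s u D k s z * S z = 0" using cell_flux_boundary(2)[OF u k, of z] z by simp
    qed
  qed auto
  finally show ?thesis .
qed

end

lemma W11_0_zero_trace_limit:
  assumes "open \<Omega>" "u \<in> W11_0 \<Omega>"
  obtains D where "\<And>b. b \<in> Basis \<Longrightarrow> weak_partial \<Omega> b u (D b)" "\<And>b. b \<in> Basis \<Longrightarrow> zero_trace_limit \<Omega> b u (D b)"
proof -
  obtain D and \<psi> :: "nat \<Rightarrow> 'a \<Rightarrow> real" where u: "u \<in> L1 \<Omega>"
    and D: "\<forall>b\<in>Basis. D b \<in> L1 \<Omega> \<and> weak_partial \<Omega> b u (D b)"
    and \<psi>: "\<forall>n. \<psi> n \<in> C1_c \<Omega>" and l1: "(\<lambda>n. LINT x|lebesgue_on \<Omega>. \<bar>\<psi> n x - u x\<bar>) \<longlonglongrightarrow> 0"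
    and l2: "\<forall>b\<in>Basis. (\<lambda>n. LINT x|lebesgue_on \<Omega>. \<bar>frechet_derivative (\<psi> n) (at x) b - D b x\<bar>) \<longlonglongrightarrow> 0"
    using assms(2) unfolding W11_0_def by blast
  define \<eta> where "\<eta> n x = (if x \<in> \<Omega> then \<psi> n x else 0)" for n x
  have \<eta>: "\<eta> n \<in> test_fun \<Omega>" "x \<in> \<Omega> \<Longrightarrow> frechet_derivative (\<eta> n) (at x) v = frechet_derivative (\<psi> n) (at x) v" for n x v
    unfolding \<eta>_def[abs_def] using C1_c_extend[OF assms(1), of "\<psi> n"] \<psi> by auto
  show thesis
  proof (rule that)
    fix b :: 'a assume b: "b \<in> Basis"
    then show "weak_partial \<Omega> b u (D b)" using D by blast
    have "(LINT x|lebesgue_on \<Omega>. \<bar>\<eta> n x - u x\<bar>) = (LINT x|lebesgue_on \<Omega>. \<bar>\<psi> n x - u x\<bar>)" for n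
      by (intro Bochner_Integration.integral_cong refl) (simp add: \<eta>_def)
    moreover have "(LINT x|lebesgue_on \<Omega>. \<bar>frechet_derivative (\<eta> n) (at x) b - D b x\<bar>)
      = (LINT x|lebesgue_on \<Omega>. \<bar>frechet_derivative (\<psi> n) (at x) b - D b x\<bar>)" for n
      by (intro Bochner_Integration.integral_cong refl) (simp add: \<eta>(2))
    ultimately show "zero_trace_limit \<Omega> b u (D b)"
      unfolding zero_trace_limit_def using u D b \<eta>(1) l1 l2
      by (intro conjI exI[of _ \<eta>]) (auto simp: L1_def)
  qed
qed

section \<open>The Raviart-Thomas interpolant\<close>

text \<open>The points of disagreement in the open cell form an open null set, and closedness
  carries equality to the faces. This serves \<open>RT0_0\<close>, which imposes the boundary
  condition on every local representative that agrees almost everywhere.\<close>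

lemma continuous_AE_eq_cell:
  fixes f g :: "'a::euclidean_space \<Rightarrow> 'b::real_normed_vector"
  assumes s: "s > 0" and c: "continuous_on UNIV f" "continuous_on UNIV g"
    and eq: "AE x in lebesgue_on (cell s z). f x = g x" and x: "x \<in> cell s z"
  shows "f x = g x"
proof -
  let ?V = "open_cell s z \<inter> {x. f x - g x \<noteq> 0}"
  have cl: "closed {x. f x - g x = 0}"
    by (intro closed_Collect_eq continuous_intros c)
  then have "open {x. f x - g x \<noteq> 0}" by (simp add: closed_def Collect_neg_eq)
  then have "open ?V" by (intro open_Int) (auto simp: open_cell_def open_box)
  moreover have "negligible ?V"
  proof -
    obtain N where N: "N \<in> null_sets lebesgue" "{x. \<not> (x \<in> cell s z \<longrightarrow> f x = g x)} \<subseteq> N"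
      using eq AE_lebesgue_on_iff[OF cell_lebesgue[of s z], of "\<lambda>x. f x = g x"]
      by (auto simp: eventually_ae_filter)
    have "?V \<subseteq> N" using N(2) by (auto simp: mem_cell mem_open_cell less_imp_le)
    then show ?thesis using N(1) negligible_subset by (auto simp: negligible_iff_null_sets[symmetric])
  qed
  ultimately have "?V = {}" using open_not_negligible by blast
  then have "open_cell s z \<subseteq> {x. f x - g x = 0}" by blast
  then have "closure (open_cell s z) \<subseteq> {x. f x - g x = 0}" by (rule closure_minimal[OF _ cl])
  then have "x \<in> {x. f x - g x = 0}" using x closure_open_cell[OF s, of z] by blast
  then show ?thesis by simp
qed

lemma cell_mean_abs_le:
  fixes f :: "'a::euclidean_space \<Rightarrow> real"
  assumes s: "s > 0" and f: "integrable (lebesgue_on (open_cell s z)) f" and le: "AE x in lebesgue_on (open_cell s z). f x \<le> M"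
  shows "(LINT x|lebesgue_on (open_cell s z). f x) \<le> s ^ DIM('a) * M"
proof -
  interpret finite_measure "lebesgue_on (open_cell s z)"
    by (rule finite_measure_lebesgue_on) (rule open_cell_lmeasurable)
  have "(LINT x|lebesgue_on (open_cell s z). f x) \<le> (LINT x|lebesgue_on (open_cell s z). M)"
    using f le by (intro integral_mono_AE) auto
  also have "\<dots> = s ^ DIM('a) * M"
    using measure_open_cell[OF s, of z] by (simp add: measure_restrict_space)
  finally show ?thesis .
qed

context cube_mesh
begin

text \<open>The face values of the interpolant of \<open>l \<phi>\<close>; \<open>D k\<close> stands for the weak derivative of
  \<open>\<phi> \<bullet> k\<close> in direction \<open>k\<close>.\<close>

definition upper_coeff :: "real \<Rightarrow> ('a \<Rightarrow> 'a) \<Rightarrow> ('a \<Rightarrow> 'a \<Rightarrow> real) \<Rightarrow> 'a \<Rightarrow> 'a \<Rightarrow> real" where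
  "upper_coeff l \<phi> D z k = l * cell_flux s (\<lambda>x. \<phi> x \<bullet> k) (D k) k 0 z / s ^ DIM('a)"

definition lower_coeff :: "real \<Rightarrow> ('a \<Rightarrow> 'a) \<Rightarrow> ('a \<Rightarrow> 'a \<Rightarrow> real) \<Rightarrow> 'a \<Rightarrow> 'a \<Rightarrow> real" where
  "lower_coeff l \<phi> D z k = l * cell_flux s (\<lambda>x. \<phi> x \<bullet> k) (D k) k s z / s ^ DIM('a)"

text \<open>Component \<open>k\<close> is the linear interpolation between the values on the two
  faces orthogonal to \<open>k\<close>.\<close>

definition rt_local :: "real \<Rightarrow> ('a \<Rightarrow> 'a) \<Rightarrow> ('a \<Rightarrow> 'a \<Rightarrow> real) \<Rightarrow> 'a \<Rightarrow> 'a \<Rightarrow> 'a" where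
  "rt_local l \<phi> D z x = (\<Sum>k\<in>Basis. (lower_coeff l \<phi> D z k +
     ((x - z) \<bullet> k) * ((upper_coeff l \<phi> D z k - lower_coeff l \<phi> D z k) / s)) *\<^sub>R k)"

text \<open>On cell boundaries the value is \<open>0\<close>. These points are negligible, and this
  choice lets the norm bound hold everywhere.\<close>

definition rt_field :: "real \<Rightarrow> ('a \<Rightarrow> 'a) \<Rightarrow> ('a \<Rightarrow> 'a \<Rightarrow> real) \<Rightarrow> 'a \<Rightarrow> 'a" where
  "rt_field l \<phi> D x = (\<Sum>z\<in>Z. indicator (open_cell s z) x *\<^sub>R rt_local l \<phi> D z x)"

definition rt_div :: "real \<Rightarrow> ('a \<Rightarrow> 'a) \<Rightarrow> ('a \<Rightarrow> 'a \<Rightarrow> real) \<Rightarrow> 'a \<Rightarrow> real" where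
  "rt_div l \<phi> D x = (\<Sum>z\<in>Z. indicator (open_cell s z) x *
     (\<Sum>k\<in>Basis. (upper_coeff l \<phi> D z k - lower_coeff l \<phi> D z k) / s))"

lemma sum_indicator_cells:
  fixes f :: "'a \<Rightarrow> 'b::real_vector"
  assumes "z \<in> Z" "x \<in> open_cell s z"
  shows "(\<Sum>z\<in>Z. indicator (open_cell s z) x *\<^sub>R f z) = f z"
proof -
  have "indicator (open_cell s z') x *\<^sub>R f z' = (if z' = z then f z else 0)" if "z' \<in> Z" for z'
    using cells_disjoint[OF that assms(1)] assms by (auto simp: indicator_def)
  then show ?thesis using assms finite_corners by (simp add: sum.delta cong: sum.cong)
qed

lemma rt_field_cell: "z \<in> Z \<Longrightarrow> x \<in> open_cell s z \<Longrightarrow> rt_field l \<phi> D x = rt_local l \<phi> D z x"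
  unfolding rt_field_def by (rule sum_indicator_cells)

lemma rt_div_cell: "z \<in> Z \<Longrightarrow> x \<in> open_cell s z \<Longrightarrow>
    rt_div l \<phi> D x = (\<Sum>k\<in>Basis. (upper_coeff l \<phi> D z k - lower_coeff l \<phi> D z k) / s)"
  unfolding rt_div_def real_scaleR_def[symmetric] by (rule sum_indicator_cells)

lemma rt_field_outside: "(\<And>z. z \<in> Z \<Longrightarrow> x \<notin> open_cell s z) \<Longrightarrow> rt_field l \<phi> D x = 0"
  unfolding rt_field_def by (rule sum.neutral) simp

lemma rt_local_component: "k \<in> Basis \<Longrightarrow> rt_local l \<phi> D z x \<bullet> k = lower_coeff l \<phi> D z k +
     ((x - z) \<bullet> k) * ((upper_coeff l \<phi> D z k - lower_coeff l \<phi> D z k) / s)"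
  unfolding rt_local_def by simp

lemma rt_local_RT0_local: "rt_local l \<phi> D z \<in> RT0_local"
proof -
  let ?r = "\<lambda>k. (upper_coeff l \<phi> D z k - lower_coeff l \<phi> D z k) / s"
  let ?a = "\<Sum>k\<in>Basis. (lower_coeff l \<phi> D z k - (z \<bullet> k) * ?r k) *\<^sub>R k"
  let ?c = "\<Sum>k\<in>Basis. ?r k *\<^sub>R k"
  have "rt_local l \<phi> D z = (\<lambda>x. \<Sum>i\<in>Basis. (?a \<bullet> i + (?c \<bullet> i) * (x \<bullet> i)) *\<^sub>R i)"
  proof
    fix x
    have alg: "b + (p - q) * r = (b - q * r) + r * p" for b p q r :: real by (simp add: algebra_simps)
    show "rt_local l \<phi> D z x = (\<Sum>i\<in>Basis. (?a \<bullet> i + (?c \<bullet> i) * (x \<bullet> i)) *\<^sub>R i)"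
      unfolding rt_local_def inner_diff_left alg by (intro sum.cong refl) simp
  qed
  then show ?thesis unfolding RT0_local_def by blast
qed

lemma rt_local_continuous: "continuous_on S (rt_local l \<phi> D z)"
  unfolding rt_local_def[abs_def] by (intro continuous_intros)

lemma rt_field_measurable [measurable]: "rt_field l \<phi> D \<in> borel_measurable borel"
proof -
  have [measurable]: "rt_local l \<phi> D z \<in> borel_measurable borel" for z
    by (intro borel_measurable_continuous_onI rt_local_continuous)
  show ?thesis unfolding rt_field_def[abs_def] by measurable
qed

lemma rt_div_measurable [measurable]: "rt_div l \<phi> D \<in> borel_measurable borel"
  unfolding rt_div_def[abs_def] by measurable

lemma rt_div_bounded: "\<exists>B. \<forall>x. \<bar>rt_div l \<phi> D x\<bar> \<le> B"
proof (intro exI allI)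
  fix x
  let ?r = "\<lambda>z. \<Sum>k\<in>Basis. (upper_coeff l \<phi> D z k - lower_coeff l \<phi> D z k) / s"
  have "\<bar>rt_div l \<phi> D x\<bar> \<le> (\<Sum>z\<in>Z. \<bar>indicator (open_cell s z) x * ?r z\<bar>)"
    unfolding rt_div_def by (rule sum_abs)
  also have "\<dots> \<le> (\<Sum>z\<in>Z. \<bar>?r z\<bar>)" by (intro sum_mono) (auto simp: indicator_def)
  finally show "\<bar>rt_div l \<phi> D x\<bar> \<le> (\<Sum>z\<in>Z. \<bar>?r z\<bar>)" .
qed

lemma rt_field_norm_le:
  assumes \<phi>: "integrable (lebesgue_on \<Omega>) \<phi>" and D: "\<And>k. k \<in> Basis \<Longrightarrow> integrable (lebesgue_on \<Omega>) (D k)"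
    and \<phi>1: "AE x in lebesgue_on \<Omega>. norm (\<phi> x) \<le> 1"
    and DM: "\<And>k. k \<in> Basis \<Longrightarrow> AE x in lebesgue_on \<Omega>. \<bar>D k x\<bar> \<le> M" and M: "M \<ge> 0"
  shows "norm (rt_field l \<phi> D x) \<le> \<bar>l\<bar> * (1 + DIM('a) * s * M)"
proof (cases "\<exists>z\<in>Z. x \<in> open_cell s z")
  case False
  then have "rt_field l \<phi> D x = 0" by (intro rt_field_outside) auto
  then show ?thesis using M side_pos by simp
next
  case True
  then obtain z where z: "z \<in> Z" "x \<in> open_cell s z" by auto
  let ?N = "lebesgue_on (open_cell s z)"
  have sd: "s ^ DIM('a) > 0" using side_pos by simp
  define m where "m k = (LINT x|?N. \<phi> x \<bullet> k) / s ^ DIM('a)" for k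
  have i\<phi>: "integrable ?N \<phi>" by (rule integrable_open_cell[OF \<phi> z(1)])
  have iD: "integrable ?N (D k)" if "k \<in> Basis" for k by (rule integrable_open_cell[OF D[OF that] z(1)])
  have sub: "AE x in ?N. P x" if "AE x in lebesgue_on \<Omega>. P x" for P
    by (rule AE_lebesgue_on_subset[OF that]) (use open_cell_subset[OF z(1)] in auto)
  have coeff: "\<bar>cell_flux s (\<lambda>x. \<phi> x \<bullet> k) (D k) k c z / s ^ DIM('a) - m k\<bar> \<le> s * M"
    if k: "k \<in> Basis" and c: "c \<in> {0, s}" for k c
  proof -
    have "\<bar>cell_flux s (\<lambda>x. \<phi> x \<bullet> k) (D k) k c z - (LINT x|?N. \<phi> x \<bullet> k)\<bar> \<le> s * (LINT x|?N. \<bar>D k x\<bar>)"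
      by (rule cell_flux_estimate) (use i\<phi> iD k c in auto)
    also have "\<dots> \<le> s * (s ^ DIM('a) * M)"
      using side_pos iD[OF k] sub[OF DM[OF k]] by (intro mult_left_mono cell_mean_abs_le) auto
    finally have "\<bar>cell_flux s (\<lambda>x. \<phi> x \<bullet> k) (D k) k c z - (LINT x|?N. \<phi> x \<bullet> k)\<bar> / s ^ DIM('a) \<le> s * M"
      using sd by (simp add: divide_le_eq mult_ac)
    moreover have "cell_flux s (\<lambda>x. \<phi> x \<bullet> k) (D k) k c z / s ^ DIM('a) - m k
      = (cell_flux s (\<lambda>x. \<phi> x \<bullet> k) (D k) k c z - (LINT x|?N. \<phi> x \<bullet> k)) / s ^ DIM('a)"
      unfolding m_def by (simp add: diff_divide_distrib)
    ultimately show ?thesis using sd by (simp add: abs_divide)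
  qed
  have comp: "\<bar>rt_local l \<phi> D z x \<bullet> k - l * m k\<bar> \<le> \<bar>l\<bar> * (s * M)" if k: "k \<in> Basis" for k
  proof -
    \<comment> \<open>The relative position between the two faces: the component is a convex
      combination of the face values, so their common distance bound to the mean survives.\<close>
    define t where "t = ((x - z) \<bullet> k) / s"
    have t: "0 \<le> t" "t \<le> 1" using open_cell_coordinate[OF z(2) k] side_pos by (auto simp: t_def)
    let ?a = "cell_flux s (\<lambda>x. \<phi> x \<bullet> k) (D k) k 0 z / s ^ DIM('a)"
    let ?b = "cell_flux s (\<lambda>x. \<phi> x \<bullet> k) (D k) k s z / s ^ DIM('a)"
    have alg: "l * b + t * (l * a - l * b) - l * c = l * ((1 - t) * (b - c) + t * (a - c))" for a b c :: real
      by (simp add: algebra_simps)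
    have eq: "rt_local l \<phi> D z x \<bullet> k = l * ?b + t * (l * ?a - l * ?b)"
      unfolding rt_local_component[OF k] upper_coeff_def lower_coeff_def t_def by simp
    have E1: "rt_local l \<phi> D z x \<bullet> k - l * m k = l * ((1 - t) * (?b - m k) + t * (?a - m k))"
      unfolding eq by (rule alg)
    have "\<bar>(1 - t) * (?b - m k) + t * (?a - m k)\<bar> \<le> (1 - t) * (s * M) + t * (s * M)"
    proof -
      have "\<bar>(1 - t) * (?b - m k) + t * (?a - m k)\<bar> \<le> (1 - t) * \<bar>?b - m k\<bar> + t * \<bar>?a - m k\<bar>"
        using t abs_triangle_ineq[of "(1 - t) * (?b - m k)" "t * (?a - m k)"] by (simp add: abs_mult)
      also have "\<dots> \<le> (1 - t) * (s * M) + t * (s * M)"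
        using t coeff[OF k, of s] coeff[OF k, of 0] by (intro add_mono mult_left_mono) auto
      finally show ?thesis .
    qed
    moreover have "(1 - t) * (s * M) + t * (s * M) = s * M" by (simp add: left_diff_distrib)
    ultimately have E2: "\<bar>(1 - t) * (?b - m k) + t * (?a - m k)\<bar> \<le> s * M" by (simp only:)
    show ?thesis unfolding E1 abs_mult by (rule mult_left_mono[OF E2]) simp
  qed
  have mean: "norm (\<Sum>k\<in>Basis. m k *\<^sub>R k) \<le> 1"
  proof -
    have "(\<Sum>k\<in>Basis. m k *\<^sub>R k) = (1 / s ^ DIM('a)) *\<^sub>R (LINT x|?N. \<phi> x)"
      by (rule euclidean_eqI) (simp add: m_def integral_inner_left[OF i\<phi>])
    moreover have "norm (LINT x|?N. \<phi> x) \<le> s ^ DIM('a) * 1"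
    proof (rule order_trans[OF integral_norm_bound])
      show "(LINT x|?N. norm (\<phi> x)) \<le> s ^ DIM('a) * 1"
        by (rule cell_mean_abs_le) (use side_pos i\<phi> sub[OF \<phi>1] in auto)
    qed
    ultimately show ?thesis using sd by (simp add: divide_le_eq)
  qed
  \<comment> \<open>The mean is estimated as a vector, which gives the constant 1 exactly. Only the
    deviations are added component by component, and this is where the dimension enters.\<close>
  have "rt_local l \<phi> D z x = l *\<^sub>R (\<Sum>k\<in>Basis. m k *\<^sub>R k) + (\<Sum>k\<in>Basis. (rt_local l \<phi> D z x \<bullet> k - l * m k) *\<^sub>R k)"
    by (rule euclidean_eqI) (simp add: inner_add_left)
  then have "norm (rt_local l \<phi> D z x) = norm (l *\<^sub>R (\<Sum>k\<in>Basis. m k *\<^sub>R k) + (\<Sum>k\<in>Basis. (rt_local l \<phi> D z x \<bullet> k - l * m k) *\<^sub>R k))"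
    by (rule arg_cong)
  also have "\<dots> \<le> norm (l *\<^sub>R (\<Sum>k\<in>Basis. m k *\<^sub>R k)) + norm (\<Sum>k\<in>Basis. (rt_local l \<phi> D z x \<bullet> k - l * m k) *\<^sub>R k)"
    by (rule norm_triangle_ineq)
  also have "\<dots> = \<bar>l\<bar> * norm (\<Sum>k\<in>Basis. m k *\<^sub>R k) + norm (\<Sum>k\<in>Basis. (rt_local l \<phi> D z x \<bullet> k - l * m k) *\<^sub>R k)"
    by (simp only: norm_scaleR)
  also have "\<dots> \<le> \<bar>l\<bar> * 1 + (\<Sum>k\<in>(Basis::'a set). \<bar>l\<bar> * (s * M))"
  proof (intro add_mono mult_left_mono mean)
    show "norm (\<Sum>k\<in>Basis. (rt_local l \<phi> D z x \<bullet> k - l * m k) *\<^sub>R k) \<le> (\<Sum>k\<in>(Basis::'a set). \<bar>l\<bar> * (s * M))"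
      by (rule order_trans[OF norm_sum sum_mono]) (use comp in simp)
  qed simp
  also have "\<dots> = \<bar>l\<bar> * (1 + DIM('a) * s * M)" by (simp add: algebra_simps)
  finally show ?thesis by (simp only: rt_field_cell[OF z])
qed

lemma rt_div_eq_mean:
  assumes \<phi>: "integrable (lebesgue_on \<Omega>) \<phi>" and D: "\<And>k. k \<in> Basis \<Longrightarrow> integrable (lebesgue_on \<Omega>) (D k)"
    and z: "z \<in> Z" "x \<in> open_cell s z"
  shows "rt_div l \<phi> D x = l * (LINT x|lebesgue_on (open_cell s z). (\<Sum>k\<in>Basis. D k x)) / s ^ DIM('a)"
proof -
  have "(upper_coeff l \<phi> D z k - lower_coeff l \<phi> D z k) / s
     = l * (LINT x|lebesgue_on (open_cell s z). D k x) / s ^ DIM('a)" if k: "k \<in> Basis" for k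
  proof -
    have "upper_coeff l \<phi> D z k - lower_coeff l \<phi> D z k
      = l * (cell_flux s (\<lambda>x. \<phi> x \<bullet> k) (D k) k 0 z - cell_flux s (\<lambda>x. \<phi> x \<bullet> k) (D k) k s z) / s ^ DIM('a)"
      by (simp add: upper_coeff_def lower_coeff_def right_diff_distrib diff_divide_distrib)
    also have "cell_flux s (\<lambda>x. \<phi> x \<bullet> k) (D k) k 0 z - cell_flux s (\<lambda>x. \<phi> x \<bullet> k) (D k) k s z
      = s * (LINT x|lebesgue_on (open_cell s z). D k x)"
      by (rule cell_flux_diff) (use integrable_open_cell[OF \<phi> z(1)] integrable_open_cell[OF D z(1)] k in auto)
    finally show ?thesis using side_pos by simp
  qed
  then have "rt_div l \<phi> D x = (\<Sum>k\<in>Basis. l * (LINT x|lebesgue_on (open_cell s z). D k x) / s ^ DIM('a))"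
    unfolding rt_div_cell[OF z] by (rule sum.cong[OF refl])
  also have "\<dots> = l * (\<Sum>k\<in>Basis. LINT x|lebesgue_on (open_cell s z). D k x) / s ^ DIM('a)"
    by (simp add: sum_distrib_left sum_divide_distrib)
  also have "(\<Sum>k\<in>Basis. LINT x|lebesgue_on (open_cell s z). D k x) = (LINT x|lebesgue_on (open_cell s z). (\<Sum>k\<in>Basis. D k x))"
    by (intro Bochner_Integration.integral_sum[symmetric] integrable_open_cell D z)
  finally show ?thesis .
qed

section \<open>The weak divergence and the boundary values of the interpolant\<close>

lemma grad_component: "b \<in> Basis \<Longrightarrow> grad f x \<bullet> b = frechet_derivative f (at x) b"
  unfolding grad_def by simp

text \<open>Integration by parts on one cell. In each direction the integrand is regrouped into the
  lower coefficient times the derivative of \<eta>, and the slope times the flux integrand of \<eta>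
  for the upper face; both integrals are known face integrals.\<close>

lemma rt_field_divergence_cell:
  assumes \<eta>: "\<eta> \<in> test_fun \<Omega>" and z: "z \<in> Z"
  shows "(LINT x|lebesgue_on (open_cell s z). rt_field l \<phi> D x \<bullet> grad \<eta> x + rt_div l \<phi> D x * \<eta> x)
   = (\<Sum>k\<in>Basis. (upper_coeff l \<phi> D z k * face_int s k (z + s *\<^sub>R k) \<eta> - lower_coeff l \<phi> D z k * face_int s k z \<eta>) / s)"
proof -
  let ?N = "lebesgue_on (open_cell s z)"
  let ?a = "upper_coeff l \<phi> D z" and ?b = "lower_coeff l \<phi> D z"
  let ?P = "\<lambda>k x. frechet_derivative \<eta> (at x) k"
  have i\<eta>: "integrable ?N \<eta>" "integrable ?N (?P k)" for k
    using test_fun_integrable[OF \<eta> open_cell_lebesgue] by auto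
  have if0: "integrable ?N (\<lambda>x. \<eta> x + ((x - z) \<bullet> k - 0) * ?P k x)" if "k \<in> Basis" for k
    by (intro Bochner_Integration.integrable_add integrable_coordinate_mult i\<eta> that)
  have pt: "rt_field l \<phi> D x \<bullet> grad \<eta> x + rt_div l \<phi> D x * \<eta> x
    = (\<Sum>k\<in>Basis. ?b k * ?P k x + ((?a k - ?b k) / s) * (\<eta> x + ((x - z) \<bullet> k - 0) * ?P k x))"
    if x: "x \<in> open_cell s z" for x
  proof -
    have "rt_field l \<phi> D x \<bullet> grad \<eta> x = (\<Sum>k\<in>Basis. (?b k + ((x - z) \<bullet> k) * ((?a k - ?b k) / s)) * ?P k x)"
      unfolding rt_field_cell[OF z x] by (subst euclidean_inner) (intro sum.cong refl, simp add: rt_local_component grad_component)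
    then have "rt_field l \<phi> D x \<bullet> grad \<eta> x + rt_div l \<phi> D x * \<eta> x
      = (\<Sum>k\<in>Basis. (?b k + ((x - z) \<bullet> k) * ((?a k - ?b k) / s)) * ?P k x + ((?a k - ?b k) / s) * \<eta> x)"
      unfolding rt_div_cell[OF z x] by (simp add: sum.distrib sum_distrib_right)
    also have "\<dots> = (\<Sum>k\<in>Basis. ?b k * ?P k x + ((?a k - ?b k) / s) * (\<eta> x + ((x - z) \<bullet> k - 0) * ?P k x))"
    proof (rule sum.cong[OF refl])
      have alg: "(b + t * r) * P + r * e = b * P + r * (e + (t - 0) * P)" for b t r P e :: real
        by (simp add: algebra_simps)
      show "(?b k + ((x - z) \<bullet> k) * ((?a k - ?b k) / s)) * ?P k x + ((?a k - ?b k) / s) * \<eta> x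
        = ?b k * ?P k x + ((?a k - ?b k) / s) * (\<eta> x + ((x - z) \<bullet> k - 0) * ?P k x)" for k
        by (rule alg)
    qed
    finally show ?thesis .
  qed
  have "(LINT x|?N. rt_field l \<phi> D x \<bullet> grad \<eta> x + rt_div l \<phi> D x * \<eta> x)
     = (LINT x|?N. (\<Sum>k\<in>Basis. ?b k * ?P k x + ((?a k - ?b k) / s) * (\<eta> x + ((x - z) \<bullet> k - 0) * ?P k x)))"
    by (rule Bochner_Integration.integral_cong[OF refl]) (use pt in simp)
  also have "\<dots> = (\<Sum>k\<in>Basis. LINT x|?N. ?b k * ?P k x + ((?a k - ?b k) / s) * (\<eta> x + ((x - z) \<bullet> k - 0) * ?P k x))"
    using i\<eta> if0 by (intro Bochner_Integration.integral_sum) auto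
  also have "\<dots> = (\<Sum>k\<in>Basis. (?a k * face_int s k (z + s *\<^sub>R k) \<eta> - ?b k * face_int s k z \<eta>) / s)"
  proof (rule sum.cong[OF refl])
    fix k :: 'a assume k: "k \<in> Basis"
    note C = test_funD[OF \<eta>]
    have 1: "(LINT x|?N. \<eta> x + ((x - z) \<bullet> k - 0) * ?P k x) = face_int s k (z + s *\<^sub>R k) \<eta>"
      using cell_flux_C1(1)[OF C k side_pos, of z] unfolding cell_flux_def .
    have 2: "s * (LINT x|?N. ?P k x) = face_int s k (z + s *\<^sub>R k) \<eta> - face_int s k z \<eta>"
      using cell_flux_diff[OF i\<eta>(1) i\<eta>(2)[of k] k] cell_flux_C1[OF C k side_pos, of z] by simp
    have "(LINT x|?N. ?b k * ?P k x + ((?a k - ?b k) / s) * (\<eta> x + ((x - z) \<bullet> k - 0) * ?P k x))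
      = ?b k * (LINT x|?N. ?P k x) + ((?a k - ?b k) / s) * (LINT x|?N. \<eta> x + ((x - z) \<bullet> k - 0) * ?P k x)"
      using i\<eta> if0[OF k] by (subst Bochner_Integration.integral_add) auto
    also have "\<dots> = (?b k * (s * (LINT x|?N. ?P k x)) + (?a k - ?b k) * face_int s k (z + s *\<^sub>R k) \<eta>) / s"
      unfolding 1 using side_pos by (simp add: field_simps)
    also have "\<dots> = (?a k * face_int s k (z + s *\<^sub>R k) \<eta> - ?b k * face_int s k z \<eta>) / s"
      unfolding 2 by (simp add: algebra_simps)
    finally show "(LINT x|?N. ?b k * ?P k x + ((?a k - ?b k) / s) * (\<eta> x + ((x - z) \<bullet> k - 0) * ?P k x))
      = (?a k * face_int s k (z + s *\<^sub>R k) \<eta> - ?b k * face_int s k z \<eta>) / s" .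
  qed
  finally show ?thesis .
qed

lemma integrable_bounded_mult:
  fixes f :: "'a \<Rightarrow> 'b::{banach, second_countable_topology, real_inner}"
  assumes "f \<in> borel_measurable borel" "\<And>x. norm (f x) \<le> B" "integrable (lebesgue_on S) g"
  shows "integrable (lebesgue_on S) (\<lambda>x. f x \<bullet> g x)"
proof (rule Bochner_Integration.integrable_bound)
  show "integrable (lebesgue_on S) (\<lambda>x. B * norm (g x))" using assms(3) by simp
  show "(\<lambda>x. f x \<bullet> g x) \<in> borel_measurable (lebesgue_on S)"
    by (rule borel_measurable_inner[OF borel_measurable_lebesgue_on[OF assms(1)] borel_measurable_integrable[OF assms(3)]])
  have "B \<ge> 0" using assms(2)[of 0] norm_ge_zero order_trans by blast
  show "AE x in lebesgue_on S. norm (f x \<bullet> g x) \<le> norm (B * norm (g x))"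
  proof (rule AE_I2)
    fix x
    have "norm (f x \<bullet> g x) \<le> norm (f x) * norm (g x)" by (simp add: Cauchy_Schwarz_ineq2)
    also have "\<dots> \<le> B * norm (g x)" by (intro mult_right_mono assms) auto
    finally show "norm (f x \<bullet> g x) \<le> norm (B * norm (g x))" using \<open>B \<ge> 0\<close> by simp
  qed
qed

text \<open>Summing over the cells leaves, for each direction, the two sides of
  \<open>flux_cancellation\<close> with the face integrals of the test function in the role of
  \<open>S\<close>. Normal continuity of the field thus enters only in this summed form.\<close>

lemma rt_field_weak_div:
  assumes trace: "\<And>k. k \<in> Basis \<Longrightarrow> zero_trace_limit \<Omega> k (\<lambda>x. \<phi> x \<bullet> k) (D k)"
    and bound: "\<And>x. norm (rt_field l \<phi> D x) \<le> B"
  shows "weak_div \<Omega> (rt_field l \<phi> D) (rt_div l \<phi> D)"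
  unfolding weak_div_def locally_integrable_def
proof (intro conjI allI impI ballI)
  obtain B' where B': "\<And>x. \<bar>rt_div l \<phi> D x\<bar> \<le> B'" using rt_div_bounded by blast
  fix K assume "compact K \<and> K \<subseteq> \<Omega>"
  then have K: "K \<in> lmeasurable" by (auto intro: lmeasurable_compact)
  show "integrable (lebesgue_on K) (rt_field l \<phi> D)"
    by (rule integrable_lebesgue_on_bounded[OF K borel_measurable_lebesgue_on]) (use bound in auto)
  show "integrable (lebesgue_on K) (rt_div l \<phi> D)"
    by (rule integrable_lebesgue_on_bounded[OF K borel_measurable_lebesgue_on]) (use B' in auto)
next
  obtain B' where B': "\<And>x. \<bar>rt_div l \<phi> D x\<bar> \<le> B'" using rt_div_bounded by blast
  fix \<psi> :: "'a \<Rightarrow> real" assume \<psi>: "\<psi> \<in> C1_c \<Omega>"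
  define \<eta> where "\<eta> = (\<lambda>x. if x \<in> \<Omega> then \<psi> x else 0)"
  have \<eta>: "\<eta> \<in> test_fun \<Omega>" and \<eta>': "\<And>x v. x \<in> \<Omega> \<Longrightarrow> frechet_derivative \<eta> (at x) v = frechet_derivative \<psi> (at x) v"
    unfolding \<eta>_def using C1_c_extend[OF open_domain \<psi>] by auto
  have gr: "integrable (lebesgue_on \<Omega>) (grad \<eta>)"
    unfolding grad_def[abs_def] using test_fun_integrable(2)[OF \<eta> domain_lebesgue]
    by (intro Bochner_Integration.integrable_sum integrable_scaleR_left)
  have i1: "integrable (lebesgue_on \<Omega>) (\<lambda>x. rt_field l \<phi> D x \<bullet> grad \<eta> x)"
    by (rule integrable_bounded_mult[OF rt_field_measurable bound gr])
  have i2: "integrable (lebesgue_on \<Omega>) (\<lambda>x. rt_div l \<phi> D x * \<eta> x)"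
    using integrable_bounded_mult[OF rt_div_measurable, of l \<phi> D B', OF _ test_fun_integrable(1)[OF \<eta> domain_lebesgue]] B' by simp
  have "(LINT x|lebesgue_on \<Omega>. rt_field l \<phi> D x \<bullet> grad \<eta> x) + (LINT x|lebesgue_on \<Omega>. rt_div l \<phi> D x * \<eta> x)
    = (LINT x|lebesgue_on \<Omega>. rt_field l \<phi> D x \<bullet> grad \<eta> x + rt_div l \<phi> D x * \<eta> x)"
    by (rule Bochner_Integration.integral_add[OF i1 i2, symmetric])
  also have "\<dots> = (\<Sum>z\<in>Z. LINT x|lebesgue_on (open_cell s z). rt_field l \<phi> D x \<bullet> grad \<eta> x + rt_div l \<phi> D x * \<eta> x)"
    by (intro integral_domain_cells Bochner_Integration.integrable_add i1 i2)
  also have "\<dots> = (\<Sum>z\<in>Z. \<Sum>k\<in>Basis. (upper_coeff l \<phi> D z k * face_int s k (z + s *\<^sub>R k) \<eta> - lower_coeff l \<phi> D z k * face_int s k z \<eta>) / s)"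
    by (intro sum.cong refl rt_field_divergence_cell \<eta>)
  also have "\<dots> = (\<Sum>k\<in>Basis. \<Sum>z\<in>Z. (upper_coeff l \<phi> D z k * face_int s k (z + s *\<^sub>R k) \<eta> - lower_coeff l \<phi> D z k * face_int s k z \<eta>) / s)"
    by (rule sum.swap)
  also have "\<dots> = 0"
  proof (rule sum.neutral, rule ballI)
    fix k :: 'a assume k: "k \<in> Basis"
    have "(\<Sum>z\<in>Z. (upper_coeff l \<phi> D z k * face_int s k (z + s *\<^sub>R k) \<eta> - lower_coeff l \<phi> D z k * face_int s k z \<eta>) / s)
      = l / s ^ DIM('a) / s * ((\<Sum>z\<in>Z. cell_flux s (\<lambda>x. \<phi> x \<bullet> k) (D k) k 0 z * face_int s k (z + s *\<^sub>R k) \<eta>)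
        - (\<Sum>z\<in>Z. cell_flux s (\<lambda>x. \<phi> x \<bullet> k) (D k) k s z * face_int s k z \<eta>))"
      unfolding upper_coeff_def lower_coeff_def sum_subtractf[symmetric] sum_distrib_left
      by (intro sum.cong refl) (simp add: right_diff_distrib diff_divide_distrib)
    also have "\<dots> = 0" using flux_cancellation[OF trace[OF k] k, of "\<lambda>y. face_int s k y \<eta>"] by simp
    finally show "(\<Sum>z\<in>Z. (upper_coeff l \<phi> D z k * face_int s k (z + s *\<^sub>R k) \<eta> - lower_coeff l \<phi> D z k * face_int s k z \<eta>) / s) = 0" .
  qed
  finally have zero: "(LINT x|lebesgue_on \<Omega>. rt_field l \<phi> D x \<bullet> grad \<eta> x) = - (LINT x|lebesgue_on \<Omega>. rt_div l \<phi> D x * \<eta> x)"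
    by simp
  have "(LINT x|lebesgue_on \<Omega>. rt_field l \<phi> D x \<bullet> grad \<psi> x) = (LINT x|lebesgue_on \<Omega>. rt_field l \<phi> D x \<bullet> grad \<eta> x)"
    by (rule Bochner_Integration.integral_cong[OF refl]) (simp add: grad_def \<eta>')
  moreover have "(LINT x|lebesgue_on \<Omega>. rt_div l \<phi> D x * \<psi> x) = (LINT x|lebesgue_on \<Omega>. rt_div l \<phi> D x * \<eta> x)"
    by (rule Bochner_Integration.integral_cong[OF refl]) (simp add: \<eta>_def)
  ultimately show "(LINT x|lebesgue_on \<Omega>. rt_field l \<phi> D x \<bullet> grad \<psi> x) = - (LINT x|lebesgue_on \<Omega>. rt_div l \<phi> D x * \<psi> x)"
    using zero by simp
qed

lemma rt_field_RT0_0: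
  assumes trace: "\<And>k. k \<in> Basis \<Longrightarrow> zero_trace_limit \<Omega> k (\<lambda>x. \<phi> x \<bullet> k) (D k)"
    and bound: "\<And>x. norm (rt_field l \<phi> D x) \<le> B"
  shows "rt_field l \<phi> D \<in> RT0_0 \<Omega> (cell s ` Z)"
proof -
  obtain B' where B': "\<And>x. \<bar>rt_div l \<phi> D x\<bar> \<le> B'" using rt_div_bounded by blast
  have "rt_field l \<phi> D \<in> L2 \<Omega>"
    unfolding L2_def
  proof (intro CollectI conjI)
    show "rt_field l \<phi> D \<in> borel_measurable (lebesgue_on \<Omega>)"
      by (rule borel_measurable_lebesgue_on) simp
    show "integrable (lebesgue_on \<Omega>) (\<lambda>x. (norm (rt_field l \<phi> D x))\<^sup>2)"
    proof (rule integrable_lebesgue_on_bounded[OF domain_lmeasurable borel_measurable_lebesgue_on])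
      show "AE x in lebesgue_on \<Omega>. norm ((norm (rt_field l \<phi> D x))\<^sup>2) \<le> B\<^sup>2"
        using bound by (auto intro!: AE_I2 power_mono)
    qed measurable
  qed
  moreover have "rt_div l \<phi> D \<in> L2 \<Omega>"
    unfolding L2_def
  proof (intro CollectI conjI)
    show "rt_div l \<phi> D \<in> borel_measurable (lebesgue_on \<Omega>)"
      by (rule borel_measurable_lebesgue_on) simp
    show "integrable (lebesgue_on \<Omega>) (\<lambda>x. (norm (rt_div l \<phi> D x))\<^sup>2)"
    proof (rule integrable_lebesgue_on_bounded[OF domain_lmeasurable borel_measurable_lebesgue_on])
      have "norm ((norm (rt_div l \<phi> D x))\<^sup>2) \<le> B'\<^sup>2" for x
        using power_mono[OF B'[of x], of 2] by simp
      then show "AE x in lebesgue_on \<Omega>. norm ((norm (rt_div l \<phi> D x))\<^sup>2) \<le> B'\<^sup>2" by simp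
    qed measurable
  qed
  ultimately have Hd: "rt_field l \<phi> D \<in> Hdiv \<Omega>"
    unfolding Hdiv_def using rt_field_weak_div[OF trace bound] by blast
  have AEc: "AE x in lebesgue_on (cell s z). rt_field l \<phi> D x = rt_local l \<phi> D z x" if z: "z \<in> Z" for z
  proof -
    have "AE x in lebesgue. x \<notin> cell s z - open_cell s z"
      by (rule AE_not_in) (simp add: negligible_cell_minus_open_cell flip: negligible_iff_null_sets)
    then have "AE x in lebesgue. x \<in> cell s z \<longrightarrow> rt_field l \<phi> D x = rt_local l \<phi> D z x"
      by eventually_elim (auto simp: rt_field_cell[OF z])
    then show ?thesis by (simp add: AE_lebesgue_on_iff)
  qed
  have RT: "rt_field l \<phi> D \<in> RT0 \<Omega> (cell s ` Z)"
    unfolding RT0_def using Hd AEc rt_local_RT0_local by blast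
  show ?thesis
    unfolding RT0_0_def
  proof (intro CollectI conjI RT ballI impI allI)
    fix Q p x n
    assume Q: "Q \<in> cell s ` Z" and p: "p \<in> RT0_local" "AE x in lebesgue_on Q. rt_field l \<phi> D x = p x"
      and x: "x \<in> Q" and n: "outer_unit_normal \<Omega> x n"
    obtain z where z: "z \<in> Z" "Q = cell s z" using Q by auto
    have cp: "continuous_on UNIV p"
      using p(1) unfolding RT0_local_def by (auto intro!: continuous_intros)
    have "AE x in lebesgue_on (cell s z). p x = rt_local l \<phi> D z x"
      using p(2)[unfolded z(2)] AEc[OF z(1)] by eventually_elim simp
    from continuous_AE_eq_cell[OF side_pos cp rt_local_continuous this] have px: "p x = rt_local l \<phi> D z x"
      using x z by simp
    obtain k \<sigma> where k: "k \<in> Basis" "\<sigma> \<in> {1, -1}" "n = \<sigma> *\<^sub>R k" "x \<bullet> k = z \<bullet> k + (1 + \<sigma>) / 2 * s"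
      "z + (\<sigma> * s) *\<^sub>R k \<notin> Z"
      using outer_unit_normal_cell[OF n z(1)] x z(2) by metis
    \<comment> \<open>On the face selected by the normal only one of the two coefficients
      contributes, and it is a flux through a face with no cell beyond it.\<close>
    have "rt_local l \<phi> D z x \<bullet> k = 0"
    proof (cases "\<sigma> = 1")
      case True
      then have "(x - z) \<bullet> k = s" using k(4) by (simp add: inner_diff_left)
      moreover have "upper_coeff l \<phi> D z k = 0"
        using cell_flux_boundary(1)[OF trace[OF k(1)] k(1) z(1)] k(5) True by (simp add: upper_coeff_def)
      ultimately show ?thesis unfolding rt_local_component[OF k(1)] using side_pos by simp
    next
      case False
      then have sg: "\<sigma> = -1" using k(2) by simp
      then have "(x - z) \<bullet> k = 0" using k(4) by (simp add: inner_diff_left)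
      moreover have "lower_coeff l \<phi> D z k = 0"
        using cell_flux_boundary(2)[OF trace[OF k(1)] k(1) z(1)] k(5) sg by (simp add: lower_coeff_def)
      ultimately show ?thesis unfolding rt_local_component[OF k(1)] by simp
    qed
    then show "p x \<bullet> n = 0" unfolding px k(3) by simp
  qed
qed

end

section \<open>Uniqueness of weak derivatives and oscillation on meshes\<close>

lemma test_fun_mono: "f \<in> test_fun U \<Longrightarrow> U \<subseteq> V \<Longrightarrow> f \<in> test_fun V"
  unfolding test_fun_def by blast

lemma test_fun_bounded:
  fixes f :: "'a::euclidean_space \<Rightarrow> real"
  assumes f: "f \<in> test_fun U"
  obtains B where "\<And>x. \<bar>f x\<bar> \<le> B" "\<And>x. \<bar>frechet_derivative f (at x) k\<bar> \<le> B"
proof -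
  obtain K where K: "compact K" "\<And>x. x \<notin> K \<Longrightarrow> f x = 0" using f unfolding test_fun_def by blast
  have C: "C1_fun f" using f by (rule test_funD)
  obtain B1 where B1: "\<And>x. norm (f x) \<le> B1"
    using compact_support_bounded[OF C1_fun_continuous[OF C] K] by blast
  obtain B2 where B2: "\<And>x. norm (frechet_derivative f (at x) k) \<le> B2"
    using compact_support_bounded[OF C1_fun_cont_deriv[OF C] K(1) test_fun_deriv_support[OF C compact_imp_closed[OF K(1)] K(2)]] by blast
  show thesis
  proof (rule that[of "max B1 B2"])
    show "\<bar>f x\<bar> \<le> max B1 B2" for x using B1[of x] by simp
    show "\<bar>frechet_derivative f (at x) k\<bar> \<le> max B1 B2" for x using B2[of x] by simp
  qed
qed

lemma integrable_mult_test_fun: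
  fixes u :: "'a::euclidean_space \<Rightarrow> real"
  assumes u: "integrable (lebesgue_on S) u" and f: "f \<in> test_fun U"
  shows "integrable (lebesgue_on S) (\<lambda>x. u x * f x)"
    and "integrable (lebesgue_on S) (\<lambda>x. u x * frechet_derivative f (at x) k)"
proof -
  obtain B where B: "\<And>x. \<bar>f x\<bar> \<le> B" "\<And>x. \<bar>frechet_derivative f (at x) k\<bar> \<le> B"
    using test_fun_bounded[OF f] by blast
  have *: "integrable (lebesgue_on S) (\<lambda>x. u x * g x)" if g: "continuous_on UNIV g" "\<And>x. \<bar>g x\<bar> \<le> B" for g
  proof (rule Bochner_Integration.integrable_bound)
    show "integrable (lebesgue_on S) (\<lambda>x. B * u x)" using u by simp
    show "(\<lambda>x. u x * g x) \<in> borel_measurable (lebesgue_on S)"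
      using g(1) by (intro borel_measurable_times borel_measurable_integrable[OF u] borel_measurable_lebesgue_on borel_measurable_continuous_onI)
    have "B \<ge> 0" using g(2)[of 0] by linarith
    then show "AE x in lebesgue_on S. norm (u x * g x) \<le> norm (B * u x)"
      using g(2) by (intro AE_I2) (simp add: abs_mult mult.commute[of B] mult_left_mono)
  qed
  show "integrable (lebesgue_on S) (\<lambda>x. u x * f x)"
    by (rule *[OF C1_fun_continuous[OF test_funD[OF f]] B(1)])
  show "integrable (lebesgue_on S) (\<lambda>x. u x * frechet_derivative f (at x) k)"
    by (rule *[OF C1_fun_cont_deriv[OF test_funD[OF f]] B(2)])
qed

lemma L2_imp_L1:
  fixes f :: "'a::euclidean_space \<Rightarrow> real"
  assumes "S \<in> lmeasurable" "f \<in> L2 S" shows "integrable (lebesgue_on S) f"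
proof (rule Bochner_Integration.integrable_bound)
  interpret finite_measure "lebesgue_on S" using assms(1) by (rule finite_measure_lebesgue_on)
  show "integrable (lebesgue_on S) (\<lambda>x. 1 + (norm (f x))\<^sup>2)" using assms(2) by (simp add: L2_def)
  show "f \<in> borel_measurable (lebesgue_on S)" using assms(2) by (simp add: L2_def)
  have "\<bar>a\<bar> \<le> 1 + a\<^sup>2" for a :: real
    using zero_le_power2[of "\<bar>a\<bar> - 1 / 2"] by (simp add: power2_eq_square algebra_simps)
  then show "AE x in lebesgue_on S. norm (f x) \<le> norm (1 + (norm (f x))\<^sup>2)" by simp
qed

text \<open>The difference is the integral of \<open>(w x - c) * (\<mu> - d x)\<close>: as
  \<open>\<mu> - d x\<close> has mean zero, any constant \<open>c\<close> may be subtracted from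
  \<open>w\<close>. The factor \<open>2 * M\<close> bounds
  \<open>\<bar>\<mu> - d x\<bar>\<close>.\<close>

lemma mean_oscillation:
  fixes w d :: "'a::euclidean_space \<Rightarrow> real"
  assumes s: "s > 0" and w: "integrable (lebesgue_on (open_cell s z)) w" and d: "integrable (lebesgue_on (open_cell s z)) d"
    and M: "AE x in lebesgue_on (open_cell s z). \<bar>d x\<bar> \<le> M"
  defines "\<mu> \<equiv> (LINT x|lebesgue_on (open_cell s z). d x) / s ^ DIM('a)"
  shows "\<bar>\<mu> * (LINT x|lebesgue_on (open_cell s z). w x) - (LINT x|lebesgue_on (open_cell s z). d x * w x)\<bar>
     \<le> 2 * M * (LINT x|lebesgue_on (open_cell s z). \<bar>w x - c\<bar>)" and "\<bar>\<mu>\<bar> \<le> M"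
proof -
  let ?N = "lebesgue_on (open_cell s z)"
  interpret finite_measure ?N
    by (rule finite_measure_lebesgue_on) (rule open_cell_lmeasurable)
  have sd: "s ^ DIM('a) > 0" using s by simp
  have mN: "measure ?N (open_cell s z) = s ^ DIM('a)"
    using measure_open_cell[OF s, of z] by (simp add: measure_restrict_space)
  have "\<bar>LINT x|?N. d x\<bar> \<le> (LINT x|?N. \<bar>d x\<bar>)" by (rule integral_abs_bound)
  also have "\<dots> \<le> s ^ DIM('a) * M" by (rule cell_mean_abs_le[OF s]) (use d M in auto)
  finally show mu: "\<bar>\<mu>\<bar> \<le> M" using sd by (simp add: \<mu>_def divide_le_eq mult.commute)
  have dw: "integrable ?N (\<lambda>x. d x * w x)"
  proof (rule Bochner_Integration.integrable_bound)
    show "integrable ?N (\<lambda>x. M * w x)" using w by simp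
    show "(\<lambda>x. d x * w x) \<in> borel_measurable ?N" using w d by auto
    show "AE x in ?N. norm (d x * w x) \<le> norm (M * w x)"
      using M by eventually_elim (auto simp: abs_mult intro!: mult_right_mono)
  qed
  have "(LINT x|?N. (w x - c) * (\<mu> - d x)) = (LINT x|?N. \<mu> * w x - d x * w x - (c * \<mu> - c * d x))"
    by (intro Bochner_Integration.integral_cong refl) (simp add: algebra_simps)
  also have "\<dots> = \<mu> * (LINT x|?N. w x) - (LINT x|?N. d x * w x) - (c * \<mu> * s ^ DIM('a) - c * (LINT x|?N. d x))"
    using w d dw by (simp add: mN)
  also have "\<dots> = \<mu> * (LINT x|?N. w x) - (LINT x|?N. d x * w x)"
    using s by (simp add: \<mu>_def)
  finally have eq: "\<mu> * (LINT x|?N. w x) - (LINT x|?N. d x * w x) = (LINT x|?N. (w x - c) * (\<mu> - d x))" by simp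
  have iP: "integrable ?N (\<lambda>x. (w x - c) * (\<mu> - d x))"
  proof -
    have "integrable ?N (\<lambda>x. \<mu> * w x - d x * w x - (c * \<mu> - c * d x))" using w d dw by simp
    moreover have "(\<lambda>x. \<mu> * w x - d x * w x - (c * \<mu> - c * d x)) = (\<lambda>x. (w x - c) * (\<mu> - d x))"
      by (rule ext) (simp add: algebra_simps)
    ultimately show ?thesis by simp
  qed
  have "\<bar>LINT x|?N. (w x - c) * (\<mu> - d x)\<bar> \<le> (LINT x|?N. \<bar>(w x - c) * (\<mu> - d x)\<bar>)" by (rule integral_abs_bound)
  also have "\<dots> \<le> (LINT x|?N. 2 * M * \<bar>w x - c\<bar>)"
  proof (rule integral_mono_AE)
    show "AE x in ?N. \<bar>(w x - c) * (\<mu> - d x)\<bar> \<le> 2 * M * \<bar>w x - c\<bar>"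
      using M
    proof eventually_elim
      case (elim x)
      then have "\<bar>\<mu> - d x\<bar> \<le> 2 * M" using mu by linarith
      then have "\<bar>w x - c\<bar> * \<bar>\<mu> - d x\<bar> \<le> \<bar>w x - c\<bar> * (2 * M)" by (intro mult_left_mono) auto
      then show ?case by (simp add: abs_mult mult.commute)
    qed
  qed (use iP w in auto)
  finally show "\<bar>\<mu> * (LINT x|?N. w x) - (LINT x|?N. d x * w x)\<bar> \<le> 2 * M * (LINT x|?N. \<bar>w x - c\<bar>)"
    unfolding eq by simp
qed

lemma TV_test_bound:
  assumes "TV \<Omega> w = ereal T" "\<psi> \<in> test_fun \<Omega>" "\<And>x. norm (\<psi> x) \<le> 1"
  shows "(LINT x|lebesgue_on \<Omega>. w x * divergence \<psi> x) \<le> T"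
proof -
  have "ereal (LINT x|lebesgue_on \<Omega>. w x * divergence \<psi> x) \<le> TV \<Omega> w"
    unfolding TV_def using assms(2,3) test_fun_imp_C1_c by (intro Sup_upper) blast
  then show ?thesis using assms(1) by simp
qed

lemma TV_nonneg:
  assumes "TV \<Omega> w = ereal T" shows "T \<ge> 0"
proof -
  have z: "(\<lambda>x. 0) \<in> test_fun \<Omega>" unfolding test_fun_def by (auto intro!: exI[of _ "{}"])
  have "frechet_derivative (\<lambda>x::'a. 0 :: 'a) (at x) = (\<lambda>v. 0)" for x
    using frechet_derivative_at[of "\<lambda>x. 0" "\<lambda>v. 0" x] by simp
  then have "divergence (\<lambda>x::'a. 0) x = 0" for x by (simp add: divergence_def)
  then show ?thesis using TV_test_bound[OF assms z] by simp
qed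

lemma test_fun_divergence_measurable:
  assumes "\<psi> \<in> test_fun \<Omega>" shows "divergence \<psi> \<in> borel_measurable borel"
  unfolding divergence_def[abs_def]
  by (intro borel_measurable_continuous_onI continuous_intros C1_fun_cont_deriv test_funD[OF assms])

section \<open>Separation by test functions, and oscillation over the mesh\<close>

context cube_mesh
begin

lemma AE_domain_from_cells:
  assumes "\<And>z. z \<in> Z \<Longrightarrow> AE x in lebesgue_on (open_cell s z). P x"
  shows "AE x in lebesgue_on \<Omega>. P x"
proof -
  have "AE x in lebesgue. \<forall>z\<in>Z. x \<in> open_cell s z \<longrightarrow> P x"
    using assms by (intro AE_finite_allI finite_corners) (simp add: AE_lebesgue_on_iff)
  with AE_domain_cells have "AE x in lebesgue. x \<in> \<Omega> \<longrightarrow> P x"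
  proof eventually_elim
    case (elim x)
    show ?case
    proof
      assume "x \<in> \<Omega>"
      then have "(\<Sum>z\<in>Z. indicator (open_cell s z) x :: real) \<noteq> 0" using elim(1) by simp
      then obtain z where "z \<in> Z" "(indicator (open_cell s z) x :: real) \<noteq> 0" by (rule sum.not_neutral_contains_not_neutral)
      then show "P x" using elim(2) by (auto simp: indicator_def split: if_splits)
    qed
  qed
  then show ?thesis by (simp add: AE_lebesgue_on_iff)
qed

text \<open>The duality bound is applied with \<open>0\<close> on each open cell, which is a box;
  the finitely many cells exhaust \<Omega> up to a null set.\<close>

lemma test_functions_separate:
  assumes F: "integrable (lebesgue_on \<Omega>) F"
    and zero: "\<And>g. g \<in> test_fun \<Omega> \<Longrightarrow> (LINT x|lebesgue_on \<Omega>. F x * g x) = 0"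
  shows "AE x in lebesgue_on \<Omega>. F x = (0 :: real)"
proof (rule AE_domain_from_cells)
  fix z assume z: "z \<in> Z"
  let ?F = "\<lambda>x. indicator \<Omega> x * F x"
  have iF: "integrable lebesgue ?F" using F by (simp add: integrable_lebesgue_on)
  have U: "open_cell s z = (\<Union>i\<in>{z}. box i (i + s *\<^sub>R One))" by (simp add: open_cell_def)
  have "(LINT x|lebesgue. indicator (open_cell s z) x * \<bar>?F x\<bar>) \<le> 0"
  proof (rule L1_norm_by_test_functions[OF iF _ U])
    fix g :: "'a \<Rightarrow> real" assume "g \<in> test_fun (open_cell s z)"
    then have "g \<in> test_fun \<Omega>" using test_fun_mono open_cell_subset[OF z] by blast
    from zero[OF this] show "(LINT x|lebesgue. ?F x * g x) \<le> 0"
      by (simp add: integral_lebesgue_on mult.assoc)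
  qed simp
  moreover have "(LINT x|lebesgue. indicator (open_cell s z) x * \<bar>?F x\<bar>) = (LINT x|lebesgue_on (open_cell s z). \<bar>F x\<bar>)"
    unfolding integral_lebesgue_on[OF open_cell_lebesgue]
    using open_cell_subset[OF z] by (intro Bochner_Integration.integral_cong refl) (auto simp: indicator_def)
  moreover have "(LINT x|lebesgue_on (open_cell s z). \<bar>F x\<bar>) \<ge> 0" by (rule integral_nonneg_AE) simp
  ultimately have "(LINT x|lebesgue_on (open_cell s z). \<bar>F x\<bar>) = 0" by linarith
  then show "AE x in lebesgue_on (open_cell s z). F x = 0"
    using integrable_open_cell[OF F z] by (subst (asm) integral_nonneg_eq_0_iff_AE) auto
qed

lemma weak_partial_unique:
  assumes "weak_partial \<Omega> b u v" "weak_partial \<Omega> b u v'"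
    and v: "integrable (lebesgue_on \<Omega>) v" "integrable (lebesgue_on \<Omega>) v'"
  shows "AE x in lebesgue_on \<Omega>. v x = v' x"
proof -
  have "AE x in lebesgue_on \<Omega>. v x - v' x = 0"
  proof (rule test_functions_separate)
    fix g :: "'a \<Rightarrow> real" assume g: "g \<in> test_fun \<Omega>"
    have "(LINT x|lebesgue_on \<Omega>. v x * g x) = (LINT x|lebesgue_on \<Omega>. v' x * g x)"
      using assms(1,2) test_fun_imp_C1_c[OF g] unfolding weak_partial_def by fastforce
    then show "(LINT x|lebesgue_on \<Omega>. (v x - v' x) * g x) = 0"
      using integrable_mult_test_fun(1)[OF v(1) g] integrable_mult_test_fun(1)[OF v(2) g]
      by (simp add: left_diff_distrib)
  qed (use v in simp)
  then show ?thesis by eventually_elim simp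
qed

text \<open>Both sides act equally on test functions. Through this identity the given version of the
  divergence inherits the bounds of the partial derivatives, and its cell means become the
  divergence of the interpolant.\<close>

lemma weak_div_eq_sum_partials:
  assumes \<phi>: "integrable (lebesgue_on \<Omega>) \<phi>" and g: "weak_div \<Omega> \<phi> g" "integrable (lebesgue_on \<Omega>) g"
    and D: "\<And>k. k \<in> Basis \<Longrightarrow> weak_partial \<Omega> k (\<lambda>x. \<phi> x \<bullet> k) (D k)"
      "\<And>k. k \<in> Basis \<Longrightarrow> integrable (lebesgue_on \<Omega>) (D k)"
  shows "AE x in lebesgue_on \<Omega>. g x = (\<Sum>k\<in>Basis. D k x)"
proof -
  have "AE x in lebesgue_on \<Omega>. g x - (\<Sum>k\<in>Basis. D k x) = 0"
  proof (rule test_functions_separate)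
    fix f :: "'a \<Rightarrow> real" assume f: "f \<in> test_fun \<Omega>"
    note fc = test_fun_imp_C1_c[OF f]
    have "(LINT x|lebesgue_on \<Omega>. g x * f x) = - (LINT x|lebesgue_on \<Omega>. \<phi> x \<bullet> grad f x)"
      using g(1) fc unfolding weak_div_def by simp
    also have "(LINT x|lebesgue_on \<Omega>. \<phi> x \<bullet> grad f x) = (LINT x|lebesgue_on \<Omega>. (\<Sum>k\<in>Basis. (\<phi> x \<bullet> k) * frechet_derivative f (at x) k))"
    proof (rule Bochner_Integration.integral_cong[OF refl])
      show "\<phi> x \<bullet> grad f x = (\<Sum>k\<in>Basis. (\<phi> x \<bullet> k) * frechet_derivative f (at x) k)" for x
        by (subst euclidean_inner) (intro sum.cong refl, simp add: grad_component)
    qed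
    also have "\<dots> = (\<Sum>k\<in>Basis. LINT x|lebesgue_on \<Omega>. (\<phi> x \<bullet> k) * frechet_derivative f (at x) k)"
      by (intro Bochner_Integration.integral_sum integrable_mult_test_fun(2)[OF _ f]) (use \<phi> in simp)
    also have "\<dots> = (\<Sum>k\<in>Basis. - (LINT x|lebesgue_on \<Omega>. D k x * f x))"
      using D(1) fc by (intro sum.cong refl) (simp add: weak_partial_def)
    finally have 1: "(LINT x|lebesgue_on \<Omega>. g x * f x) = (\<Sum>k\<in>Basis. LINT x|lebesgue_on \<Omega>. D k x * f x)"
      by (simp add: sum_negf)
    have "(LINT x|lebesgue_on \<Omega>. (g x - (\<Sum>k\<in>Basis. D k x)) * f x) = (LINT x|lebesgue_on \<Omega>. g x * f x - (\<Sum>k\<in>Basis. D k x * f x))"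
      by (simp add: left_diff_distrib sum_distrib_right)
    also have "\<dots> = (LINT x|lebesgue_on \<Omega>. g x * f x) - (LINT x|lebesgue_on \<Omega>. (\<Sum>k\<in>Basis. D k x * f x))"
      by (intro Bochner_Integration.integral_diff Bochner_Integration.integrable_sum integrable_mult_test_fun(1)[OF _ f] g D)
    also have "(LINT x|lebesgue_on \<Omega>. (\<Sum>k\<in>Basis. D k x * f x)) = (\<Sum>k\<in>Basis. LINT x|lebesgue_on \<Omega>. D k x * f x)"
      by (intro Bochner_Integration.integral_sum integrable_mult_test_fun(1)[OF _ f] D)
    finally show "(LINT x|lebesgue_on \<Omega>. (g x - (\<Sum>k\<in>Basis. D k x)) * f x) = 0" using 1 by simp
  qed (use g D in simp)
  then show ?thesis by eventually_elim simp
qed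

text \<open>Translations and Fubini are carried out for Borel functions on the whole space, whereas
  \<open>w\<close> is only Lebesgue measurable and arbitrary outside \<Omega>. It is therefore
  replaced by a Borel function \<open>w'\<close> that agrees almost everywhere with \<open>w\<close>
  extended by zero.\<close>

lemma Poincare_mesh:
  assumes w: "integrable (lebesgue_on \<Omega>) w" and T: "TV \<Omega> w = ereal T"
  shows "(\<Sum>z\<in>Z. LINT x|lebesgue_on (open_cell s z). \<bar>w x - (LINT x|lebesgue_on (open_cell s z). w x) / s ^ DIM('a)\<bar>)
    \<le> 2 ^ DIM('a) * DIM('a) * s * T"
proof -
  have iw: "integrable lebesgue (\<lambda>x. indicator \<Omega> x * w x)" using w by (simp add: integrable_lebesgue_on)
  obtain w' where "w' \<in> borel_measurable lborel" and eq0: "AE x in lborel. indicator \<Omega> x * w x = w' x"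
    using completion_ex_borel_measurable_real[OF borel_measurable_integrable[OF iw]] by auto
  then have w'[measurable]: "w' \<in> borel_measurable borel" by simp
  have eq: "AE x in lebesgue. indicator \<Omega> x * w x = w' x" using eq0 by (rule AE_completion)
  have "integrable lebesgue w'"
    using iw eq by (subst integrable_cong_AE[symmetric, of "\<lambda>x. indicator \<Omega> x * w x"]) (auto intro: measurable_completion borel_measurable_integrable)
  then have iw': "integrable lborel w'" by (simp add: integrable_completion)
  have bridge: "(LINT x|lborel. indicator (open_cell s z) x * F (w' x)) = (LINT x|lebesgue_on (open_cell s z). F (w x))"
    if z: "z \<in> Z" and [measurable]: "F \<in> borel_measurable borel" for z and F :: "real \<Rightarrow> real"
  proof -
    have [measurable]: "w \<in> borel_measurable (lebesgue_on (open_cell s z))"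
      using integrable_open_cell[OF w z] by auto
    have "(LINT x|lborel. indicator (open_cell s z) x * F (w' x)) = (LINT x|lebesgue_on (open_cell s z). F (w' x))"
      by (simp add: integral_lebesgue_on integral_completion)
    also have "\<dots> = (LINT x|lebesgue_on (open_cell s z). F (w x))"
    proof (rule integral_cong_AE)
      have "AE x in lebesgue. x \<in> open_cell s z \<longrightarrow> F (w' x) = F (w x)"
        using eq by eventually_elim (use open_cell_subset[OF z] in auto)
      then show "AE x in lebesgue_on (open_cell s z). F (w' x) = F (w x)" by (simp add: AE_lebesgue_on_iff)
      show "(\<lambda>x. F (w' x)) \<in> borel_measurable (lebesgue_on (open_cell s z))"
        by (rule borel_measurable_lebesgue_on) measurable
    qed measurable
    finally show ?thesis .
  qed
  have T': "(LINT x|lborel. w' x * divergence \<psi> x) \<le> T" if \<psi>: "\<psi> \<in> test_fun \<Omega>" "\<And>x. norm (\<psi> x) \<le> 1" for \<psi>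
  proof -
    have dm[measurable]: "divergence \<psi> \<in> borel_measurable borel" by (rule test_fun_divergence_measurable[OF \<psi>(1)])
    have "(LINT x|lborel. w' x * divergence \<psi> x) = (LINT x|lebesgue. w' x * divergence \<psi> x)"
      by (simp add: integral_completion)
    also have "\<dots> = (LINT x|lebesgue. indicator \<Omega> x * (w x * divergence \<psi> x))"
    proof (rule integral_cong_AE)
      show "AE x in lebesgue. w' x * divergence \<psi> x = indicator \<Omega> x * (w x * divergence \<psi> x)"
        using eq by eventually_elim (metis mult.assoc)
      show "(\<lambda>x. w' x * divergence \<psi> x) \<in> borel_measurable lebesgue"
        by (intro measurable_completion) simp
      have "(\<lambda>x. (indicator \<Omega> x * w x) * divergence \<psi> x) \<in> borel_measurable lebesgue"
        by (intro borel_measurable_times borel_measurable_integrable[OF iw] measurable_completion) simp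
      then show "(\<lambda>x. indicator \<Omega> x * (w x * divergence \<psi> x)) \<in> borel_measurable lebesgue"
        by (simp add: mult.assoc)
    qed
    also have "\<dots> = (LINT x|lebesgue_on \<Omega>. w x * divergence \<psi> x)" by (simp add: integral_lebesgue_on)
    also have "\<dots> \<le> T" by (rule TV_test_bound[OF T \<psi>])
    finally show ?thesis .
  qed
  have "(\<Sum>z\<in>Z. LINT x|lborel. indicator (open_cell s z) x * \<bar>w' x - (LINT x|lborel. indicator (open_cell s z) x * w' x) / s ^ DIM('a)\<bar>)
    \<le> 2 ^ DIM('a) * DIM('a) * s * T"
    by (rule Poincare_cells[OF iw' finite_corners open_cell_subset side_pos cells_disjoint T' TV_nonneg[OF T]])
  moreover have "(LINT x|lborel. indicator (open_cell s z) x * \<bar>w' x - (LINT x|lborel. indicator (open_cell s z) x * w' x) / s ^ DIM('a)\<bar>)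
    = (LINT x|lebesgue_on (open_cell s z). \<bar>w x - (LINT x|lebesgue_on (open_cell s z). w x) / s ^ DIM('a)\<bar>)" if z: "z \<in> Z" for z
    using bridge[OF z, of "\<lambda>y. y"] bridge[OF z, of "\<lambda>y. \<bar>y - (LINT x|lebesgue_on (open_cell s z). w x) / s ^ DIM('a)\<bar>"]
    by simp
  ultimately show ?thesis by (simp cong: sum.cong)
qed

end

section \<open>Rounding and the lower bound\<close>

text \<open>The attained value \<open>v\<close> guarantees that the finite set of minimisers is
  nonempty, so its \<open>Min\<close> is a genuine minimiser.\<close>

lemma cell_round_optimal:
  assumes "finite W" "v \<in> attained_values W w Q"
  shows "\<bar>cell_mean w Q - real_of_int (cell_round W w Q)\<bar> \<le> \<bar>cell_mean w Q - real_of_int v\<bar>"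
proof -
  let ?f = "\<lambda>\<omega>. \<bar>cell_mean w Q - real_of_int \<omega>\<bar>"
  let ?A = "attained_values W w Q"
  let ?S = "{\<omega>. is_arg_min ?f (\<lambda>\<omega>. \<omega> \<in> ?A) \<omega>}"
  have fin: "finite ?A" using assms(1) by (simp add: attained_values_def)
  have "?S \<subseteq> ?A" by (auto simp: is_arg_min_def)
  then have "finite ?S" using fin finite_subset by blast
  moreover have "?S \<noteq> {}"
    using ex_is_arg_min_if_finite[OF fin, of ?f] assms(2) by blast
  ultimately have "Min ?S \<in> ?S" by (rule Min_in)
  then have "is_arg_min ?f (\<lambda>\<omega>. \<omega> \<in> ?A) (cell_round W w Q)" by (simp add: cell_round_def)
  then show ?thesis using assms(2) unfolding is_arg_min_linorder by blast
qed

context cube_mesh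
begin

text \<open>The boundary of the closed cell may lie outside \<Omega>, where nothing is known about
  \<open>w\<close>. Being negligible, it affects neither integrability nor the integral.\<close>

lemma cell_mean_eq:
  fixes w :: "'a \<Rightarrow> real"
  assumes w: "integrable (lebesgue_on \<Omega>) w" and z: "z \<in> Z"
  shows "cell_mean w (cell s z) = (LINT x|lebesgue_on (open_cell s z). w x) / s ^ DIM('a)"
proof -
  have "measure lebesgue (cell s z) = s ^ DIM('a)"
    using side_pos unfolding cell_def by (simp add: content_cbox_if inner_add_left box_ne_empty)
  moreover have "(LINT x|lebesgue_on (cell s z). w x) = (LINT x|lebesgue_on (open_cell s z). w x)"
  proof -
    have iz: "integrable (lebesgue_on (open_cell s z)) w" by (rule integrable_open_cell[OF w z])
    have oc: "open_cell s z - cell s z = {}" by (auto simp: mem_cell mem_open_cell less_imp_le)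
    have n: "negligible {x \<in> open_cell s z - cell s z. w x \<noteq> 0}" "negligible {x \<in> cell s z - open_cell s z. w x \<noteq> 0}"
      unfolding oc by (auto intro: negligible_subset[OF negligible_cell_minus_open_cell])
    have ic: "integrable (lebesgue_on (cell s z)) w"
      using absolutely_integrable_spike_set_eq[OF n] iz
      by (simp add: set_integrable_def integrable_lebesgue_on)
    show ?thesis
      using lebesgue_integral_eq_integral[OF ic] lebesgue_integral_eq_integral[OF iz] integral_spike_set[OF n] by simp
  qed
  ultimately show ?thesis by (simp add: cell_mean_def)
qed

lemma rounding_cell:
  assumes z: "z \<in> Z" and x: "x \<in> open_cell s z"
  shows "rounding W (cell s ` Z) w x = real_of_int (cell_round W w (cell s z))"
proof -
  have "(THE Q. Q \<in> cell s ` Z \<and> x \<in> interior Q) = cell s z"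
  proof (rule the_equality)
    show "cell s z \<in> cell s ` Z \<and> x \<in> interior (cell s z)" using z x by (simp add: interior_cell)
    fix Q assume "Q \<in> cell s ` Z \<and> x \<in> interior Q"
    then obtain z' where z': "z' \<in> Z" "Q = cell s z'" "x \<in> open_cell s z'" by (auto simp: interior_cell)
    then show "Q = cell s z" using cells_disjoint[OF z z'(1)] x by auto
  qed
  moreover have "\<exists>Q\<in>cell s ` Z. x \<in> interior Q" using z x by (auto simp: interior_cell)
  ultimately show ?thesis by (simp add: rounding_def)
qed

text \<open>Both sides are \<open>0\<close> at points in no open cell, so the identity holds
  everywhere and yields the measurability of the rounded function.\<close>

lemma rounding_eq_step:
  "rounding W (cell s ` Z) w x = (\<Sum>z\<in>Z. indicator (open_cell s z) x * real_of_int (cell_round W w (cell s z)))"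
proof (cases "\<exists>z\<in>Z. x \<in> open_cell s z")
  case True
  then obtain z where z: "z \<in> Z" "x \<in> open_cell s z" by auto
  then show ?thesis
    using sum_indicator_cells[OF z, of "\<lambda>z. real_of_int (cell_round W w (cell s z))"] rounding_cell[OF z] by simp
next
  case False
  then have "\<not> (\<exists>Q\<in>cell s ` Z. x \<in> interior Q)" by (simp add: interior_cell)
  then have "rounding W (cell s ` Z) w x = 0" unfolding rounding_def by (simp only: if_False)
  moreover have "(\<Sum>z\<in>Z. indicator (open_cell s z) x * real_of_int (cell_round W w (cell s z))) = 0"
    using False by (intro sum.neutral) auto
  ultimately show ?thesis by simp
qed

lemma rounding_integrable: "integrable (lebesgue_on \<Omega>) (rounding W (cell s ` Z) w)"
proof -
  have "integrable (lebesgue_on \<Omega>) (\<lambda>x. \<Sum>z\<in>Z. indicator (open_cell s z) x * real_of_int (cell_round W w (cell s z)))"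
  proof (rule integrable_lebesgue_on_bounded[OF domain_lmeasurable borel_measurable_lebesgue_on])
    show "(\<lambda>x. \<Sum>z\<in>Z. indicator (open_cell s z) x * real_of_int (cell_round W w (cell s z))) \<in> borel_measurable borel"
      by measurable
    show "AE x in lebesgue_on \<Omega>. norm (\<Sum>z\<in>Z. indicator (open_cell s z) x * real_of_int (cell_round W w (cell s z)))
       \<le> (\<Sum>z\<in>Z. \<bar>real_of_int (cell_round W w (cell s z))\<bar>)"
      by (intro AE_I2 order_trans[OF norm_sum] sum_mono) (auto simp: indicator_def)
  qed
  then show ?thesis using rounding_eq_step[of W w] by (simp cong: Bochner_Integration.integrable_cong)
qed

text \<open>Each of the finitely many values of \<open>W\<close> that is not attained on the cell
  has a null level set there. It justifies comparing the rounded value with \<open>w x\<close> for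
  almost every \<open>x\<close>.\<close>

lemma AE_attained:
  assumes w: "integrable (lebesgue_on \<Omega>) w" and W: "finite W"
    and vals: "AE x in lebesgue_on \<Omega>. w x \<in> real_of_int ` W" and z: "z \<in> Z"
  shows "AE x in lebesgue_on (open_cell s z). \<exists>v\<in>attained_values W w (cell s z). w x = real_of_int v"
proof -
  let ?N = "lebesgue_on (open_cell s z)"
  have wm: "w \<in> borel_measurable ?N" using integrable_open_cell[OF w z] by auto
  have "AE x in lebesgue. x \<in> open_cell s z \<longrightarrow> w x \<noteq> real_of_int v" if v: "v \<in> W - attained_values W w (cell s z)" for v
  proof -
    let ?E = "{x \<in> open_cell s z. w x = real_of_int v}" and ?C = "{x \<in> cell s z. w x = real_of_int v}"
    have "{x \<in> space ?N. w x = real_of_int v} \<in> sets ?N"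
      using wm by measurable
    then have E: "?E \<in> sets lebesgue" by (simp add: sets_restrict_space_iff)
    have "?C - ?E \<in> null_sets lebesgue"
      using negligible_subset[OF negligible_cell_minus_open_cell[of s z], of "?C - ?E"]
      by (auto simp: negligible_iff_null_sets[symmetric])
    then have CE: "?C - ?E \<in> sets lebesgue" by (rule null_setsD2)
    have sub: "?E \<subseteq> ?C" by (auto simp: mem_cell mem_open_cell less_imp_le)
    then have "?C = ?E \<union> (?C - ?E)" by blast
    \<comment> \<open>Measurability is essential here: \<open>emeasure\<close> is \<open>0\<close>
      by default on nonmeasurable sets, and monotonicity needs a measurable larger set.\<close>
    then have C: "?C \<in> sets lebesgue" using sets.Un[OF E CE] by simp
    have "emeasure lebesgue ?C = 0" using v by (simp add: attained_values_def)
    then have "emeasure lebesgue ?E = 0" using emeasure_mono[OF sub C] by simp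
    then have "?E \<in> null_sets lebesgue" using E by (rule null_setsI)
    from AE_not_in[OF this] show ?thesis by eventually_elim auto
  qed
  then have "AE x in lebesgue. \<forall>v\<in>W - attained_values W w (cell s z). x \<in> open_cell s z \<longrightarrow> w x \<noteq> real_of_int v"
    using W by (intro AE_finite_allI) auto
  then have 1: "AE x in ?N. \<forall>v\<in>W - attained_values W w (cell s z). w x \<noteq> real_of_int v"
    by (simp add: AE_lebesgue_on_iff)
  have 2: "AE x in ?N. w x \<in> real_of_int ` W"
    by (rule AE_lebesgue_on_subset[OF vals]) (use open_cell_subset[OF z] in auto)
  from 1 2 show ?thesis by eventually_elim auto
qed

text \<open>The factor \<open>2\<close> is the triangle inequality through the cell mean: both the
  rounded value and \<open>w x\<close> are within \<open>\<bar>w x - ?m z\<bar>\<close> of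
  it.\<close>

lemma rounding_error:
  assumes w: "integrable (lebesgue_on \<Omega>) w" and W: "finite W"
    and vals: "AE x in lebesgue_on \<Omega>. w x \<in> real_of_int ` W" and T: "TV \<Omega> w = ereal T"
  shows "(LINT x|lebesgue_on \<Omega>. \<bar>rounding W (cell s ` Z) w x - w x\<bar>) \<le> 2 * (2 ^ DIM('a) * DIM('a) * s * T)"
proof -
  let ?r = "rounding W (cell s ` Z) w"
  let ?m = "\<lambda>z. (LINT x|lebesgue_on (open_cell s z). w x) / s ^ DIM('a)"
  have ir: "integrable (lebesgue_on \<Omega>) (\<lambda>x. \<bar>?r x - w x\<bar>)"
    using rounding_integrable w by simp
  have "(LINT x|lebesgue_on \<Omega>. \<bar>?r x - w x\<bar>) = (\<Sum>z\<in>Z. LINT x|lebesgue_on (open_cell s z). \<bar>?r x - w x\<bar>)"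
    by (rule integral_domain_cells[OF ir])
  also have "\<dots> \<le> (\<Sum>z\<in>Z. 2 * (LINT x|lebesgue_on (open_cell s z). \<bar>w x - ?m z\<bar>))"
  proof (rule sum_mono)
    fix z assume z: "z \<in> Z"
    let ?N = "lebesgue_on (open_cell s z)"
    interpret finite_measure ?N
      by (rule finite_measure_lebesgue_on) (rule open_cell_lmeasurable)
    have "(LINT x|?N. \<bar>?r x - w x\<bar>) \<le> (LINT x|?N. 2 * \<bar>w x - ?m z\<bar>)"
    proof (rule integral_mono_AE)
      show "integrable ?N (\<lambda>x. \<bar>?r x - w x\<bar>)" by (rule integrable_open_cell[OF ir z])
      show "integrable ?N (\<lambda>x. 2 * \<bar>w x - ?m z\<bar>)" using integrable_open_cell[OF w z] by simp
      have "AE x in lebesgue. x \<in> open_cell s z \<longrightarrow> (\<exists>v\<in>attained_values W w (cell s z). w x = real_of_int v)"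
        using AE_attained[OF w W vals z] by (simp add: AE_lebesgue_on_iff)
      then have "AE x in lebesgue. x \<in> open_cell s z \<longrightarrow> \<bar>?r x - w x\<bar> \<le> 2 * \<bar>w x - ?m z\<bar>"
      proof eventually_elim
        case (elim x)
        show ?case
        proof
          assume x: "x \<in> open_cell s z"
          then obtain v where v: "v \<in> attained_values W w (cell s z)" "w x = real_of_int v" using elim by blast
          from cell_round_optimal[OF W v(1)] have "\<bar>?m z - ?r x\<bar> \<le> \<bar>?m z - w x\<bar>"
            unfolding cell_mean_eq[OF w z] rounding_cell[OF z x] v(2) .
          then have le: "\<bar>?r x - ?m z\<bar> \<le> \<bar>w x - ?m z\<bar>" by (simp only: abs_minus_commute)
          have "\<bar>?r x - w x\<bar> \<le> \<bar>?r x - ?m z\<bar> + \<bar>w x - ?m z\<bar>"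
            using abs_triangle_ineq4[of "?r x - ?m z" "w x - ?m z"] by simp
          also have "\<dots> \<le> \<bar>w x - ?m z\<bar> + \<bar>w x - ?m z\<bar>" by (rule add_right_mono[OF le])
          also have "\<dots> = 2 * \<bar>w x - ?m z\<bar>" by (rule mult_2[symmetric])
          finally show "\<bar>?r x - w x\<bar> \<le> 2 * \<bar>w x - ?m z\<bar>" .
        qed
      qed
      then show "AE x in ?N. \<bar>?r x - w x\<bar> \<le> 2 * \<bar>w x - ?m z\<bar>" by (simp add: AE_lebesgue_on_iff)
    qed
    then show "(LINT x|?N. \<bar>?r x - w x\<bar>) \<le> 2 * (LINT x|?N. \<bar>w x - ?m z\<bar>)" by simp
  qed
  also have "\<dots> \<le> 2 * (2 ^ DIM('a) * DIM('a) * s * T)"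
    using Poincare_mesh[OF w T] by (simp add: sum_distrib_left[symmetric])
  finally show ?thesis .
qed

end

section \<open>Assembling the lower bound for the discrete total variation\<close>

lemma Linf_bound:
  assumes "f \<in> Linf S"
  obtains M where "M \<ge> 0" "AE x in lebesgue_on S. norm (f x) \<le> M"
proof -
  have fin: "Linf_norm S f < \<infinity>" using assms by (simp add: Linf_def)
  have AE: "AE x in lebesgue_on S. ereal (norm (f x)) \<le> Linf_norm S f"
    unfolding Linf_norm_def by (rule esssup_AE)
  show thesis
  proof (rule that)
    show "AE x in lebesgue_on S. norm (f x) \<le> max 0 (real_of_ereal (Linf_norm S f))"
      using AE
    proof eventually_elim
      case (elim x)
      then show ?case using fin by (cases "Linf_norm S f") auto
    qed
  qed simp
qed

lemma TV_h_ge: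
  assumes "\<phi> \<in> RT0_0 \<Omega> \<Q>" "weak_div \<Omega> \<phi> g" "\<phi> \<in> borel_measurable borel" "\<And>x. norm (\<phi> x) \<le> 1"
  shows "ereal (LINT x|lebesgue_on \<Omega>. w x * g x) \<le> TV_h \<Omega> \<Q> w"
proof -
  have "Linf_norm \<Omega> \<phi> \<le> 1"
    unfolding Linf_norm_def
  proof (rule esssup_I)
    show "(\<lambda>x. ereal (norm (\<phi> x))) \<in> borel_measurable (lebesgue_on \<Omega>)"
      by (rule borel_measurable_lebesgue_on) (use assms(3) in measurable)
    show "AE x in lebesgue_on \<Omega>. ereal (norm (\<phi> x)) \<le> 1" using assms(4) by simp
  qed
  then show ?thesis unfolding TV_h_def using assms(1,2) by (intro Sup_upper) blast
qed

lemma TV_h_rounding_ge: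
  fixes \<Omega> :: "'a::euclidean_space set" and h t T M K :: real
  assumes Q: "cube_mesh \<Omega> h Zq" and P: "cube_mesh \<Omega> t Zp" and th: "t \<le> h"
    and w: "integrable (lebesgue_on \<Omega>) w" and W: "finite W"
    and vals: "AE x in lebesgue_on \<Omega>. w x \<in> real_of_int ` W"
    and T: "TV \<Omega> w = ereal T" and Tw: "T = - (LINT x|lebesgue_on \<Omega>. d x * w x)"
    and \<phi>: "integrable (lebesgue_on \<Omega>) \<phi>" "AE x in lebesgue_on \<Omega>. norm (\<phi> x) \<le> 1"
    and trace: "\<And>k. k \<in> Basis \<Longrightarrow> zero_trace_limit \<Omega> k (\<lambda>x. \<phi> x \<bullet> k) (D k)"
    and wp: "\<And>k. k \<in> Basis \<Longrightarrow> weak_partial \<Omega> k (\<lambda>x. \<phi> x \<bullet> k) (D k)"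
    and wv: "\<And>k. k \<in> Basis \<Longrightarrow> weak_partial \<Omega> k (\<lambda>x. \<phi> x \<bullet> k) (v k)"
    and v: "\<And>k. k \<in> Basis \<Longrightarrow> integrable (lebesgue_on \<Omega>) (v k)"
    and M: "\<And>k. k \<in> Basis \<Longrightarrow> AE x in lebesgue_on \<Omega>. \<bar>v k x\<bar> \<le> M" "M \<ge> 0"
    and d: "weak_div \<Omega> \<phi> d" "integrable (lebesgue_on \<Omega>) d"
  defines "K \<equiv> real DIM('a) * M"
  shows "TV_h \<Omega> (cell h ` Zq) (rounding W (cell t ` Zp) w)
    \<ge> ereal (T - (4 * K * (2 ^ DIM('a) * DIM('a)) * T + K * T) * h)"
proof -
  interpret Q: cube_mesh \<Omega> h Zq by (rule Q)
  interpret P: cube_mesh \<Omega> t Zp by (rule P)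
  let ?r = "rounding W (cell t ` Zp) w"
  let ?O = "\<lambda>z. lebesgue_on (open_cell h z)"
  have h: "h > 0" by (rule Q.side_pos)
  have T0: "T \<ge> 0" by (rule TV_nonneg[OF T])
  have K0: "K \<ge> 0" using M by (simp add: K_def)
  have iD: "integrable (lebesgue_on \<Omega>) (D k)" if "k \<in> Basis" for k
    using trace[OF that] by (simp add: zero_trace_limit_def)
  \<comment> \<open>\<open>D\<close> comes with the approximating sequence and is only known to be
    integrable, while \<open>v\<close> carries the essential bound. Uniqueness of weak derivatives
    transfers the bound to \<open>D\<close>.\<close>
  have DM: "AE x in lebesgue_on \<Omega>. \<bar>D k x\<bar> \<le> M" if k: "k \<in> Basis" for k
    using Q.weak_partial_unique[OF wp[OF k] wv[OF k] iD[OF k] v[OF k]] M(1)[OF k] by eventually_elim simp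
  have dD: "AE x in lebesgue_on \<Omega>. d x = (\<Sum>k\<in>Basis. D k x)"
    by (rule Q.weak_div_eq_sum_partials[OF \<phi>(1) d wp iD])
  have "AE x in lebesgue_on \<Omega>. \<forall>k\<in>Basis. \<bar>D k x\<bar> \<le> M"
    using DM by (intro AE_finite_allI) auto
  with dD have dK: "AE x in lebesgue_on \<Omega>. \<bar>d x\<bar> \<le> K"
  proof eventually_elim
    case (elim x)
    have "\<bar>d x\<bar> \<le> (\<Sum>k\<in>(Basis::'a set). \<bar>D k x\<bar>)" unfolding elim(1) by (rule sum_abs)
    also have "\<dots> \<le> (\<Sum>k\<in>(Basis::'a set). M)" using elim(2) by (intro sum_mono) auto
    finally show ?case by (simp add: K_def)
  qed
  \<comment> \<open>The denominator is the norm bound of the unscaled interpolant, as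
    \<open>K * h\<close> is the dimension times \<open>h * M\<close>. The sign matches the minus in
    the representation of \<open>T\<close>.\<close>
  define l where "l = - 1 / (1 + K * h)"
  have Kh: "1 + K * h > 0" using K0 h by (simp add: add_pos_nonneg)
  define \<Phi> where "\<Phi> = Q.rt_field l \<phi> D"
  define G where "G = Q.rt_div l \<phi> D"
  have b: "norm (\<Phi> x) \<le> 1" for x
  proof -
    have "norm (\<Phi> x) \<le> \<bar>l\<bar> * (1 + DIM('a) * h * M)"
      unfolding \<Phi>_def by (rule Q.rt_field_norm_le[OF \<phi>(1) iD \<phi>(2) DM M(2)])
    also have "\<dots> = 1" using Kh by (simp add: l_def K_def mult_ac)
    finally show ?thesis .
  qed
  have TVh: "ereal (LINT x|lebesgue_on \<Omega>. ?r x * G x) \<le> TV_h \<Omega> (cell h ` Zq) ?r"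
    by (rule TV_h_ge[of \<Phi>]) (use Q.rt_field_RT0_0[OF trace, of l 1] Q.rt_field_weak_div[OF trace, of l 1] b in \<open>simp_all add: \<Phi>_def G_def\<close>)
  define \<mu> where "\<mu> z = (LINT x|?O z. d x) / h ^ DIM('a)" for z
  have G: "G x = l * \<mu> z" if z: "z \<in> Zq" "x \<in> open_cell h z" for x z
  proof -
    have "(LINT x|?O z. (\<Sum>k\<in>Basis. D k x)) = (LINT x|?O z. d x)"
    proof (rule integral_cong_AE)
      have "AE x in ?O z. d x = (\<Sum>k\<in>Basis. D k x)"
        by (rule AE_lebesgue_on_subset[OF dD]) (use Q.open_cell_subset[OF z(1)] in auto)
      then show "AE x in ?O z. (\<Sum>k\<in>Basis. D k x) = d x" by eventually_elim simp
      show "(\<lambda>x. \<Sum>k\<in>Basis. D k x) \<in> borel_measurable (?O z)"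
        by (intro borel_measurable_sum borel_measurable_integrable Q.integrable_open_cell iD z)
      show "d \<in> borel_measurable (?O z)"
        by (intro borel_measurable_integrable Q.integrable_open_cell d z)
    qed
    then show ?thesis unfolding G_def \<mu>_def using Q.rt_div_eq_mean[OF \<phi>(1) iD z] by simp
  qed
  have ir: "integrable (lebesgue_on \<Omega>) ?r" by (rule P.rounding_integrable)
  obtain B where B: "\<And>x. \<bar>G x\<bar> \<le> B" unfolding G_def using Q.rt_div_bounded by blast
  have irG: "integrable (lebesgue_on \<Omega>) (\<lambda>x. ?r x * G x)"
    using Q.integrable_bounded_mult[of G B \<Omega> ?r] B ir unfolding G_def by (simp add: mult.commute)
  have idw: "integrable (lebesgue_on \<Omega>) (\<lambda>x. d x * w x)"
  proof (rule Bochner_Integration.integrable_bound)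
    show "integrable (lebesgue_on \<Omega>) (\<lambda>x. K * w x)" using w by simp
    show "(\<lambda>x. d x * w x) \<in> borel_measurable (lebesgue_on \<Omega>)"
      by (intro borel_measurable_times borel_measurable_integrable d w)
    show "AE x in lebesgue_on \<Omega>. norm (d x * w x) \<le> norm (K * w x)"
      using dK by eventually_elim (use K0 in \<open>auto simp: abs_mult intro!: mult_right_mono\<close>)
  qed
  \<comment> \<open>The accumulated error of using cell means of \<open>d\<close> and the rounded
    function in place of \<open>d\<close> and \<open>w\<close>; with \<open>A = 0\<close> the
    competitor would give \<open>T / (1 + K * h)\<close>.\<close>
  define A where "A = (\<Sum>z\<in>Zq. \<mu> z * (LINT x|?O z. ?r x) - (LINT x|?O z. d x * w x))"
  have rG: "(LINT x|lebesgue_on \<Omega>. ?r x * G x) = l * (A - T)"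
  proof -
    have "(LINT x|lebesgue_on \<Omega>. ?r x * G x) = (\<Sum>z\<in>Zq. LINT x|?O z. ?r x * G x)"
      by (rule Q.integral_domain_cells[OF irG])
    also have "\<dots> = (\<Sum>z\<in>Zq. l * (\<mu> z * (LINT x|?O z. ?r x)))"
    proof (rule sum.cong[OF refl])
      fix z assume z: "z \<in> Zq"
      have "(LINT x|?O z. ?r x * G x) = (LINT x|?O z. (l * \<mu> z) * ?r x)"
        by (rule Bochner_Integration.integral_cong[OF refl]) (simp add: G[OF z])
      then show "(LINT x|?O z. ?r x * G x) = l * (\<mu> z * (LINT x|?O z. ?r x))" by simp
    qed
    also have "\<dots> = l * (A + (\<Sum>z\<in>Zq. LINT x|?O z. d x * w x))"
      by (simp add: A_def sum_subtractf sum_distrib_left)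
    also have "(\<Sum>z\<in>Zq. LINT x|?O z. d x * w x) = - T"
      unfolding Tw by (simp add: Q.integral_domain_cells[OF idw])
    finally show ?thesis by simp
  qed
  \<comment> \<open>Of the \<open>4 * K\<close>, one half is \<open>K\<close> times the factor
    \<open>2\<close> of the rounding error on the input mesh, where \<open>t \<le> h\<close> is
    used, and the other half is the \<open>2 * K\<close> of \<open>mean_oscillation\<close> on the
    TV mesh.\<close>
  define E where "E = 4 * K * (2 ^ DIM('a) * DIM('a)) * T"
  have A: "\<bar>A\<bar> \<le> E * h"
  proof -
    have irw: "integrable (lebesgue_on \<Omega>) (\<lambda>x. \<bar>?r x - w x\<bar>)" using ir w by simp
    have "\<bar>\<mu> z * (LINT x|?O z. ?r x) - (LINT x|?O z. d x * w x)\<bar>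
      \<le> K * (LINT x|?O z. \<bar>?r x - w x\<bar>) + 2 * K * (LINT x|?O z. \<bar>w x - (LINT x|?O z. w x) / h ^ DIM('a)\<bar>)"
      if z: "z \<in> Zq" for z
    proof -
      note irz = Q.integrable_open_cell[OF ir z] and iwz = Q.integrable_open_cell[OF w z]
      have dKz: "AE x in ?O z. \<bar>d x\<bar> \<le> K"
        by (rule AE_lebesgue_on_subset[OF dK]) (use Q.open_cell_subset[OF z] in auto)
      note osc = mean_oscillation[OF h iwz Q.integrable_open_cell[OF d(2) z] dKz, folded \<mu>_def]
      \<comment> \<open>Under the constant weight \<open>\<mu> z\<close> the rounded function is
        exchanged for \<open>w\<close>, at the cost of the rounding error. What remains is the
        oscillation term, taken with the cell mean of \<open>w\<close> as the constant.\<close>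
      have "\<mu> z * (LINT x|?O z. ?r x) - (LINT x|?O z. d x * w x)
        = \<mu> z * (LINT x|?O z. ?r x - w x) + (\<mu> z * (LINT x|?O z. w x) - (LINT x|?O z. d x * w x))"
        using irz iwz by (simp add: right_diff_distrib)
      moreover have "\<bar>\<mu> z * (LINT x|?O z. ?r x - w x)\<bar> \<le> K * (LINT x|?O z. \<bar>?r x - w x\<bar>)"
        unfolding abs_mult using osc(2) K0 by (intro mult_mono integral_abs_bound) auto
      ultimately show ?thesis
        using osc(1)[of "(LINT x|?O z. w x) / h ^ DIM('a)"] by linarith
    qed
    then have "\<bar>A\<bar> \<le> (\<Sum>z\<in>Zq. K * (LINT x|?O z. \<bar>?r x - w x\<bar>) + 2 * K * (LINT x|?O z. \<bar>w x - (LINT x|?O z. w x) / h ^ DIM('a)\<bar>))"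
      unfolding A_def by (intro order_trans[OF sum_abs] sum_mono)
    also have "\<dots> = K * (LINT x|lebesgue_on \<Omega>. \<bar>?r x - w x\<bar>) + 2 * K * (\<Sum>z\<in>Zq. LINT x|?O z. \<bar>w x - (LINT x|?O z. w x) / h ^ DIM('a)\<bar>)"
      by (simp add: sum.distrib sum_distrib_left Q.integral_domain_cells[OF irw])
    also have "\<dots> \<le> K * (2 * (2 ^ DIM('a) * DIM('a) * t * T)) + 2 * K * (2 ^ DIM('a) * DIM('a) * h * T)"
      using K0 by (intro add_mono mult_left_mono P.rounding_error[OF w W vals T] Q.Poincare_mesh[OF w T]) auto
    also have "\<dots> \<le> K * (2 * (2 ^ DIM('a) * DIM('a) * h * T)) + 2 * K * (2 ^ DIM('a) * DIM('a) * h * T)"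
      using K0 T0 th by (intro add_mono mult_left_mono mult_right_mono) auto
    also have "\<dots> = E * h" by (simp add: E_def)
    finally show ?thesis .
  qed
  have E0: "E \<ge> 0" using K0 T0 by (simp add: E_def)
  have "T - (E + K * T) * h \<le> l * (A - T)"
  proof -
    \<comment> \<open>The summand \<open>K * T\<close> is the price of the scaling: after
      multiplication by \<open>1 + K * h\<close> the terms \<open>K * T * h\<close> cancel, and all
      further terms have a favourable sign.\<close>
    have "(T - (E + K * T) * h) * (1 + K * h) = T - E * h - (K * h * (E * h) + (K * h) * (K * h) * T)"
      by (simp add: algebra_simps)
    also have "\<dots> \<le> T - E * h"
    proof -
      have "0 \<le> K * h * (E * h)" "0 \<le> (K * h) * (K * h) * T" using K0 E0 T0 h by simp_all
      then show ?thesis by linarith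
    qed
    also have "\<dots> \<le> T - A" using A by linarith
    finally have "T - (E + K * T) * h \<le> (T - A) / (1 + K * h)" using Kh by (simp add: pos_le_divide_eq)
    also have "\<dots> = l * (A - T)" unfolding l_def by (simp only: times_divide_eq_left mult_minus1 minus_diff_eq)
    finally show ?thesis .
  qed
  then have "ereal (T - (E + K * T) * h) \<le> ereal (LINT x|lebesgue_on \<Omega>. ?r x * G x)" unfolding rG by simp
  then show ?thesis using TVh unfolding E_def by (rule order_trans)
qed

theorem proposition2p15:
  fixes \<Omega> :: "'a::euclidean_space set"
    and W :: "int set"
    and w :: "'a \<Rightarrow> real"
    and \<phi> :: "'a \<Rightarrow> 'a"
    and div_\<phi> :: "'a \<Rightarrow> real"
  assumes "DIM('a) \<in> {1, 2, 3}"
    and "bounded_lipschitz_domain \<Omega>"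
    and "finite_union_of_cubes \<Omega>"
    and "finite W" and "W \<noteq> {}"
    and "w \<in> BV_W W \<Omega>"
    and "\<phi> \<in> W1inf_0 \<Omega>"
    and "Linf_norm \<Omega> \<phi> \<le> 1"
    and "weak_div \<Omega> \<phi> div_\<phi>"
    and "TV \<Omega> w = ereal (- (LINT x|lebesgue_on \<Omega>. div_\<phi> x * w x))"
    and "div_\<phi> \<in> H1 \<Omega>"
  shows "\<exists>c>0. \<forall>H \<tau> \<Q> \<P>. admissible_family \<Omega> H \<tau> \<Q> \<P> \<longrightarrow>
           (\<forall>h\<in>H. TV_h \<Omega> (\<Q> h) (rounding W (\<P> h) w)
                    \<ge> TV \<Omega> w - ereal (c * (h\<^sup>2 + h + \<tau> h / h)))"
proof -
  note w = assms(6) and \<phi> = assms(7) and \<phi>1 = assms(8) and div = assms(9)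
  have "open \<Omega>" "bounded \<Omega>" using assms(2) by (auto simp: bounded_lipschitz_domain_def)
  then have lm: "\<Omega> \<in> lmeasurable" by (intro lmeasurable_open)
  have w1: "integrable (lebesgue_on \<Omega>) w" and wW: "AE x in lebesgue_on \<Omega>. w x \<in> real_of_int ` W"
    using w by (simp_all add: BV_W_def L1_def)
  define T where "T = - (LINT x|lebesgue_on \<Omega>. div_\<phi> x * w x)"
  have T: "TV \<Omega> w = ereal T" using assms(10) by (simp add: T_def)
  have d1: "integrable (lebesgue_on \<Omega>) div_\<phi>"
    using assms(11) L2_imp_L1[OF lm] by (simp add: H1_def sobolev1_def)
  have comp: "(\<lambda>x. \<phi> x \<bullet> k) \<in> sobolev1 \<Omega> (Linf \<Omega>)" "(\<lambda>x. \<phi> x \<bullet> k) \<in> W11_0 \<Omega>" if "k \<in> Basis" for k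
    using \<phi> that by (auto simp: W1inf_0_def)
  have \<phi>i: "integrable (lebesgue_on \<Omega>) \<phi>"
  proof -
    have "integrable (lebesgue_on \<Omega>) (\<lambda>x. \<Sum>k\<in>Basis. (\<phi> x \<bullet> k) *\<^sub>R k)"
      using comp(2) by (intro Bochner_Integration.integrable_sum integrable_scaleR_left) (simp add: W11_0_def L1_def)
    then show ?thesis by (simp add: euclidean_representation)
  qed
  have \<phi>n: "AE x in lebesgue_on \<Omega>. norm (\<phi> x) \<le> 1"
  proof -
    have "AE x in lebesgue_on \<Omega>. ereal (norm (\<phi> x)) \<le> Linf_norm \<Omega> \<phi>"
      unfolding Linf_norm_def by (rule esssup_AE)
    then show ?thesis
    proof eventually_elim
      case (elim x)
      then have "ereal (norm (\<phi> x)) \<le> 1" using \<phi>1 by (rule order_trans)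
      then show ?case by simp
    qed
  qed
  have "\<exists>v. v \<in> Linf \<Omega> \<and> weak_partial \<Omega> k (\<lambda>x. \<phi> x \<bullet> k) v" if "k \<in> Basis" for k
    using comp(1)[OF that] that by (auto simp: sobolev1_def)
  then have "\<forall>k\<in>Basis. \<exists>v. v \<in> Linf \<Omega> \<and> weak_partial \<Omega> k (\<lambda>x. \<phi> x \<bullet> k) v" by blast
  then have "\<exists>v. \<forall>k\<in>Basis. v k \<in> Linf \<Omega> \<and> weak_partial \<Omega> k (\<lambda>x. \<phi> x \<bullet> k) (v k)" by (rule bchoice)
  then obtain v where "\<forall>k\<in>Basis. v k \<in> Linf \<Omega> \<and> weak_partial \<Omega> k (\<lambda>x. \<phi> x \<bullet> k) (v k)" by (rule exE)
  then have v: "\<And>k. k \<in> Basis \<Longrightarrow> v k \<in> Linf \<Omega>" "\<And>k. k \<in> Basis \<Longrightarrow> weak_partial \<Omega> k (\<lambda>x. \<phi> x \<bullet> k) (v k)"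
    by simp_all
  have "\<exists>m. m \<ge> 0 \<and> (AE x in lebesgue_on \<Omega>. norm (v k x) \<le> m)" if "k \<in> Basis" for k
    using Linf_bound[OF v(1)[OF that]] by metis
  then have "\<forall>k\<in>Basis. \<exists>m. m \<ge> 0 \<and> (AE x in lebesgue_on \<Omega>. norm (v k x) \<le> m)" by blast
  then have "\<exists>m. \<forall>k\<in>Basis. m k \<ge> 0 \<and> (AE x in lebesgue_on \<Omega>. norm (v k x) \<le> m k)" by (rule bchoice)
  then obtain m where "\<forall>k\<in>Basis. m k \<ge> 0 \<and> (AE x in lebesgue_on \<Omega>. norm (v k x) \<le> m k)" by (rule exE)
  then have m: "\<And>k. k \<in> Basis \<Longrightarrow> m k \<ge> 0" "\<And>k. k \<in> Basis \<Longrightarrow> AE x in lebesgue_on \<Omega>. norm (v k x) \<le> m k"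
    by simp_all
  define M where "M = (\<Sum>k\<in>Basis. m k)"
  have M0: "M \<ge> 0" unfolding M_def using m(1) by (rule sum_nonneg)
  have vM: "AE x in lebesgue_on \<Omega>. \<bar>v k x\<bar> \<le> M" if k: "k \<in> Basis" for k
  proof -
    have "m k \<le> M" unfolding M_def using m(1) k by (intro member_le_sum) auto
    with m(2)[OF k] show ?thesis by (auto elim!: eventually_mono)
  qed
  have vi: "integrable (lebesgue_on \<Omega>) (v k)" if k: "k \<in> Basis" for k
    by (rule integrable_lebesgue_on_bounded[OF lm _ m(2)[OF k]]) (use v(1)[OF k] in \<open>simp add: Linf_def\<close>)
  have "\<exists>D. weak_partial \<Omega> k (\<lambda>x. \<phi> x \<bullet> k) D \<and> zero_trace_limit \<Omega> k (\<lambda>x. \<phi> x \<bullet> k) D" if k: "k \<in> Basis" for k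
    using W11_0_zero_trace_limit[OF \<open>open \<Omega>\<close> comp(2)[OF k]] k by metis
  then have "\<forall>k\<in>Basis. \<exists>D. weak_partial \<Omega> k (\<lambda>x. \<phi> x \<bullet> k) D \<and> zero_trace_limit \<Omega> k (\<lambda>x. \<phi> x \<bullet> k) D" by blast
  then have "\<exists>D. \<forall>k\<in>Basis. weak_partial \<Omega> k (\<lambda>x. \<phi> x \<bullet> k) (D k) \<and> zero_trace_limit \<Omega> k (\<lambda>x. \<phi> x \<bullet> k) (D k)" by (rule bchoice)
  then obtain D where "\<forall>k\<in>Basis. weak_partial \<Omega> k (\<lambda>x. \<phi> x \<bullet> k) (D k) \<and> zero_trace_limit \<Omega> k (\<lambda>x. \<phi> x \<bullet> k) (D k)"
    by (rule exE)
  then have D: "\<And>k. k \<in> Basis \<Longrightarrow> weak_partial \<Omega> k (\<lambda>x. \<phi> x \<bullet> k) (D k)"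
    "\<And>k. k \<in> Basis \<Longrightarrow> zero_trace_limit \<Omega> k (\<lambda>x. \<phi> x \<bullet> k) (D k)"
    by simp_all
  define K where "K = real DIM('a) * M"
  \<comment> \<open>The summand \<open>1\<close> keeps \<open>c\<close> positive when
    \<open>T\<close> or \<open>M\<close> is \<open>0\<close>.\<close>
  define c where "c = 4 * K * (2 ^ DIM('a) * DIM('a)) * T + K * T + 1"
  have T0: "T \<ge> 0" by (rule TV_nonneg[OF T])
  have c: "c > 0" using M0 T0 by (simp add: c_def K_def add_nonneg_pos)
  show ?thesis
  proof (intro exI[of _ c] conjI c allI impI ballI)
    fix H \<tau> \<Q> \<P> h
    assume fam: "admissible_family \<Omega> H \<tau> \<Q> \<P>" and h: "h \<in> H"
    then have pair: "admissible_mesh_pair \<Omega> h (\<tau> h) (\<Q> h) (\<P> h)" by (simp add: admissible_family_def)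
    then have hp: "h > 0" "\<tau> h > 0" "\<tau> h \<le> h" and mesh: "is_mesh \<Omega> h (\<Q> h)" "is_mesh \<Omega> (\<tau> h) (\<P> h)"
      by (simp_all add: admissible_mesh_pair_def)
    note Q = is_mesh_imp_cube_mesh[OF mesh(1) assms(2)] and P = is_mesh_imp_cube_mesh[OF mesh(2) assms(2)]
    have "ereal (T - (4 * K * (2 ^ DIM('a) * DIM('a)) * T + K * T) * h) \<le> TV_h \<Omega> (\<Q> h) (rounding W (\<P> h) w)"
      using TV_h_rounding_ge[OF Q(1) P(1) hp(3) w1 assms(4) wW T T_def \<phi>i \<phi>n D(2) D(1) v(2) vi vM M0 div d1]
      unfolding Q(2)[symmetric] P(2)[symmetric] K_def .
    moreover have "T - c * (h\<^sup>2 + h + \<tau> h / h) \<le> T - (4 * K * (2 ^ DIM('a) * DIM('a)) * T + K * T) * h"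
    proof -
      have "(4 * K * (2 ^ DIM('a) * DIM('a)) * T + K * T) * h \<le> c * h"
        using hp by (intro mult_right_mono) (auto simp: c_def)
      also have "\<dots> \<le> c * (h\<^sup>2 + h + \<tau> h / h)" using hp c by (intro mult_left_mono) auto
      finally show ?thesis by linarith
    qed
    ultimately show "TV \<Omega> w - ereal (c * (h\<^sup>2 + h + \<tau> h / h)) \<le> TV_h \<Omega> (\<Q> h) (rounding W (\<P> h) w)"
      unfolding T by (metis ereal_less_eq(3) ereal_minus(1) order_trans)
  qed
qed

end
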